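(* There exists a fully retroactive data structure for maintaining the maximum degree of a graph with amortized $O(\log^2 T)$ update time per retroactive operation and worst-case $O(n\log T)$ query time.
   Context: Setting: a graph with edge weights on a fixed vertex set of $n$ vertices, initially empty. The data structure maintains a sequence $S$ of updates (weighted edge insertions and deletions), each with a distinct real time; $T=|S|$. Operations: $\textsf{Create}(\text{update},t)$ adds an update (insertion or deletion) at time $t$, $\textsf{Cancel}(t)$ removes the update at time $t$; all operations are legal. A query at time $t$ asks for the maximum (weighted) degree of the graph $G_t$ obtained by applying, in time order, the updates with time at most $t$. Word RAM with word size $O(\log n)$; $T$ and weights polynomial in $n$. *)

theory Defs
  imports Complex_Main "HOL-Library.Log_Nat"
begin

text \<open>Simple undirected graphs on the vertex set \<open>{..<n}\<close> with integer edge weights: the domain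
  of the map is the edge set, an edge being a two-element set of vertices.\<close>

type_synonym wgraph = "nat set \<rightharpoonup> int"

definition weighted_degree :: "wgraph \<Rightarrow> nat \<Rightarrow> int" where
  "weighted_degree G v = (\<Sum>e \<in> {e \<in> dom G. v \<in> e}. the (G e))"

definition max_degree :: "nat \<Rightarrow> wgraph \<Rightarrow> int" where
  "max_degree n G = Max (weighted_degree G ` {..<n})"

datatype upd =
    Insert nat nat int
  | Delete nat nat

fun apply_upd :: "upd \<Rightarrow> wgraph \<Rightarrow> wgraph" where
  "apply_upd (Insert u v x) G = G({u, v} \<mapsto> x)"
| "apply_upd (Delete u v) G = G({u, v} := None)"

text \<open>The sequence \<open>S\<close> of updates is a map from times to updates, so that distinct updates have
  distinct times; \<open>T\<close> is the cardinality of its domain.\<close>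

type_synonym timeline = "real \<rightharpoonup> upd"

definition replay :: "timeline \<Rightarrow> real set \<Rightarrow> wgraph" where
  "replay S A = fold (\<lambda>t. apply_upd (the (S t))) (sorted_list_of_set A) Map.empty"

definition graph_at :: "timeline \<Rightarrow> real \<Rightarrow> wgraph" where
  "graph_at S t = replay S {t' \<in> dom S. t' \<le> t}"

definition graph_before :: "timeline \<Rightarrow> real \<Rightarrow> wgraph" where
  "graph_before S t = replay S {t' \<in> dom S. t' < t}"

text \<open>\<open>B\<close> bounds the absolute values of the weights.\<close>

fun legal_upd :: "nat \<Rightarrow> nat \<Rightarrow> wgraph \<Rightarrow> upd \<Rightarrow> bool" where
  "legal_upd n B G (Insert u v x) \<longleftrightarrow>
     u < n \<and> v < n \<and> u \<noteq> v \<and> {u, v} \<notin> dom G \<and> \<bar>x\<bar> \<le> int B"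
| "legal_upd n B G (Delete u v) \<longleftrightarrow> {u, v} \<in> dom G"

definition legal_timeline :: "nat \<Rightarrow> nat \<Rightarrow> timeline \<Rightarrow> bool" where
  "legal_timeline n B S \<longleftrightarrow>
     (\<forall>t \<in> dom S. legal_upd n B (graph_before S t) (the (S t)))"

datatype request =
    Create upd real
  | Cancel real
  | Query real

fun is_query :: "request \<Rightarrow> bool" where
  "is_query (Query t) = True"
| "is_query _ = False"

fun apply_request :: "request \<Rightarrow> timeline \<Rightarrow> timeline" where
  "apply_request (Create u t) S = S(t \<mapsto> u)"
| "apply_request (Cancel t) S = S(t := None)"
| "apply_request (Query t) S = S"

definition timeline_after :: "request list \<Rightarrow> timeline" where
  "timeline_after rs = fold apply_request rs Map.empty"

definition legal_requests :: "nat \<Rightarrow> nat \<Rightarrow> request list \<Rightarrow> bool" where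
  "legal_requests n B rs \<longleftrightarrow> (\<forall>i < length rs.
     let S = timeline_after (take i rs); S' = timeline_after (take (Suc i) rs) in
       (\<forall>u t. rs ! i = Create u t \<longrightarrow> t \<notin> dom S) \<and>
       (\<forall>t. rs ! i = Cancel t \<longrightarrow> t \<in> dom S) \<and>
       legal_timeline n B S' \<and> card (dom S') \<le> B)"

text \<open>Programs for a word RAM with structured control flow. Words are signed \<open>w\<close>-bit integers in
  two's complement, and every word is a valid memory address. The times are real numbers and
  do not fit into words, so they are kept in separate registers and a separate memory, and can only
  be moved and compared. A program mentions finitely many registers.\<close>

datatype binop = Add | Sub | Mul | Div | Mod | And | Or | Xor | Shl | Shr

fun binop_val :: "binop \<Rightarrow> int \<Rightarrow> int \<Rightarrow> int" where
  "binop_val Add x y = x + y"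
| "binop_val Sub x y = x - y"
| "binop_val Mul x y = x * y"
| "binop_val Div x y = x div y"
| "binop_val Mod x y = x mod y"
| "binop_val And x y = and x y"
| "binop_val Or x y = or x y"
| "binop_val Xor x y = xor x y"
| "binop_val Shl x y = push_bit (nat y) x"
| "binop_val Shr x y = drop_bit (nat y) x"

datatype instr =
    Const nat int
  | Move nat nat
  | Op binop nat nat nat
  | Load nat nat
  | Store nat nat
  | TMove nat nat
  | TLoad nat nat
  | TStore nat nat

datatype test =
    Eq nat nat
  | Less nat nat
  | TEq nat nat
  | TLess nat nat

datatype prog =
    Skip
  | Instr instr
  | Seq prog prog
  | Cond test prog prog
  | While test prog

record state =
  reg :: "nat \<Rightarrow> int"
  mem :: "int \<Rightarrow> int"
  treg :: "nat \<Rightarrow> real"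
  tmem :: "int \<Rightarrow> real"

definition wrap :: "nat \<Rightarrow> int \<Rightarrow> int" where
  "wrap w x = signed_take_bit (w - 1) x"

definition set_reg :: "nat \<Rightarrow> nat \<Rightarrow> int \<Rightarrow> state \<Rightarrow> state" where
  "set_reg w r x s = s\<lparr>reg := (reg s)(r := wrap w x)\<rparr>"

definition set_treg :: "nat \<Rightarrow> real \<Rightarrow> state \<Rightarrow> state" where
  "set_treg r t s = s\<lparr>treg := (treg s)(r := t)\<rparr>"

text \<open>In the four memory instructions the second argument is the register that holds the
  address.\<close>

fun step :: "nat \<Rightarrow> instr \<Rightarrow> state \<Rightarrow> state" where
  "step w (Const r k) s = set_reg w r k s"
| "step w (Move r q) s = set_reg w r (reg s q) s"
| "step w (Op f r p q) s = set_reg w r (binop_val f (reg s p) (reg s q)) s"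
| "step w (Load r q) s = set_reg w r (mem s (reg s q)) s"
| "step w (Store r q) s = s\<lparr>mem := (mem s)(reg s q := reg s r)\<rparr>"
| "step w (TMove r q) s = set_treg r (treg s q) s"
| "step w (TLoad r q) s = set_treg r (tmem s (reg s q)) s"
| "step w (TStore r q) s = s\<lparr>tmem := (tmem s)(reg s q := treg s r)\<rparr>"

fun test_val :: "test \<Rightarrow> state \<Rightarrow> bool" where
  "test_val (Eq p q) s \<longleftrightarrow> reg s p = reg s q"
| "test_val (Less p q) s \<longleftrightarrow> reg s p < reg s q"
| "test_val (TEq p q) s \<longleftrightarrow> treg s p = treg s q"
| "test_val (TLess p q) s \<longleftrightarrow> treg s p < treg s q"

text \<open>\<open>exec w p s k s'\<close>: with word size \<open>w\<close>, program \<open>p\<close> started in \<open>s\<close> halts in \<open>s'\<close> after \<open>k\<close> time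
  units; every instruction executed and every test evaluated costs one unit.\<close>

inductive exec :: "nat \<Rightarrow> prog \<Rightarrow> state \<Rightarrow> nat \<Rightarrow> state \<Rightarrow> bool" for w :: nat where
  exec_Skip: "exec w Skip s 1 s"
| exec_Instr: "exec w (Instr i) s 1 (step w i s)"
| exec_Seq: "exec w p s k s' \<Longrightarrow> exec w q s' l s'' \<Longrightarrow> exec w (Seq p q) s (k + l) s''"
| exec_Cond_True:
    "test_val b s \<Longrightarrow> exec w p s k s' \<Longrightarrow> exec w (Cond b p q) s (Suc k) s'"
| exec_Cond_False:
    "\<not> test_val b s \<Longrightarrow> exec w q s k s' \<Longrightarrow> exec w (Cond b p q) s (Suc k) s'"
| exec_While_False: "\<not> test_val b s \<Longrightarrow> exec w (While b p) s 1 s"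
| exec_While_True:
    "test_val b s \<Longrightarrow> exec w p s k s' \<Longrightarrow> exec w (While b p) s' l s'' \<Longrightarrow>
     exec w (While b p) s (Suc (k + l)) s''"

inductive_cases exec_SkipE: "exec w Skip s k s'"
inductive_cases exec_InstrE: "exec w (Instr i) s k s'"
inductive_cases exec_SeqE: "exec w (Seq p q) s k s'"
inductive_cases exec_CondE: "exec w (Cond b p q) s k s'"
inductive_cases exec_WhileE: "exec w (While b p) s k s'"

lemma exec_deterministic:
  "exec w p s k s' \<Longrightarrow> exec w p s l s'' \<Longrightarrow> l = k \<and> s'' = s'"
proof (induction arbitrary: l s'' rule: exec.induct)
  case (exec_Skip s)
  then show ?case by (rule exec_SkipE) simp
next
  case (exec_Instr i s)
  then show ?case by (rule exec_InstrE) simp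
next
  case (exec_Seq p s k1 s1 q k2 s2)
  from exec_Seq.prems show ?case
  proof (rule exec_SeqE)
    fix l1 t l2
    assume "l = l1 + l2" "exec w p s l1 t" "exec w q t l2 s''"
    with exec_Seq.IH(1)[of l1 t] exec_Seq.IH(2)[of l2 s''] show ?thesis by simp
  qed
next
  case (exec_Cond_True b s p k s' q)
  from exec_Cond_True.prems show ?case
  proof (rule exec_CondE)
    fix m assume "l = Suc m" "exec w p s m s''"
    with exec_Cond_True.IH[of m s''] show ?thesis by simp
  qed (use exec_Cond_True.hyps in simp)
next
  case (exec_Cond_False b s q k s' p)
  from exec_Cond_False.prems show ?case
  proof (rule exec_CondE)
    fix m assume "l = Suc m" "exec w q s m s''"
    with exec_Cond_False.IH[of m s''] show ?thesis by simp
  qed (use exec_Cond_False.hyps in simp)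
next
  case (exec_While_False b s p)
  from exec_While_False.prems show ?case
    by (rule exec_WhileE) (use exec_While_False.hyps in simp_all)
next
  case (exec_While_True b s p k1 s1 k2 s2)
  from exec_While_True.prems show ?case
  proof (rule exec_WhileE)
    fix l1 t l2
    assume "l = Suc (l1 + l2)" "exec w p s l1 t" "exec w (While b p) t l2 s''"
    with exec_While_True.IH(1)[of l1 t] exec_While_True.IH(2)[of l2 s''] show ?thesis by simp
  qed (use exec_While_True.hyps in simp)
qed

record data_structure =
  init_code :: prog
  insert_code :: prog
  delete_code :: prog
  cancel_code :: prog
  query_code :: prog

fun request_code :: "data_structure \<Rightarrow> request \<Rightarrow> prog" where
  "request_code D (Create (Insert u v x) t) = insert_code D"
| "request_code D (Create (Delete u v) t) = delete_code D"
| "request_code D (Cancel t) = cancel_code D"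
| "request_code D (Query t) = query_code D"

text \<open>Arguments are passed in word registers 0, 1, 2 and time register 0, and the answer to a query
  is returned in word register 0. Everything else persists from one request to the next.\<close>

fun pass_args :: "nat \<Rightarrow> request \<Rightarrow> state \<Rightarrow> state" where
  "pass_args w (Create (Insert u v x) t) s =
     set_treg 0 t (set_reg w 2 x (set_reg w 1 (int v) (set_reg w 0 (int u) s)))"
| "pass_args w (Create (Delete u v) t) s =
     set_treg 0 t (set_reg w 1 (int v) (set_reg w 0 (int u) s))"
| "pass_args w (Cancel t) s = set_treg 0 t s"
| "pass_args w (Query t) s = set_treg 0 t s"

definition start_state :: "nat \<Rightarrow> nat \<Rightarrow> state" where
  "start_state w n = set_reg w 0 (int n)
     \<lparr>reg = (\<lambda>_. 0), mem = (\<lambda>_. 0), treg = (\<lambda>_. 0), tmem = (\<lambda>_. 0)\<rparr>"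

text \<open>The trace records, for every request, the time taken and the content of word register 0
  afterwards.\<close>

inductive serve ::
  "nat \<Rightarrow> data_structure \<Rightarrow> state \<Rightarrow> request list \<Rightarrow> (nat \<times> int) list \<Rightarrow> bool"
  for w :: nat and D :: data_structure where
  serve_Nil: "serve w D s [] []"
| serve_Cons: "exec w (request_code D r) (pass_args w r s) k s' \<Longrightarrow> serve w D s' rs tr \<Longrightarrow>
     serve w D s (r # rs) ((k, reg s' 0) # tr)"

definition correct_answers :: "nat \<Rightarrow> request list \<Rightarrow> (nat \<times> int) list \<Rightarrow> bool" where
  "correct_answers n rs tr \<longleftrightarrow> (\<forall>i < length rs. \<forall>t. rs ! i = Query t \<longrightarrow>
     snd (tr ! i) = max_degree n (graph_at (timeline_after (take i rs)) t))"

text \<open>The bounds \<open>f\<close> below are functions of the current \<open>T\<close>; for an update this is the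
  size of the sequence right after the update.\<close>

definition size_after :: "request list \<Rightarrow> nat \<Rightarrow> nat" where
  "size_after rs i = card (dom (timeline_after (take (Suc i) rs)))"

definition worst_case_query_time ::
  "(nat \<Rightarrow> real) \<Rightarrow> request list \<Rightarrow> (nat \<times> int) list \<Rightarrow> bool" where
  "worst_case_query_time f rs tr \<longleftrightarrow> (\<forall>i < length rs. is_query (rs ! i) \<longrightarrow>
     real (fst (tr ! i)) \<le> f (size_after rs i))"

definition amortized_update_time ::
  "(nat \<Rightarrow> real) \<Rightarrow> request list \<Rightarrow> (nat \<times> int) list \<Rightarrow> bool" where
  "amortized_update_time f rs tr \<longleftrightarrow>
     (\<Sum>i \<in> {i. i < length rs \<and> \<not> is_query (rs ! i)}. real (fst (tr ! i)))
       \<le> (\<Sum>i \<in> {i. i < length rs \<and> \<not> is_query (rs ! i)}. f (size_after rs i))"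

text \<open>Logarithm for time bounds, rounded up to 1 where \<open>log 2 T\<close> would be smaller.\<close>

definition lg :: "nat \<Rightarrow> real" where
  "lg T = (if T \<le> 2 then 1 else log 2 (real T))"

end

theory Submission
  imports Defs "HOL-Library.Product_Lexorder" "HOL-Library.Multiset"
begin

text \<open>The degree of a vertex \<open>v\<close> at time \<open>t\<close> is the sum of the changes that the updates up to time
  \<open>t\<close> made to it. All these changes are kept in one balanced search tree under the keys \<open>(v, t)\<close>,
  ordered lexicographically, with the sum of every subtree stored at its root, so that a query takes
  two searches per vertex. The updates of an edge alternate between insertions and deletions; hence
  legality forces every created or cancelled update to be the last one of its edge. So no other
  change depends on it, and the current weight of the edge, from which the change made by a deletion
  is found, can be kept in a table.

  A cancelled entry is overwritten with 0. When more than half of the nodes are superfluous, the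
  nonzero entries are inserted one by one into a new tree. This takes time \<open>O(N log N)\<close>, which is
  paid for by the potential \<open>e log (e + 2)\<close>, where \<open>N\<close> is the number of nodes and
  \<open>e = N - 3T\<close> the number of those that are not needed for certain.\<close>

section \<open>Reasoning about programs\<close>

text \<open>A cancellation names nothing but a time, so each update also records its edge, under the
  extra key \<open>(n, t)\<close>. With the two ends of the edge this makes at most three nonzero
  keys per update, whence \<open>3T\<close>. Times do not fit into words and can only be compared,
  so the boundary below the keys of vertex \<open>v\<close> is \<open>v - 1\<close> paired with a
  stored upper bound of all times. Nodes are never freed one by one: their numbers stay exactly
  \<open>1..N\<close>, so no free list arises, and a rebuild can read the old nodes in the order of
  their numbers while the new tree overwrites those already read. Programs have no recursion;
  insertion therefore keeps a stack of visited links and is compared, as a zipper, with the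
  recursive insertion. Sums may exceed a word; they are kept modulo the word size, and only the
  final difference, a degree, has to fit. One update raises the excess by at most 6, and a rebuild
  starts only when the excess is nearly half of the tree or more; this is why the excess can pay for
  it.\<close>

lemma wrap_wrap [simp]: "wrap w (wrap w x) = wrap w x"
  by (simp add: wrap_def)

lemma wrap_add_left [simp]: "wrap w (wrap w x + y) = wrap w (x + y)"
  by (metis wrap_def signed_take_bit_add signed_take_bit_signed_take_bit min.idem)

lemma wrap_add_right [simp]: "wrap w (x + wrap w y) = wrap w (x + y)"
  by (metis wrap_add_left add.commute)

lemma wrap_diff_left [simp]: "wrap w (wrap w x - y) = wrap w (x - y)"
  using wrap_add_left[of w x "- y"] by simp

lemma wrap_diff_right [simp]: "wrap w (x - wrap w y) = wrap w (x - y)"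
  by (metis wrap_def signed_take_bit_diff signed_take_bit_signed_take_bit min.idem)

lemma wrap_mult_left [simp]: "wrap w (wrap w x * y) = wrap w (x * y)"
  by (metis wrap_def signed_take_bit_mult signed_take_bit_signed_take_bit min.idem)

lemma wrap_id: "- (2 ^ (w - 1)) \<le> x \<Longrightarrow> x < 2 ^ (w - 1) \<Longrightarrow> wrap w x = x"
  by (simp add: wrap_def signed_take_bit_int_eq_self)

lemma wrap_0 [simp]: "wrap w 0 = 0"
  by (simp add: wrap_def)

text \<open>On such states \<open>Move\<close> and \<open>Load\<close> copy values exactly although
  the machine truncates every result. This justifies that \<open>eval\<close> reads registers and
  memory without truncation.\<close>

definition wrapped :: "nat \<Rightarrow> state \<Rightarrow> bool" where
  "wrapped w s \<longleftrightarrow> (\<forall>r. wrap w (reg s r) = reg s r) \<and> (\<forall>a. wrap w (mem s a) = mem s a)"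

lemma exec_wrapped: "exec w p s k s' \<Longrightarrow> wrapped w s \<Longrightarrow> wrapped w s'"
proof (induction rule: exec.induct)
  case (exec_Instr i s)
  then show ?case
    by (cases i) (auto simp: wrapped_def set_reg_def set_treg_def)
qed auto

section \<open>Arithmetic expressions and their compilation\<close>

datatype expr = Num int | Var nat | Bin binop expr expr | Mem expr

primrec eval :: "nat \<Rightarrow> expr \<Rightarrow> state \<Rightarrow> int" where
  "eval w (Num k) s = wrap w k"
| "eval w (Var x) s = reg s x"
| "eval w (Bin f a b) s = wrap w (binop_val f (eval w a s) (eval w b s))"
| "eval w (Mem a) s = mem s (eval w a s)"

primrec compile :: "expr \<Rightarrow> nat \<Rightarrow> prog" where
  "compile (Num k) d = Instr (Const d k)"
| "compile (Var x) d = Instr (Move d x)"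
| "compile (Bin f a b) d =
     Seq (compile a d) (Seq (compile b (Suc d)) (Instr (Op f d d (Suc d))))"
| "compile (Mem a) d = Seq (compile a d) (Instr (Load d d))"

primrec cost :: "expr \<Rightarrow> nat" where
  "cost (Num k) = 1"
| "cost (Var x) = 1"
| "cost (Bin f a b) = cost a + (cost b + 1)"
| "cost (Mem a) = cost a + 1"

primrec low :: "expr \<Rightarrow> bool" where
  "low (Num k) = True"
| "low (Var x) = (x < 30)"
| "low (Bin f a b) = (low a \<and> low b)"
| "low (Mem a) = low a"

text \<open>Registers from 30 on are scratch space for the evaluation of expressions.\<close>

definition sim :: "state \<Rightarrow> state \<Rightarrow> bool" where
  "sim s t \<longleftrightarrow> (\<forall>r < 30. reg s r = reg t r) \<and> mem s = mem t \<and> treg s = treg t \<and> tmem s = tmem t"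

lemma sim_refl [simp]: "sim s s"
  by (simp add: sim_def)

lemma sim_trans: "sim s t \<Longrightarrow> sim t u \<Longrightarrow> sim s u"
  by (simp add: sim_def)

lemma eval_sim: "sim s t \<Longrightarrow> low e \<Longrightarrow> eval w e s = eval w e t"
  by (induction e) (auto simp: sim_def)

text \<open>The clause on registers below \<open>d\<close> protects the left operand of a binary
  operation, which waits in \<open>d\<close> while the right one is evaluated into
  \<open>Suc d\<close>.\<close>

lemma compile_exec:
  assumes "wrapped w s" "low e" "30 \<le> d"
  shows "\<exists>t. exec w (compile e d) s (cost e) t \<and> sim s t \<and> reg t d = eval w e s \<and>
    (\<forall>r < d. reg t r = reg s r)"
  using assms
proof (induction e arbitrary: s d)
  case (Num k)
  have "exec w (compile (Num k) d) s (cost (Num k)) (step w (Const d k) s)"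
    by (simp add: exec_Instr[unfolded One_nat_def] del: step.simps)
  with Num show ?case
    by (intro exI[of _ "step w (Const d k) s"]) (auto simp: sim_def set_reg_def)
next
  case (Var x)
  have "exec w (compile (Var x) d) s (cost (Var x)) (step w (Move d x) s)"
    by (simp add: exec_Instr[unfolded One_nat_def] del: step.simps)
  with Var show ?case
    by (intro exI[of _ "step w (Move d x) s"]) (auto simp: sim_def set_reg_def wrapped_def)
next
  case (Bin f a b)
  from Bin.IH(1)[of s d] Bin.prems obtain t1 where
    1: "exec w (compile a d) s (cost a) t1" "sim s t1" "reg t1 d = eval w a s"
    "\<forall>r < d. reg t1 r = reg s r" by auto
  from Bin.IH(2)[of t1 "Suc d"] Bin.prems exec_wrapped[OF 1(1)] obtain t2 where
    2: "exec w (compile b (Suc d)) t1 (cost b) t2" "sim t1 t2" "reg t2 (Suc d) = eval w b t1"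
    "\<forall>r < Suc d. reg t2 r = reg t1 r" by auto
  have e: "eval w b t1 = eval w b s"
    using eval_sim[OF 1(2)] Bin.prems by simp
  let ?t = "step w (Op f d d (Suc d)) t2"
  have "exec w (compile (Bin f a b) d) s (cost (Bin f a b)) ?t"
    unfolding compile.simps cost.simps by (rule exec_Seq[OF 1(1) exec_Seq[OF 2(1) exec_Instr]])
  moreover have "sim s ?t"
    using sim_trans[OF 1(2) 2(2)] Bin.prems by (auto simp: sim_def set_reg_def)
  ultimately show ?case
    using 1 2 e by (intro exI[of _ ?t]) (auto simp: set_reg_def)
next
  case (Mem a)
  from Mem.IH[of s d] Mem.prems obtain t1 where
    1: "exec w (compile a d) s (cost a) t1" "sim s t1" "reg t1 d = eval w a s"
    "\<forall>r < d. reg t1 r = reg s r" by auto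
  let ?t = "step w (Load d d) t1"
  have "exec w (compile (Mem a) d) s (cost (Mem a)) ?t"
    unfolding compile.simps cost.simps by (rule exec_Seq[OF 1(1) exec_Instr])
  moreover have "sim s ?t"
    using 1(2) Mem.prems by (auto simp: sim_def set_reg_def)
  ultimately show ?case
    using 1 Mem.prems by (intro exI[of _ ?t]) (auto simp: set_reg_def wrapped_def sim_def)
qed

text \<open>Total correctness, with the exact running time as an argument of the postcondition.
  Start and end states are taken up to \<open>sim\<close>, so that symbolic states never mention the
  scratch registers.\<close>

definition wp :: "nat \<Rightarrow> prog \<Rightarrow> (nat \<Rightarrow> state \<Rightarrow> bool) \<Rightarrow> state \<Rightarrow> bool" where
  "wp w p Q s \<longleftrightarrow> (\<forall>t. sim s t \<longrightarrow> wrapped w t \<longrightarrow>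
     (\<exists>k t' s'. exec w p t k t' \<and> sim s' t' \<and> Q k s'))"

lemma wp_mono:
  assumes "wp w p Q s" "\<And>k s'. Q k s' \<Longrightarrow> R k s'"
  shows "wp w p R s"
  using assms unfolding wp_def by blast

lemma wp_Skip: "Q 1 s \<Longrightarrow> wp w Skip Q s"
  unfolding wp_def by (meson exec_Skip)

lemma wp_Seq:
  assumes "wp w p (\<lambda>k. wp w q (\<lambda>l. Q (k + l))) s"
  shows "wp w (Seq p q) Q s"
  unfolding wp_def
proof (intro allI impI)
  fix t assume t: "sim s t" "wrapped w t"
  with assms obtain k t' s' where
    1: "exec w p t k t'" "sim s' t'" "wp w q (\<lambda>l. Q (k + l)) s'"
    unfolding wp_def[of w p] by blast
  with exec_wrapped[OF 1(1) t(2)] obtain l t'' s'' where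
    "exec w q t' l t''" "sim s'' t''" "Q (k + l) s''"
    unfolding wp_def by blast
  with 1 show "\<exists>k t' s'. exec w (Seq p q) t k t' \<and> sim s' t' \<and> Q k s'"
    by (meson exec_Seq)
qed

lemma wp_SeqI:
  assumes "wp w p R s" "\<And>k s'. R k s' \<Longrightarrow> wp w q (\<lambda>l. Q (k + l)) s'"
  shows "wp w (Seq p q) Q s"
  using assms by (blast intro: wp_Seq wp_mono)

fun low_test :: "test \<Rightarrow> bool" where
  "low_test (Eq p q) \<longleftrightarrow> p < 30 \<and> q < 30"
| "low_test (Less p q) \<longleftrightarrow> p < 30 \<and> q < 30"
| "low_test (TEq p q) \<longleftrightarrow> True"
| "low_test (TLess p q) \<longleftrightarrow> True"

lemma test_sim: "low_test b \<Longrightarrow> sim s t \<Longrightarrow> test_val b s = test_val b t"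
  by (cases b) (auto simp: sim_def)

lemma wp_Cond:
  assumes "low_test b"
    and "test_val b s \<Longrightarrow> wp w p (\<lambda>k. Q (Suc k)) s"
    and "\<not> test_val b s \<Longrightarrow> wp w q (\<lambda>k. Q (Suc k)) s"
  shows "wp w (Cond b p q) Q s"
  unfolding wp_def
proof (intro allI impI)
  fix t assume t: "sim s t" "wrapped w t"
  show "\<exists>k t' s'. exec w (Cond b p q) t k t' \<and> sim s' t' \<and> Q k s'"
  proof (cases "test_val b s")
    case True
    from assms(2)[OF True] t obtain k t' s' where
      "exec w p t k t'" "sim s' t'" "Q (Suc k) s'" unfolding wp_def by blast
    with True test_sim[OF assms(1) t(1)] show ?thesis by (metis exec_Cond_True)
  next
    case False
    from assms(3)[OF False] t obtain k t' s' where
      "exec w q t k t'" "sim s' t'" "Q (Suc k) s'" unfolding wp_def by blast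
    with False test_sim[OF assms(1) t(1)] show ?thesis by (metis exec_Cond_False)
  qed
qed

lemma wp_While_False:
  "low_test b \<Longrightarrow> \<not> test_val b s \<Longrightarrow> Q 1 s \<Longrightarrow> wp w (While b p) Q s"
  unfolding wp_def by (meson exec_While_False test_sim)

text \<open>Instead of an invariant rule there is a single unrolling: each loop is verified by
  induction on the tree, the context or the counter that it consumes, and the running times add up
  along the way.\<close>

lemma wp_While_True:
  assumes "low_test b" "test_val b s"
    and "wp w p (\<lambda>k. wp w (While b p) (\<lambda>l. Q (Suc (k + l)))) s"
  shows "wp w (While b p) Q s"
  unfolding wp_def
proof (intro allI impI)
  fix t assume t: "sim s t" "wrapped w t"
  with assms(3) obtain k t' s' where
    1: "exec w p t k t'" "sim s' t'" "wp w (While b p) (\<lambda>l. Q (Suc (k + l))) s'"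
    unfolding wp_def[of w p] by blast
  with exec_wrapped[OF 1(1) t(2)] obtain l t'' s'' where
    "exec w (While b p) t' l t''" "sim s'' t''" "Q (Suc (k + l)) s''"
    unfolding wp_def by blast
  with 1 assms(2) test_sim[OF assms(1) t(1)]
  show "\<exists>k t' s'. exec w (While b p) t k t' \<and> sim s' t' \<and> Q k s'"
    by (metis exec_While_True)
qed

definition Asg :: "nat \<Rightarrow> expr \<Rightarrow> prog" where
  "Asg x e = Seq (compile e 30) (Instr (Move x 30))"

definition Sto :: "expr \<Rightarrow> expr \<Rightarrow> prog" where
  "Sto a e = Seq (compile a 30) (Seq (compile e 31) (Instr (Store 31 30)))"

lemma wp_Asg:
  assumes "x < 30" "low e"
    and Q: "\<And>v. v = eval w e s \<Longrightarrow> Q (cost e + 1) (s\<lparr>reg := (reg s)(x := v)\<rparr>)"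
  shows "wp w (Asg x e) Q s"
  unfolding wp_def
proof (intro allI impI)
  fix t assume t: "sim s t" "wrapped w t"
  from compile_exec[OF t(2) assms(2)] obtain t1 where
    1: "exec w (compile e 30) t (cost e) t1" "sim t t1" "reg t1 30 = eval w e t" by blast
  have e: "eval w e t = eval w e s" using eval_sim[OF t(1) assms(2)] by simp
  let ?t = "step w (Move x 30) t1"
  have "exec w (Asg x e) t (cost e + 1) ?t"
    unfolding Asg_def by (rule exec_Seq[OF 1(1) exec_Instr])
  moreover have "sim (s\<lparr>reg := (reg s)(x := eval w e s)\<rparr>) ?t"
    using t(1) 1(2,3) e exec_wrapped[OF 1(1) t(2)]
    by (auto simp: sim_def set_reg_def wrapped_def) metis
  ultimately show "\<exists>k t' s'. exec w (Asg x e) t k t' \<and> sim s' t' \<and> Q k s'"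
    using Q by blast
qed

lemma wp_Sto:
  assumes "low a" "low e"
    and Q: "\<And>i v. i = eval w a s \<Longrightarrow> v = eval w e s \<Longrightarrow>
      Q (cost a + (cost e + 1)) (s\<lparr>mem := (mem s)(i := v)\<rparr>)"
  shows "wp w (Sto a e) Q s"
  unfolding wp_def
proof (intro allI impI)
  fix t assume t: "sim s t" "wrapped w t"
  from compile_exec[OF t(2) assms(1)] obtain t1 where
    1: "exec w (compile a 30) t (cost a) t1" "sim t t1" "reg t1 30 = eval w a t" by blast
  from compile_exec[OF exec_wrapped[OF 1(1) t(2)] assms(2), of 31] obtain t2 where
    2: "exec w (compile e 31) t1 (cost e) t2" "sim t1 t2" "reg t2 31 = eval w e t1"
    "reg t2 30 = reg t1 30" by auto
  have e: "eval w a t = eval w a s" "eval w e t1 = eval w e s"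
    using eval_sim[OF t(1) assms(1)] eval_sim[OF sim_trans[OF t(1) 1(2)] assms(2)] by auto
  let ?t = "step w (Store 31 30) t2"
  have "exec w (Sto a e) t (cost a + (cost e + 1)) ?t"
    unfolding Sto_def by (rule exec_Seq[OF 1(1) exec_Seq[OF 2(1) exec_Instr]])
  moreover have "sim (s\<lparr>mem := (mem s)(eval w a s := eval w e s)\<rparr>) ?t"
    using t(1) 1(2,3) 2(2-4) e by (auto simp: sim_def)
  ultimately show "\<exists>k t' s'. exec w (Sto a e) t k t' \<and> sim s' t' \<and> Q k s'"
    using Q by blast
qed

lemma wp_TMove:
  "Q 1 (s\<lparr>treg := (treg s)(r := treg s q)\<rparr>) \<Longrightarrow> wp w (Instr (TMove r q)) Q s"
  unfolding wp_def
  by (intro allI impI exI conjI, rule exec_Instr) (auto simp: sim_def set_treg_def)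

lemma wp_TLoad:
  "q < 30 \<Longrightarrow> Q 1 (s\<lparr>treg := (treg s)(r := tmem s (reg s q))\<rparr>) \<Longrightarrow>
   wp w (Instr (TLoad r q)) Q s"
  unfolding wp_def
  by (intro allI impI exI conjI, rule exec_Instr) (auto simp: sim_def set_treg_def)

lemma wp_TStore:
  "q < 30 \<Longrightarrow> Q 1 (s\<lparr>tmem := (tmem s)(reg s q := treg s r)\<rparr>) \<Longrightarrow>
   wp w (Instr (TStore r q)) Q s"
  unfolding wp_def
  by (intro allI impI exI conjI, rule exec_Instr) (auto simp: sim_def set_treg_def)

section \<open>Balanced trees\<close>

datatype 'k tree = Lf | Nd "'k tree" int int 'k int "'k tree"

fun rt :: "'k tree \<Rightarrow> int" where
  "rt Lf = 0"
| "rt (Nd l i v a x r) = i"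

fun level :: "'k tree \<Rightarrow> int" where
  "level Lf = 0"
| "level (Nd l i v a x r) = v"

fun tsum :: "'k tree \<Rightarrow> int" where
  "tsum Lf = 0"
| "tsum (Nd l i v a x r) = tsum l + x + tsum r"

fun levels :: "'k tree \<Rightarrow> int set" where
  "levels Lf = {}"
| "levels (Nd l i v a x r) = insert v (levels l \<union> levels r)"

fun nodes :: "'k tree \<Rightarrow> nat" where
  "nodes Lf = 0"
| "nodes (Nd l i v a x r) = Suc (nodes l + nodes r)"

fun depth :: "'k tree \<Rightarrow> nat" where
  "depth Lf = 0"
| "depth (Nd l i v a x r) = Suc (max (depth l) (depth r))"

fun entries :: "'k tree \<Rightarrow> (int \<times> 'k \<times> int) list" where
  "entries Lf = []"
| "entries (Nd l i v a x r) = entries l @ (i, a, x) # entries r"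

abbreviation ids :: "'k tree \<Rightarrow> int list" where
  "ids t \<equiv> map fst (entries t)"

abbreviation keys :: "'k tree \<Rightarrow> 'k list" where
  "keys t \<equiv> map (fst \<circ> snd) (entries t)"

definition ordered :: "'k::linorder tree \<Rightarrow> bool" where
  "ordered t \<longleftrightarrow> sorted_wrt (<) (keys t)"

text \<open>The default 0 identifies cancelled entries, which are overwritten with 0, with absent
  ones.\<close>

fun lookup :: "'k::linorder tree \<Rightarrow> 'k \<Rightarrow> int" where
  "lookup Lf k = 0"
| "lookup (Nd l i v a x r) k = (if a = k then x else if a < k then lookup r k else lookup l k)"

fun prefix :: "'k::linorder tree \<Rightarrow> 'k \<Rightarrow> int" where
  "prefix Lf k = 0"
| "prefix (Nd l i v a x r) k = (if a \<le> k then tsum l + x + prefix r k else prefix l k)"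

section \<open>Rebalancing of AA trees\<close>

fun skew :: "'k tree \<Rightarrow> 'k tree" where
  "skew (Nd (Nd l1 i1 v1 a1 x1 r1) i v a x r) =
     (if v1 = v then Nd l1 i1 v1 a1 x1 (Nd r1 i v a x r) else Nd (Nd l1 i1 v1 a1 x1 r1) i v a x r)"
| "skew t = t"

fun split :: "'k tree \<Rightarrow> 'k tree" where
  "split (Nd l i v a x (Nd l1 i1 v1 a1 x1 (Nd l2 i2 v2 a2 x2 r2))) =
     (if v2 = v then Nd (Nd l i v a x l1) i1 (v1 + 1) a1 x1 (Nd l2 i2 v2 a2 x2 r2)
      else Nd l i v a x (Nd l1 i1 v1 a1 x1 (Nd l2 i2 v2 a2 x2 r2)))"
| "split t = t"

definition fix_up :: "'k tree \<Rightarrow> 'k tree" where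
  "fix_up t = split (skew t)"

lemma entries_skew [simp]: "entries (skew t) = entries t"
  by (cases t rule: skew.cases) auto

lemma entries_split [simp]: "entries (split t) = entries t"
  by (cases t rule: split.cases) auto

lemma entries_fix_up [simp]: "entries (fix_up t) = entries t"
  by (simp add: fix_up_def)

lemma levels_skew [simp]: "levels (skew t) = levels t"
  by (cases t rule: skew.cases) auto

lemma levels_split: "levels (split t) \<subseteq> levels t \<union> (\<lambda>v. v + 1) ` levels t"
  by (cases t rule: split.cases) auto

text \<open>Only \<open>split\<close> raises a level, and by 1. Levels are stored in words, so their
  growth has to be controlled.\<close>

lemma levels_fix_up: "\<forall>v \<in> levels t. v \<le> b \<Longrightarrow> \<forall>v \<in> levels (fix_up t). v \<le> b + 1"
  unfolding fix_up_def using levels_split[of "skew t"] by fastforce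

lemma nodes_entries: "nodes t = length (entries t)"
  by (induction t) auto

text \<open>A tree satisfying \<open>aa m\<close> is a 2-3 tree of height \<open>m\<close> in which a 3-node is represented by a
  node with a right child on the same level.\<close>

inductive aa :: "nat \<Rightarrow> 'k tree \<Rightarrow> bool" where
  aa_Lf: "aa 0 Lf"
| aa_single: "aa m l \<Longrightarrow> aa m r \<Longrightarrow> v = int (Suc m) \<Longrightarrow> aa (Suc m) (Nd l i v a x r)"
| aa_double: "aa m l \<Longrightarrow> aa m l1 \<Longrightarrow> aa m r1 \<Longrightarrow> v = int (Suc m) \<Longrightarrow>
    aa (Suc m) (Nd l i v a x (Nd l1 i1 v a1 x1 r1))"

text \<open>Here the root is a 2-node. An overflow that is passed upwards always has this shape, one
  level higher than before.\<close>

inductive single :: "nat \<Rightarrow> 'k tree \<Rightarrow> bool" where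
  "aa m l \<Longrightarrow> aa m r \<Longrightarrow> v = int (Suc m) \<Longrightarrow> single (Suc m) (Nd l i v a x r)"

lemma level_aa: "aa m t \<Longrightarrow> level t = int m"
  by (induction rule: aa.induct) auto

lemma single_aa: "single m t \<Longrightarrow> aa m t"
  by (induction rule: single.induct) (rule aa_single)

lemma depth_aa: "aa m t \<Longrightarrow> depth t \<le> 2 * m"
  by (induction rule: aa.induct) auto

lemma nodes_aa: "aa m t \<Longrightarrow> 2 ^ m \<le> nodes t + 1"
  by (induction rule: aa.induct) auto

lemma levels_aa: "aa m t \<Longrightarrow> \<forall>v \<in> levels t. v \<le> int m"
  by (induction rule: aa.induct) auto

lemma skew_id: "level l \<noteq> v \<Longrightarrow> skew (Nd l i v a x r) = Nd l i v a x r"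
  by (cases l) auto

fun right :: "'k tree \<Rightarrow> 'k tree" where
  "right Lf = Lf"
| "right (Nd l i v a x r) = r"

lemma split_id: "level (right r) \<noteq> v \<Longrightarrow> split (Nd l i v a x r) = Nd l i v a x r"
  by (cases "Nd l i v a x r" rule: split.cases) auto

lemma level_right_aa: "aa m t \<Longrightarrow> level (right t) \<le> int m"
  by (induction rule: aa.induct) (auto dest: level_aa)

lemma fix_up_id:
  "level l \<noteq> v \<Longrightarrow> level (right r) \<noteq> v \<Longrightarrow> fix_up (Nd l i v a x r) = Nd l i v a x r"
  by (simp add: fix_up_def skew_id split_id)

text \<open>In a valid tree neither the left child nor the right grandchild shares the level of the
  root, so no rotation fires. Hence \<open>fix_up\<close> may be applied blindly all the way
  up.\<close>

lemma fix_up_aa: "aa m t \<Longrightarrow> fix_up t = t"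
proof (induction rule: aa.induct)
  case (aa_single m l r v i a x)
  then show ?case
    using level_aa[of m l] level_right_aa[of m r] by (intro fix_up_id) auto
next
  case (aa_double m l l1 r1 v i a x i1 a1 x1)
  then show ?case
    using level_aa[of m l] level_aa[of m r1] by (intro fix_up_id) auto
qed (simp add: fix_up_def)

section \<open>Insertion and its effect on the shape\<close>

fun ins :: "'k::linorder \<Rightarrow> int \<Rightarrow> int \<Rightarrow> 'k tree \<Rightarrow> 'k tree" where
  "ins k y j Lf = Nd Lf j 1 k y Lf"
| "ins k y j (Nd l i v a x r) = fix_up
    (if a = k then Nd l i v a y r
     else if a < k then Nd l i v a x (ins k y j r) else Nd (ins k y j l) i v a x r)"

text \<open>The two outcomes of an insertion into a tree of height \<open>m\<close>: the height is
  kept, or a 2-node is pushed up to the parent.\<close>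

definition grown :: "nat \<Rightarrow> 'k tree \<Rightarrow> bool" where
  "grown m t \<longleftrightarrow> aa m t \<or> single (Suc m) t"

text \<open>A 2-node pushed up from the left lies on the level of its parent; \<open>skew\<close>
  turns this horizontal left link into the right link of a 3-node.\<close>

lemma fix_up_single_left:
  assumes "grown m l" "aa m r" "v = int (Suc m)"
  shows "aa (Suc m) (fix_up (Nd l i v a x r))"
  using assms(1) unfolding grown_def
proof
  assume "aa m l"
  with assms have "aa (Suc m) (Nd l i v a x r)" by (blast intro: aa_single)
  then show ?thesis by (simp add: fix_up_aa)
next
  assume "single (Suc m) l"
  then obtain l1 i1 a1 x1 r1 where l: "l = Nd l1 i1 v a1 x1 r1" "aa m l1" "aa m r1"
    using assms(3) by (auto elim: single.cases)
  have "split (Nd l1 i1 v a1 x1 (Nd r1 i v a x r)) = Nd l1 i1 v a1 x1 (Nd r1 i v a x r)"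
    using level_aa[OF assms(2)] assms(3) by (intro split_id) auto
  then have "fix_up (Nd l i v a x r) = Nd l1 i1 v a1 x1 (Nd r1 i v a x r)"
    by (simp add: fix_up_def l)
  then show ?thesis using l assms by (auto intro: aa_double)
qed

lemma fix_up_single_right:
  assumes "aa m l" "grown m r" "v = int (Suc m)"
  shows "aa (Suc m) (fix_up (Nd l i v a x r))"
  using assms(2) unfolding grown_def
proof
  assume "aa m r"
  with assms have "aa (Suc m) (Nd l i v a x r)" by (blast intro: aa_single)
  then show ?thesis by (simp add: fix_up_aa)
next
  assume "single (Suc m) r"
  then obtain l1 i1 a1 x1 r1 where "r = Nd l1 i1 v a1 x1 r1" "aa m l1" "aa m r1"
    using assms(3) by (auto elim: single.cases)
  then have "aa (Suc m) (Nd l i v a x r)"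
    using assms by (auto intro: aa_double)
  then show ?thesis by (simp add: fix_up_aa)
qed

text \<open>A 3-node whose left child overflows has three nodes on one level. \<open>skew\<close>
  puts them in a row to the right, and \<open>split\<close> lifts the middle one.\<close>

lemma fix_up_double_left:
  assumes "grown m l" "aa m l2" "aa m r2" "v = int (Suc m)"
  shows "grown (Suc m) (fix_up (Nd l i v a x (Nd l2 i2 v a2 x2 r2)))"
  using assms(1) unfolding grown_def[of m]
proof
  assume "aa m l"
  with assms have "aa (Suc m) (Nd l i v a x (Nd l2 i2 v a2 x2 r2))" by (blast intro: aa_double)
  then show ?thesis by (simp add: fix_up_aa grown_def)
next
  assume "single (Suc m) l"
  then obtain l1 i1 a1 x1 r1 where l: "l = Nd l1 i1 v a1 x1 r1" "aa m l1" "aa m r1"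
    using assms(4) by (auto elim: single.cases)
  have "single (Suc (Suc m)) (Nd (Nd l1 i1 v a1 x1 r1) i (v + 1) a x (Nd l2 i2 v a2 x2 r2))"
    using l assms by (intro single.intros aa_single) auto
  moreover have "fix_up (Nd l i v a x (Nd l2 i2 v a2 x2 r2)) =
      Nd (Nd l1 i1 v a1 x1 r1) i (v + 1) a x (Nd l2 i2 v a2 x2 r2)"
    by (simp add: l fix_up_def)
  ultimately show ?thesis by (simp add: grown_def)
qed

text \<open>If the right part is itself a 3-node, three nodes on one level already form a row to the
  right, and \<open>split\<close> alone lifts the middle one.\<close>

lemma fix_up_double_right:
  assumes "aa m l" "aa (Suc m) r" "v = int (Suc m)"
  shows "grown (Suc m) (fix_up (Nd l i v a x r))"
  using assms(2)
proof cases
  case (aa_single l1 r1 v1 i1 a1 x1)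
  then have "aa (Suc m) (Nd l i v a x r)"
    using assms by (auto intro: aa_double)
  then show ?thesis by (simp add: fix_up_aa grown_def)
next
  case (aa_double l1 l2 r2 v1 i1 a1 x1 i2 a2 x2)
  have v: "v1 = v" using aa_double assms(3) by simp
  have "single (Suc (Suc m)) (Nd (Nd l i v a x l1) i1 (v + 1) a1 x1 (Nd l2 i2 v a2 x2 r2))"
    using aa_double assms by (intro single.intros aa_single) auto
  moreover have "skew (Nd l i v a x r) = Nd l i v a x r"
    using level_aa[OF assms(1)] assms(3) by (intro skew_id) auto
  then have "fix_up (Nd l i v a x r) =
      Nd (Nd l i v a x l1) i1 (v + 1) a1 x1 (Nd l2 i2 v a2 x2 r2)"
    by (simp add: aa_double(1) v fix_up_def)
  ultimately show ?thesis by (simp add: grown_def)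
qed

lemma ins_aa: "aa m t \<Longrightarrow> grown m (ins k y j t) \<and> (single m t \<longrightarrow> aa m (ins k y j t))"
proof (induction m t rule: aa.induct)
  case aa_Lf
  have "single (Suc 0) (Nd Lf j 1 k y Lf)" by (intro single.intros) (auto intro: aa.aa_Lf)
  then show ?case by (auto simp: grown_def elim: single.cases)
next
  case (aa_single m l r v i a x)
  then have "aa (Suc m) (ins k y j (Nd l i v a x r))"
    using fix_up_single_left[of m "ins k y j l" r v i a x]
      fix_up_single_right[of m l "ins k y j r" v i a x]
      fix_up_single_left[of m l r v i a y] by (auto simp: grown_def)
  then show ?case by (simp add: grown_def)
next
  case (aa_double m l l1 r1 v i a x i1 a1 x1)
  let ?r = "Nd l1 i1 v a1 x1 r1"
  have no: "\<not> single (Suc m) (Nd l i v a x ?r)"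
  proof
    assume "single (Suc m) (Nd l i v a x ?r)"
    then have "aa m ?r" by cases simp
    from level_aa[OF this] aa_double.hyps show False by simp
  qed
  have l: "grown m l1" using aa_double.hyps by (simp add: grown_def)
  \<comment> \<open>Seen on its own, the right half of a 3-node is a 2-node, so it absorbs the
    growth of its children without growing itself.\<close>
  have r: "aa (Suc m) (ins k y j ?r)"
    using fix_up_single_left[OF _ aa_double(3,4), of "ins k y j l1" i1 a1 x1]
      fix_up_single_right[OF aa_double(2) _ aa_double(4), of "ins k y j r1" i1 a1 x1]
      fix_up_single_left[OF l aa_double(3,4), of i1 a1 y] aa_double.IH(2,3) by auto
  consider "a = k" | "a \<noteq> k" "a < k" | "a \<noteq> k" "\<not> a < k" by blast
  then have "grown (Suc m) (ins k y j (Nd l i v a x ?r))"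
  proof cases
    case 1
    have "grown m l" using aa_double.hyps by (simp add: grown_def)
    from fix_up_double_left[OF this aa_double(2-4)] 1 show ?thesis by simp
  next
    case 2
    have "ins k y j (Nd l i v a x ?r) = fix_up (Nd l i v a x (ins k y j ?r))"
      using 2 by (subst ins.simps(2)) simp
    with fix_up_double_right[OF aa_double(1) r aa_double(4)] show ?thesis by metis
  next
    case 3
    from fix_up_double_left[OF _ aa_double(2-4)] aa_double.IH(1) 3 show ?thesis by simp
  qed
  with no show ?case by simp
qed

lemma ins_aa_exists: "aa m t \<Longrightarrow> \<exists>m'. aa m' (ins k y j t)"
  using ins_aa[of m t k y j] unfolding grown_def by (blast intro: single_aa)

text \<open>Crude on purpose: the number of nodes is known to fit into a word, so the levels fit
  too.\<close>

lemma levels_nodes: "aa m t \<Longrightarrow> \<forall>v \<in> levels t. v \<le> int (nodes t)"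
proof -
  assume t: "aa m t"
  have "m < 2 ^ m" by simp
  with nodes_aa[OF t] have "m \<le> nodes t" by linarith
  with levels_aa[OF t] show ?thesis by fastforce
qed

section \<open>Keys, values and prefix sums\<close>

lemma ordered_Nd:
  "ordered (Nd l i v a x r) \<longleftrightarrow> ordered l \<and> ordered r \<and>
     (\<forall>b \<in> set (keys l). b < a) \<and> (\<forall>b \<in> set (keys r). a < b)"
  by (fastforce simp: ordered_def sorted_wrt_append)

lemma ordered_fix_up [simp]: "ordered (fix_up t) = ordered t"
  by (simp add: ordered_def)

lemma set_keys_ins: "set (keys (ins k y j t)) = insert k (set (keys t))"
  by (induction t) auto

lemma ordered_ins: "ordered t \<Longrightarrow> ordered (ins k y j t)"
proof (induction t)
  case (Nd l i v a x r)
  then show ?case by (auto simp: ordered_Nd set_keys_ins simp del: set_map)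
qed (simp add: ordered_def)

lemma mset_ids_ins:
  "ordered t \<Longrightarrow> mset (ids (ins k y j t)) =
     (if k \<in> set (keys t) then mset (ids t) else add_mset j (mset (ids t)))"
proof (induction t)
  case (Nd l i v a x r)
  then show ?case by (fastforce simp: ordered_Nd)
qed simp

lemma lookup_notin: "k \<notin> set (keys t) \<Longrightarrow> lookup t k = 0"
  by (induction t) auto

lemma lookup_entry: "ordered t \<Longrightarrow> (i, k, x) \<in> set (entries t) \<Longrightarrow> lookup t k = x"
proof (induction t)
  case (Nd l i' v a x' r)
  then show ?case by (fastforce simp: ordered_Nd)
qed simp

text \<open>Rebalancing changes the shape of a tree but not its entries.\<close>

lemma lookup_eqI:
  assumes "ordered t" "ordered u" "set (map snd (entries t)) = set (map snd (entries u))"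
  shows "lookup t k = lookup u k"
proof (cases "k \<in> set (keys t)")
  case True
  then obtain i x where 1: "(i, k, x) \<in> set (entries t)" by auto
  then have "(k, x) \<in> set (map snd (entries t))" by force
  then obtain i' where "(i', k, x) \<in> set (entries u)" unfolding assms(3) by auto
  with 1 assms show ?thesis by (metis lookup_entry)
next
  case False
  have "set (keys t) = fst ` set (map snd (entries t))" by (simp add: image_comp)
  also have "\<dots> = set (keys u)" unfolding assms(3) by (simp add: image_comp)
  finally show ?thesis using False by (metis lookup_notin)
qed

lemma lookup_fix_up: "ordered t \<Longrightarrow> lookup (fix_up t) = lookup t"
  by (rule ext, rule lookup_eqI) auto

lemma lookup_ins: "ordered t \<Longrightarrow> lookup (ins k y j t) = (lookup t)(k := y)"
proof (induction t)
  case (Nd l i v a x r)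
  have o: "ordered (if a = k then Nd l i v a y r
     else if a < k then Nd l i v a x (ins k y j r) else Nd (ins k y j l) i v a x r)"
    using ordered_ins[OF Nd.prems, of k y j] by simp
  have IH: "lookup (ins k y j l) = (lookup l)(k := y)" "lookup (ins k y j r) = (lookup r)(k := y)"
    using Nd by (auto simp: ordered_Nd)
  show ?case unfolding ins.simps lookup_fix_up[OF o] by (auto simp: IH)
qed auto

lemma tsum_sum: "ordered t \<Longrightarrow> tsum t = (\<Sum>k \<in> set (keys t). lookup t k)"
proof (induction t)
  case (Nd l i v a x r)
  then have o: "ordered l" "ordered r" "\<forall>b \<in> set (keys l). b < a" "\<forall>b \<in> set (keys r). a < b"
    by (auto simp: ordered_Nd)
  let ?L = "set (keys l)" and ?R = "set (keys r)" and ?f = "lookup (Nd l i v a x r)"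
  have d: "?L \<inter> insert a ?R = {}" "a \<notin> ?R" using o(3,4) by fastforce+
  have "(\<Sum>k \<in> set (keys (Nd l i v a x r)). ?f k) = (\<Sum>k \<in> ?L \<union> insert a ?R. ?f k)"
    by (intro sum.cong) auto
  also have "\<dots> = (\<Sum>k \<in> ?L. ?f k) + (?f a + (\<Sum>k \<in> ?R. ?f k))"
    using d by (subst sum.union_disjoint) auto
  also have "(\<Sum>k \<in> ?L. ?f k) = (\<Sum>k \<in> ?L. lookup l k)"
    using o(3) by (intro sum.cong) auto
  also have "(\<Sum>k \<in> ?R. ?f k) = (\<Sum>k \<in> ?R. lookup r k)"
    using o(4) by (intro sum.cong) auto
  finally show ?case using Nd.IH o(1,2) by simp
qed simp

lemma prefix_sum: "ordered t \<Longrightarrow> prefix t k = (\<Sum>b \<in> {b \<in> set (keys t). b \<le> k}. lookup t b)"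
proof (induction t)
  case (Nd l i v a x r)
  then have o: "ordered l" "ordered r" "\<forall>b \<in> set (keys l). b < a" "\<forall>b \<in> set (keys r). a < b"
    by (auto simp: ordered_Nd)
  let ?L = "set (keys l)" and ?R = "set (keys r)" and ?f = "lookup (Nd l i v a x r)"
  show ?case
  proof (cases "a \<le> k")
    case True
    have d: "?L \<inter> insert a {b \<in> ?R. b \<le> k} = {}" "a \<notin> ?R" using o(3,4) by fastforce+
    have "{b \<in> set (keys (Nd l i v a x r)). b \<le> k} = ?L \<union> insert a {b \<in> ?R. b \<le> k}"
      using True o(3) by fastforce
    then have "(\<Sum>b \<in> {b \<in> set (keys (Nd l i v a x r)). b \<le> k}. ?f b) =
        (\<Sum>b \<in> ?L. ?f b) + (?f a + (\<Sum>b \<in> {b \<in> ?R. b \<le> k}. ?f b))"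
      using d by (simp only:) (subst sum.union_disjoint, auto)
    also have "(\<Sum>k \<in> ?L. ?f k) = (\<Sum>k \<in> ?L. lookup l k)"
      using o(3) by (intro sum.cong) auto
    also have "(\<Sum>b \<in> {b \<in> ?R. b \<le> k}. ?f b) = (\<Sum>b \<in> {b \<in> ?R. b \<le> k}. lookup r b)"
      using o(4) by (intro sum.cong) auto
    finally show ?thesis using True Nd.IH(2) o(1,2) tsum_sum[OF o(1)] by simp
  next
    case False
    have "{b \<in> set (keys (Nd l i v a x r)). b \<le> k} = {b \<in> ?L. b \<le> k}"
      using False o(4) by fastforce
    moreover have "(\<Sum>b \<in> {b \<in> ?L. b \<le> k}. ?f b) = (\<Sum>b \<in> {b \<in> ?L. b \<le> k}. lookup l b)"
      using o(3) by (intro sum.cong) auto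
    ultimately show ?thesis using False Nd.IH(1) o(1) by simp
  qed
qed simp

text \<open>A position in a tree is given by the subtree below it and the frames from there up to the
  root; \<open>Lo\<close> is the frame of a right child, \<open>Hi\<close> that of a left child.\<close>

datatype 'k frame = Lo "'k tree" int int 'k int | Hi int int 'k int "'k tree"

fun plug :: "'k frame \<Rightarrow> 'k tree \<Rightarrow> 'k tree" where
  "plug (Lo l i v a x) t = Nd l i v a x t"
| "plug (Hi i v a x r) t = Nd t i v a x r"

fun close :: "'k tree \<Rightarrow> 'k frame list \<Rightarrow> 'k tree" where
  "close t [] = t"
| "close t (f # fs) = close (fix_up (plug f t)) fs"

fun descend :: "'k::linorder \<Rightarrow> 'k tree \<Rightarrow> 'k frame list \<Rightarrow> 'k tree \<times> 'k frame list" where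
  "descend k Lf fs = (Lf, fs)"
| "descend k (Nd l i v a x r) fs =
     (if a = k then (Nd l i v a x r, fs)
      else if a < k then descend k r (Lo l i v a x # fs) else descend k l (Hi i v a x r # fs))"

fun put :: "'k \<Rightarrow> int \<Rightarrow> int \<Rightarrow> 'k tree \<Rightarrow> 'k tree" where
  "put k y j Lf = Nd Lf j 1 k y Lf"
| "put k y j (Nd l i v a x r) = Nd l i v a y r"

text \<open>Links the iterative insertion of the program with the recursive one. At a fresh leaf
  \<open>ins\<close> does not rebalance while the program does, but \<open>fix_up\<close> leaves a
  single node alone.\<close>

lemma close_descend:
  "descend k t fs = (u, gs) \<Longrightarrow> close (fix_up (put k y j u)) gs = close (ins k y j t) fs"
  by (induction k t fs rule: descend.induct) (auto split: if_splits simp: fix_up_def)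

fun frame_levels :: "'k frame \<Rightarrow> int set" where
  "frame_levels (Lo l i v a x) = insert v (levels l)"
| "frame_levels (Hi i v a x r) = insert v (levels r)"

abbreviation frames_levels :: "'k frame list \<Rightarrow> int set" where
  "frames_levels fs \<equiv> (\<Union>f \<in> set fs. frame_levels f)"

text \<open>Recursive counterparts of \<open>ids\<close> and its distinctness: their equations
  follow the shape of trees and frames, as the clauses of the memory predicates do.\<close>

fun nids :: "'k tree \<Rightarrow> int set" where
  "nids Lf = {}"
| "nids (Nd l i v a x r) = insert i (nids l \<union> nids r)"

fun disj :: "'k tree \<Rightarrow> bool" where
  "disj Lf \<longleftrightarrow> True"
| "disj (Nd l i v a x r) \<longleftrightarrow> i \<notin> nids l \<and> i \<notin> nids r \<and> nids l \<inter> nids r = {} \<and> disj l \<and> disj r"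

fun fnids :: "'k frame list \<Rightarrow> int set" where
  "fnids [] = {}"
| "fnids (Lo l i v a x # fs) = insert i (nids l \<union> fnids fs)"
| "fnids (Hi i v a x r # fs) = insert i (nids r \<union> fnids fs)"

fun fdisj :: "'k frame list \<Rightarrow> bool" where
  "fdisj [] \<longleftrightarrow> True"
| "fdisj (Lo l i v a x # fs) \<longleftrightarrow> disj l \<and> fdisj fs \<and> i \<notin> nids l \<and> i \<notin> fnids fs \<and> nids l \<inter> fnids fs = {}"
| "fdisj (Hi i v a x r # fs) \<longleftrightarrow> disj r \<and> fdisj fs \<and> i \<notin> nids r \<and> i \<notin> fnids fs \<and> nids r \<inter> fnids fs = {}"

lemma nids_ids: "nids t = set (ids t)"
  by (induction t) auto

lemma disj_ids: "disj t \<longleftrightarrow> distinct (ids t)"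
  by (induction t) (auto simp: nids_ids)

lemma nids_fix_up [simp]: "nids (fix_up t) = nids t" "nids (skew t) = nids t" "nids (split t) = nids t"
  by (simp_all add: nids_ids)

lemma disj_fix_up [simp]: "disj (fix_up t) = disj t" "disj (skew t) = disj t" "disj (split t) = disj t"
  by (simp_all add: disj_ids)

lemma descend_nids: "descend k t fs = (u, gs) \<Longrightarrow> nids u \<union> fnids gs = nids t \<union> fnids fs"
  by (induction k t fs rule: descend.induct) (auto split: if_splits)

lemma descend_disj:
  "descend k t fs = (u, gs) \<Longrightarrow> disj t \<Longrightarrow> fdisj fs \<Longrightarrow> nids t \<inter> fnids fs = {} \<Longrightarrow>
   disj u \<and> fdisj gs \<and> nids u \<inter> fnids gs = {}"
proof (induction k t fs rule: descend.induct)
  case (2 k l i v a x r fs)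
  have "nids r \<inter> fnids (Lo l i v a x # fs) = {}" "fdisj (Lo l i v a x # fs)"
    "nids l \<inter> fnids (Hi i v a x r # fs) = {}" "fdisj (Hi i v a x r # fs)"
    using "2.prems" by auto
  with 2 show ?case by (auto split: if_splits)
qed auto

lemma descend_levels:
  "descend k t fs = (u, gs) \<Longrightarrow> levels u \<union> frames_levels gs = levels t \<union> frames_levels fs"
  by (induction k t fs rule: descend.induct) (auto split: if_splits)

lemma descend_length:
  "descend k t fs = (u, gs) \<Longrightarrow> length gs + depth u \<le> length fs + depth t"
  by (induction k t fs rule: descend.induct) (auto split: if_splits)

lemma descend_lookup:
  "descend k t fs = (u, gs) \<Longrightarrow> lookup t k = (case u of Lf \<Rightarrow> 0 | Nd l i v a x r \<Rightarrow> x)"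
  by (induction k t fs rule: descend.induct) (auto split: if_splits)

lemma descend_Lf:
  "descend k t fs = (u, gs) \<Longrightarrow> ordered t \<Longrightarrow> u = Lf \<longleftrightarrow> k \<notin> set (keys t)"
  by (induction k t fs rule: descend.induct) (fastforce split: if_splits simp: ordered_Nd)+

lemma depth_nodes: "depth t \<le> nodes t"
  by (induction t) auto

section \<open>The tree in memory\<close>

definition ad :: "int \<Rightarrow> int \<Rightarrow> int" where
  "ad i f = 8 * i + f"

lemma ad_eq_iff [simp]:
  "0 \<le> f \<Longrightarrow> f < 8 \<Longrightarrow> 0 \<le> g \<Longrightarrow> g < 8 \<Longrightarrow> ad i f = ad j g \<longleftrightarrow> i = j \<and> f = g"
  unfolding ad_def by (rule linorder_cases[of i j]) auto

text \<open>All cells of node \<open>i\<close> have addresses that fit into a word. The margin of 16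
  lets small constants fit as well, even for \<open>i = 0\<close>.\<close>

definition rng :: "nat \<Rightarrow> int \<Rightarrow> bool" where
  "rng w i \<longleftrightarrow> 0 \<le> i \<and> 8 * i + 16 \<le> 2 ^ (w - 1)"

lemma rng_mono: "rng w i \<Longrightarrow> 0 \<le> j \<Longrightarrow> j \<le> i \<Longrightarrow> rng w j"
  by (simp add: rng_def)

lemma rng_wrap: "rng w i \<Longrightarrow> -16 \<le> x \<Longrightarrow> x \<le> 8 * i + 15 \<Longrightarrow> wrap w x = x"
  by (rule wrap_id) (auto simp: rng_def)

definition Ad :: "expr \<Rightarrow> int \<Rightarrow> expr" where
  "Ad e f = Bin Add (Bin Mul (Num 8) e) (Num f)"

definition Fd :: "expr \<Rightarrow> int \<Rightarrow> expr" where
  "Fd e f = Mem (Ad e f)"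

lemma Ad_simps [simp]: "cost (Ad e f) = cost e + 4" "low (Ad e f) = low e"
  by (auto simp: Ad_def)

lemma Fd_simps [simp]: "cost (Fd e f) = cost e + 5" "low (Fd e f) = low e"
  by (auto simp: Fd_def)

lemma eval_Ad [simp]:
  "rng w (eval w e s) \<Longrightarrow> 0 \<le> f \<Longrightarrow> f < 8 \<Longrightarrow> eval w (Ad e f) s = ad (eval w e s) f"
  by (auto simp: Ad_def ad_def rng_def intro!: wrap_id)

lemma eval_Fd [simp]:
  "rng w (eval w e s) \<Longrightarrow> 0 \<le> f \<Longrightarrow> f < 8 \<Longrightarrow> eval w (Fd e f) s = mem s (ad (eval w e s) f)"
  by (simp add: Fd_def)

type_synonym key = "int \<times> real"

text \<open>The node with number \<open>i\<close> occupies the cells \<open>ad i 0\<close> to \<open>ad i 5\<close>, which hold the numbers of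
  its children, its level, the sum of its subtree modulo the word size, its value, and the integer
  part of its key. The empty tree is node 0. The cell \<open>ad 0 6\<close> holds the root, and the cells
  \<open>ad j 7\<close> form a stack.\<close>

text \<open>Registers: 3 always holds 0, 11 the number of nodes, 13 and time register 1 the search key, 15
  the address of the link to the current node, 16 the current node, 17 the height of the stack, 18
  the outcome of the last comparison. In \<open>rep0\<close> the sum stored at the root may be out of date.\<close>

fun rep0 :: "nat \<Rightarrow> (int \<Rightarrow> int) \<Rightarrow> (int \<Rightarrow> real) \<Rightarrow> key tree \<Rightarrow> bool"
and rep :: "nat \<Rightarrow> (int \<Rightarrow> int) \<Rightarrow> (int \<Rightarrow> real) \<Rightarrow> key tree \<Rightarrow> bool" where
  "rep0 w M U Lf \<longleftrightarrow> False"
| "rep0 w M U (Nd l i v a x r) \<longleftrightarrow> rng w i \<and> 0 < i \<and> 0 < v \<and> M (ad i 0) = rt l \<and>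
     M (ad i 1) = rt r \<and> M (ad i 2) = v \<and> M (ad i 4) = x \<and> M (ad i 5) = fst a \<and> U i = snd a \<and>
     rep w M U l \<and> rep w M U r"
| "rep w M U Lf \<longleftrightarrow> rng w 0 \<and> (\<forall>f \<in> {0..3}. M (ad 0 f) = 0)"
| "rep w M U (Nd l i v a x r) \<longleftrightarrow>
     M (ad i 3) = wrap w (tsum (Nd l i v a x r)) \<and> rep0 w M U (Nd l i v a x r)"

lemma rep_rng: "rep w M U t \<Longrightarrow> rng w (rt t)"
  by (cases t) auto

lemma rep_level: "rep w M U t \<Longrightarrow> M (ad (rt t) 2) = level t"
  by (cases t) auto

lemma rep_total: "rep w M U t \<Longrightarrow> M (ad (rt t) 3) = wrap w (tsum t)"
  by (cases t) auto

lemma rep_right: "rep w M U t \<Longrightarrow> M (ad (rt t) 1) = rt (right t) \<and> rep w M U (right t)"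
  by (cases t) auto

lemmas rep_facts = rep_rng rep_level rep_total rep_right

lemma rep_ids: "rep w M U t \<Longrightarrow> i \<in> nids t \<Longrightarrow> 0 < i \<and> rng w i"
  by (induction t) auto

lemma rep_cong:
  assumes "rep w M U t" "\<And>i f. i \<in> insert 0 (nids t) \<Longrightarrow> f \<in> {0..5} \<Longrightarrow> M' (ad i f) = M (ad i f)"
    and "\<And>i. i \<in> nids t \<Longrightarrow> U' i = U i"
  shows "rep w M' U' t"
  using assms by (induction t) auto

lemma rep_upd [simp]:
  "i \<notin> nids t \<Longrightarrow> i \<noteq> 0 \<Longrightarrow> 0 \<le> f \<Longrightarrow> f < 8 \<Longrightarrow> rep w (M(ad i f := y)) U t = rep w M U t"
  by (induction t) auto

text \<open>Node 0 is a sentinel whose cells hold 0, so sums, levels and children of empty subtrees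
  are read without a case distinction.\<close>

definition Upd :: prog where
  "Upd = Sto (Ad (Var 16) 3)
    (Bin Add (Bin Add (Fd (Fd (Var 16) 0) 3) (Fd (Var 16) 4)) (Fd (Fd (Var 16) 1) 3))"

lemma wp_Upd:
  assumes t: "rep0 w (mem s) U t" "reg s 16 = rt t"
    and Q: "Q 36 (s\<lparr>mem := (mem s)(ad (rt t) 3 := wrap w (tsum t))\<rparr>)"
  shows "wp w Upd Q s"
proof (cases t)
  case (Nd l i v a x r)
  have "rep w (mem s) U l" "rep w (mem s) U r" using t Nd by auto
  note rep_facts[OF this(1)] rep_facts[OF this(2)]
  then show ?thesis using t Q Nd unfolding Upd_def
    by (intro wp_Sto) auto
qed (use t in simp)

section \<open>Rotations in memory\<close>

definition touch :: "int set \<Rightarrow> nat set \<Rightarrow> state \<Rightarrow> state \<Rightarrow> bool" where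
  "touch A R s s' \<longleftrightarrow> (\<forall>a. a \<notin> A \<longrightarrow> mem s' a = mem s a) \<and> (\<forall>r. r \<notin> R \<longrightarrow> reg s' r = reg s r) \<and>
     (\<forall>r. r \<noteq> 2 \<longrightarrow> treg s' r = treg s r) \<and> tmem s' = tmem s"

text \<open>Rebalancing writes links, levels and sums only. Values and keys, in fields 4 and 5, stay
  with their nodes.\<close>

definition cells :: "int set \<Rightarrow> int set" where
  "cells X = {ad i f | i f. i \<in> X \<and> f \<in> {0..3}}"

lemma ad_in_cells [simp]: "0 \<le> f \<Longrightarrow> f < 8 \<Longrightarrow> ad i f \<in> cells X \<longleftrightarrow> i \<in> X \<and> f \<le> 3"
  by (force simp: cells_def)

definition Skew :: prog where
  "Skew = Seq (Asg 19 (Fd (Var 16) 0)) (Seq (Asg 24 (Fd (Var 19) 2)) (Seq (Asg 25 (Fd (Var 16) 2))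
    (Seq (Cond (Eq 24 25)
      (Seq (Sto (Ad (Var 16) 0) (Fd (Var 19) 1)) (Seq (Sto (Ad (Var 19) 1) (Var 16))
        (Seq Upd (Asg 16 (Var 19))))) Skip) Upd)))"

definition Split :: prog where
  "Split = Seq (Asg 19 (Fd (Var 16) 1)) (Seq (Asg 24 (Fd (Fd (Var 19) 1) 2)) (Seq (Asg 25 (Fd (Var 16) 2))
    (Cond (Eq 24 25)
      (Seq (Sto (Ad (Var 16) 1) (Fd (Var 19) 0)) (Seq (Sto (Ad (Var 19) 0) (Var 16)) (Seq Upd
        (Seq (Sto (Ad (Var 19) 2) (Bin Add (Fd (Var 19) 2) (Num 1))) (Seq (Asg 16 (Var 19)) Upd)))))
      Skip)))"

text \<open>The start is \<open>rep0\<close> because a child may just have changed. After a rotation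
  the sum of the lowered node is refreshed first, since that of the new root depends on it.\<close>

lemma wp_Skew:
  assumes t: "rep0 w (mem s) (tmem s) t" "reg s 16 = rt t" "disj t"
  shows "wp w Skew (\<lambda>k s'. k \<le> 200 \<and> rep w (mem s') (tmem s) (skew t) \<and> reg s' 16 = rt (skew t) \<and>
    touch (cells (nids t)) {16, 19, 24, 25} s s') s"
proof (cases t)
  case (Nd l i v a x r)
  have lr: "rep w (mem s) (tmem s) l" "rep w (mem s) (tmem s) r" using t Nd by auto
  note facts = rep_facts[OF this(1)] rep_facts[OF this(2)]
  show ?thesis
  proof (cases "level l = v")
    case False
    have s: "skew t = t" using Nd False skew_id by metis
    show ?thesis unfolding Skew_def
      apply (intro wp_Seq wp_Asg; simp?)
      apply (intro wp_Cond wp_Skip; (simp add: t Nd facts False)?)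
      subgoal using t Nd facts False by auto
      apply (rule wp_Upd[of _ _ "tmem s" t])
      using t Nd facts lr apply auto
       apply (auto simp: skew_id touch_def)
      done
  next
    case True
    then obtain l1 i1 a1 x1 r1 where l: "l = Nd l1 i1 v a1 x1 r1" using t Nd by (cases l) auto
    have s: "skew t = Nd l1 i1 v a1 x1 (Nd r1 i v a x r)" using Nd l by simp
    have lr1: "rep w (mem s) (tmem s) l1" "rep w (mem s) (tmem s) r1" using lr l by auto
    show ?thesis unfolding Skew_def
      apply (intro wp_Seq wp_Asg; simp?)
      apply (rule wp_Cond)
      apply simp
      subgoal
       apply (intro wp_Seq wp_Sto; simp?)
       apply (rule wp_Upd[of _ _ "tmem s" "Nd r1 i v a x r"])
       subgoal using t Nd lr l lr1 by auto
       subgoal using t Nd lr l lr1 by auto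
       apply (intro wp_Asg; simp?)
       apply (rule wp_Upd[of _ _ "tmem s" "skew t"])
       subgoal using t Nd lr l lr1 by auto
       subgoal using t Nd lr l lr1 by auto
       using t Nd lr l lr1 by (auto simp: s touch_def)
      subgoal using t Nd lr l lr1 by auto
      done
  qed
qed (use t in simp)


lemma wp_Split:
  assumes t: "rep w (mem s) (tmem s) t" "reg s 16 = rt t" "disj t" "t \<noteq> Lf"
    and v: "\<forall>v \<in> levels t. v + 1 < 2 ^ (w - 1)"
  shows "wp w Split (\<lambda>k s'. k \<le> 200 \<and> rep w (mem s') (tmem s) (split t) \<and> reg s' 16 = rt (split t) \<and>
    touch (cells (nids t)) {16, 19, 24, 25} s s') s"
proof (cases t)
  case (Nd l i v a x r)
  have lr: "rep w (mem s) (tmem s) l" "rep w (mem s) (tmem s) r" using t Nd by auto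
  note facts = rep_facts[OF this(1)] rep_facts[OF this(2)] 
  note facts2 = rep_facts[OF facts(8)[THEN conjunct2]]
  show ?thesis
  proof (cases "level (right r) = v")
    case False
    show ?thesis unfolding Split_def
      apply (intro wp_Seq wp_Asg; simp?)
      apply (intro wp_Cond wp_Skip; (simp add: t Nd facts False)?)
      subgoal using t Nd facts facts2 False by auto
      using t Nd facts lr False by (auto simp: split_id touch_def)
  next
    case True
    moreover have "0 < v" using t Nd by simp
    ultimately obtain l1 i1 v1 a1 x1 l2 i2 a2 x2 r2 where r: "r = Nd l1 i1 v1 a1 x1 (Nd l2 i2 v a2 x2 r2)"
      by (cases r; cases "right r"; auto)
    have s: "split t = Nd (Nd l i v a x l1) i1 (v1 + 1) a1 x1 (Nd l2 i2 v a2 x2 r2)" using Nd r by simp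
    have lr1: "rep w (mem s) (tmem s) l1" "rep w (mem s) (tmem s) (Nd l2 i2 v a2 x2 r2)" using lr r by auto
    have v1: "wrap w (v1 + wrap w 1) = v1 + 1" using lr r v Nd by (auto intro!: wrap_id)
    note all = t Nd lr r lr1
    show ?thesis unfolding Split_def
      apply (intro wp_Seq wp_Asg; simp?)
      apply (rule wp_Cond)
      apply simp
      subgoal
       apply (intro wp_Seq wp_Sto; simp?)
       apply (rule wp_Upd[of _ _ "tmem s" "Nd l i v a x l1"])
       subgoal using all by auto
       subgoal using all by auto
       apply (intro wp_Sto wp_Asg wp_Seq; simp?)
       apply (rule wp_Upd[of _ _ "tmem s" "split t"])
       subgoal using all v1 unfolding s by auto
       subgoal using all by auto
       using all v1 by (auto simp: s touch_def)
      subgoal using all by auto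
      done
  qed
qed (use t in simp)

lemma touch_trans:
  "touch A R s s' \<Longrightarrow> touch B R' s' s'' \<Longrightarrow> A \<subseteq> C \<Longrightarrow> B \<subseteq> C \<Longrightarrow> R \<subseteq> T \<Longrightarrow> R' \<subseteq> T \<Longrightarrow> touch C T s s''"
  unfolding touch_def by (metis subsetD)

lemma cells_Un: "cells (X \<union> Y) = cells X \<union> cells Y"
  by (auto simp: cells_def)

definition Fix :: prog where
  "Fix = Seq Skew (Seq Split (Sto (Var 15) (Var 16)))"

text \<open>The link held in register 15 must lie outside the tree and the sentinel; otherwise the
  final store would damage what has just been rebalanced.\<close>

lemma wp_Fix:
  assumes t: "rep0 w (mem s) (tmem s) t" "reg s 16 = rt t" "disj t"
    and v: "\<forall>v \<in> levels t. v + 1 < 2 ^ (w - 1)"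
    and a: "\<And>i f. i \<in> insert 0 (nids t) \<Longrightarrow> f \<in> {0..5} \<Longrightarrow> reg s 15 \<noteq> ad i f"
  shows "wp w Fix (\<lambda>k s'. k \<le> 410 \<and> rep w (mem s') (tmem s') (fix_up t) \<and>
    mem s' (reg s 15) = rt (fix_up t) \<and>
    touch (insert (reg s 15) (cells (nids t))) {16, 19, 24, 25} s s') s"
  (is "wp w Fix ?Q s")
proof -
  have ne: "skew t \<noteq> Lf" using t(1) by (cases t rule: skew.cases) auto
  have v': "\<forall>v \<in> levels (skew t). v + 1 < 2 ^ (w - 1)" using v by simp
  show ?thesis unfolding Fix_def
  proof (rule wp_SeqI[OF wp_Skew[OF t]], elim conjE, goal_cases)
    case 1: (1 k s1)
    have d: "disj (skew t)" using t(3) by simp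
    have T: "tmem s1 = tmem s" using 1(4) by (simp add: touch_def)
    show ?case
    proof (rule wp_SeqI[OF wp_Split[OF 1(2)[folded T] 1(3) d ne v']], elim conjE, goal_cases)
      case 2: (1 l s2)
      have 3: "touch (cells (nids t)) {16, 19, 24, 25} s s2"
        using touch_trans[OF 1(4) 2(4)] by simp
      then have r: "reg s2 15 = reg s 15" "tmem s2 = tmem s" by (simp_all add: touch_def)
      have "rep w ((mem s2)(reg s 15 := rt (fix_up t))) (tmem s2) (fix_up t)"
        by (rule rep_cong[OF 2(2)[folded fix_up_def]]) (use a r T in force)+
      with 1 2 3 r show ?case
        by (intro wp_Sto) (auto simp: touch_def fix_up_def[symmetric])
    qed
  qed
qed

section \<open>Contexts in memory and the way back to the root\<close>

fun link :: "key frame list \<Rightarrow> int" where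
  "link [] = ad 0 6"
| "link (Lo l i v a x # fs) = ad i 1"
| "link (Hi i v a x r # fs) = ad i 0"

text \<open>The link from the innermost frame into the focus is left open, and nothing is said about
  the sums of the frames: the way up restores both.\<close>

fun crep :: "nat \<Rightarrow> (int \<Rightarrow> int) \<Rightarrow> (int \<Rightarrow> real) \<Rightarrow> key frame list \<Rightarrow> bool" where
  "crep w M U [] \<longleftrightarrow> True"
| "crep w M U (Lo l i v a x # fs) \<longleftrightarrow> rng w i \<and> 0 < i \<and> 0 < v \<and> M (ad i 0) = rt l \<and>
     M (ad i 2) = v \<and> M (ad i 4) = x \<and> M (ad i 5) = fst a \<and> U i = snd a \<and>
     rep w M U l \<and> M (link fs) = i \<and> crep w M U fs"
| "crep w M U (Hi i v a x r # fs) \<longleftrightarrow> rng w i \<and> 0 < i \<and> 0 < v \<and> M (ad i 1) = rt r \<and>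
     M (ad i 2) = v \<and> M (ad i 4) = x \<and> M (ad i 5) = fst a \<and> U i = snd a \<and>
     rep w M U r \<and> M (link fs) = i \<and> crep w M U fs"

text \<open>The stack holds addresses of links rather than node numbers, so that an entry serves
  both to read the node and to redirect the link when a rotation gives the subtree a new root. The
  link to the root of the whole tree lies at the bottom.\<close>

fun stk :: "(int \<Rightarrow> int) \<Rightarrow> key frame list \<Rightarrow> bool" where
  "stk M [] \<longleftrightarrow> M (ad 1 7) = link []"
| "stk M (f # fs) \<longleftrightarrow> M (ad (2 + int (length fs)) 7) = link (f # fs) \<and> stk M fs"

lemma stk_top: "stk M fs \<Longrightarrow> M (ad (1 + int (length fs)) 7) = link fs"
  by (cases fs) auto

lemma stk_cong: "stk M fs \<Longrightarrow> (\<And>j. M' (ad j 7) = M (ad j 7)) \<Longrightarrow> stk M' fs"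
  by (induction fs) auto

lemma link_cases: "crep w M U fs \<Longrightarrow> \<exists>i f. link fs = ad i f \<and> i \<in> insert 0 (fnids fs) \<and>
   (f = 6 \<and> i = 0 \<or> f \<in> {0,1} \<and> 0 < i)"
  by (cases fs rule: link.cases) auto

lemma crep_cong:
  assumes "crep w M U fs"
    "\<And>i f. i \<in> insert 0 (fnids fs) \<Longrightarrow> f \<in> {0..6} \<Longrightarrow> M' (ad i f) = M (ad i f)"
    "\<And>i. i \<in> fnids fs \<Longrightarrow> U' i = U i"
  shows "crep w M' U' fs"
  using assms
proof (induction fs)
  case (Cons f fs)
  have c: "crep w M U fs" and n: "fnids fs \<subseteq> fnids (f # fs)" using Cons.prems by (cases f; auto)+
  have "crep w M' U' fs" by (rule Cons.IH[OF c]) (use n in \<open>auto intro!: Cons.prems(2,3)\<close>)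
  moreover have "M' (link fs) = M (link fs)"
    using link_cases[OF c] n by (auto intro!: Cons.prems(2))
  ultimately show ?case using Cons.prems
    by (cases f) (auto intro!: rep_cong[of w M U])
qed simp

text \<open>Rebalancing at the focus writes only to nodes foreign to the context and to the open
  link, so the context survives it.\<close>

lemma crep_change:
  assumes c: "crep w M U fs" "fdisj fs" "X \<inter> fnids fs = {}" "0 \<notin> X"
    and M: "\<And>a. a \<notin> cells X \<Longrightarrow> a \<noteq> link fs \<Longrightarrow> M' a = M a"
  shows "crep w M' U fs"
proof (cases fs)
  case (Cons f gs)
  have g: "crep w M U gs" using c Cons by (cases f) auto
  obtain i where i: "i \<notin> fnids gs" "link fs = ad i 0 \<or> link fs = ad i 1" "0 < i" "X \<inter> fnids gs = {}"
    using c Cons by (cases f) auto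
  have "crep w M' U gs"
    using g by (rule crep_cong) (use i c in \<open>auto intro!: M\<close>)
  moreover have "M' (link gs) = M (link gs)"
    using link_cases[OF g] i c by (auto intro!: M)
  moreover have "rep w M' U t" if "rep w M U t" "X \<inter> nids t = {}" "i \<notin> nids t" for t
    using that(1) by (rule rep_cong) (use that i c in \<open>auto intro!: M\<close>)
  ultimately show ?thesis using c Cons i
    by (cases f) (auto simp: M Int_Un_distrib)
qed simp

definition Up :: prog where
  "Up = While (Less 3 17) (Seq (Asg 15 (Fd (Var 17) 7)) (Seq (Asg 17 (Bin Sub (Var 17) (Num 1)))
    (Seq (Asg 16 (Mem (Var 15))) Fix)))"

text \<open>In the induction \<open>b\<close> grows by 1 per frame, because each
  \<open>fix_up\<close> may raise levels by 1. The stack is one longer than the list of frames,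
  hence the last round at the root.\<close>

lemma wp_Up:
  assumes "rep0 w (mem s) (tmem s) t" "mem s (link fs) = rt t" "crep w (mem s) (tmem s) fs"
    "stk (mem s) fs" "reg s 17 = 1 + int (length fs)" "reg s 3 = 0" "disj t" "fdisj fs" "nids t \<inter> fnids fs = {}"
    "rng w (1 + int (length fs))"
    "\<forall>v \<in> levels t \<union> frames_levels fs. v \<le> b" "b + int (length fs) + 2 < 2 ^ (w - 1)"
  shows "wp w Up (\<lambda>k s'. k \<le> 450 * (1 + length fs) \<and> rep w (mem s') (tmem s') (close (fix_up t) fs) \<and>
    mem s' (ad 0 6) = rt (close (fix_up t) fs) \<and>
    touch (insert (ad 0 6) (cells (nids t \<union> fnids fs))) {15, 16, 17, 19, 24, 25} s s') s"
  using assms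
proof (induction fs arbitrary: t s b)
  case Nil
  let ?Q = "\<lambda>k s'. k \<le> 450 \<and> rep w (mem s') (tmem s') (fix_up t) \<and> mem s' (ad 0 6) = rt (fix_up t) \<and>
    touch (insert (ad 0 6) (cells (nids t))) {15, 16, 17, 19, 24, 25} s s'"
  have t: "t \<noteq> Lf" and r1: "wrap w 1 = 1" using Nil by (auto intro!: rng_wrap)
  have "wp w (While (Less 3 17) (Seq (Asg 15 (Fd (Var 17) 7)) (Seq (Asg 17 (Bin Sub (Var 17) (Num 1)))
    (Seq (Asg 16 (Mem (Var 15))) Fix)))) ?Q s"
    apply (rule wp_While_True)
    subgoal by simp
    subgoal using Nil by simp
    apply (intro wp_Seq wp_Asg; simp?)
    apply (rule wp_mono[OF wp_Fix[of _ _ t]])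
    using Nil apply (simp_all add: r1)
    subgoal by fastforce
    apply (rule wp_While_False)
    apply (auto simp: touch_def)
    done
  then show ?case by (simp add: Up_def)
next
  case (Cons f fs)
  let ?t = "plug f (fix_up t)" and ?T = "{15, 16, 17, 19, 24, 25} :: nat set"
  let ?X = "nids t \<union> fnids (f # fs)" let ?C = "insert (ad 0 6) (cells ?X)"
  let ?Q = "\<lambda>k s'. k \<le> 450 * (2 + length fs) \<and> rep w (mem s') (tmem s') (close (fix_up ?t) fs) \<and>
    mem s' (ad 0 6) = rt (close (fix_up ?t) fs) \<and> touch ?C ?T s s'"
  have t: "t \<noteq> Lf" "0 \<notin> nids t" and r1: "wrap w 1 = 1" and b: "b + 1 < 2 ^ (w - 1)"
    using Cons.prems by (cases t; auto intro!: rng_wrap dest: rep_ids)+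
  obtain i where i: "i \<in> fnids (f # fs)" "link (f # fs) = ad i 0 \<or> link (f # fs) = ad i 1" "0 < i"
    using Cons.prems(3) by (cases f) auto
  have it: "i \<notin> nids t" using i Cons.prems(9) by auto
  have nt: "nids ?t \<union> fnids fs = ?X" "link (f # fs) \<in> cells ?X" using i by (cases f; auto)+
  have wr: "wrap w (1 + int (length fs)) = 1 + int (length fs)"
    using Cons.prems(10) by (intro rng_wrap) auto
  have "v \<le> b" if "v \<in> levels t" for v using that Cons.prems(11) by blast
  then have lv: "\<forall>v \<in> levels t. v + 1 < 2 ^ (w - 1)" using b by fastforce
  define s0 where "s0 = s\<lparr>reg := (reg s)(15 := link (f # fs), 17 := 1 + int (length fs), 16 := rt t)\<rparr>"
  have F: "wp w Fix (\<lambda>k s'. k \<le> 410 \<and> rep w (mem s') (tmem s') (fix_up t) \<and>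
      mem s' (reg s0 15) = rt (fix_up t) \<and>
      touch (insert (reg s0 15) (cells (nids t))) {16, 19, 24, 25} s0 s') s0"
    using i it Cons.prems lv by (intro wp_Fix) (auto simp: s0_def)
  have U: "wp w Up (\<lambda>l s'. ?Q (Suc (30 + (k + l))) s') s1"
    if k: "k \<le> 410" and 1: "rep w (mem s1) (tmem s1) (fix_up t)" "mem s1 (reg s0 15) = rt (fix_up t)"
      "touch (insert (reg s0 15) (cells (nids t))) {16, 19, 24, 25} s0 s1" for k s1
  proof -
    have M: "mem s1 a = mem s a" if "a \<notin> cells (nids t)" "a \<noteq> link (f # fs)" for a
      using 1(3) that by (auto simp: touch_def s0_def)
    have T: "tmem s1 = tmem s" using 1(3) by (simp add: touch_def s0_def)
    have c: "crep w (mem s1) (tmem s1) (f # fs)" unfolding T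
      using Cons.prems(3,8,9) t(2) M by (rule crep_change)
    have st: "stk (mem s1) (f # fs)"
      using Cons.prems(4) by (rule stk_cong) (use i in \<open>auto intro!: M\<close>)
    have l1: "mem s1 (link (f # fs)) = rt (fix_up t)" using 1(2) by (simp add: s0_def)
    have "wp w Up (\<lambda>k s'. k \<le> 450 * (1 + length fs) \<and> rep w (mem s') (tmem s') (close (fix_up ?t) fs) \<and>
      mem s' (ad 0 6) = rt (close (fix_up ?t) fs) \<and>
      touch (insert (ad 0 6) (cells (nids ?t \<union> fnids fs))) {15, 16, 17, 19, 24, 25} s1 s') s1"
    proof (rule Cons.IH)
      show "rep0 w (mem s1) (tmem s1) ?t" using c 1(1) l1 by (cases f) auto
      show "mem s1 (link fs) = rt ?t" using c by (cases f) auto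
      show "crep w (mem s1) (tmem s1) fs" using c by (cases f) auto
      show "stk (mem s1) fs" using st by simp
      show "reg s1 17 = 1 + int (length fs)" "reg s1 3 = 0"
        using 1(3) Cons.prems by (auto simp: touch_def s0_def)
      show "disj ?t" "fdisj fs" "nids ?t \<inter> fnids fs = {}" using Cons.prems by (cases f; auto)+
      show "rng w (1 + int (length fs))" using Cons.prems(10) by (rule rng_mono) auto
      have "\<forall>v \<in> levels t. v \<le> b" using Cons.prems(11) by blast
      from levels_fix_up[OF this] Cons.prems(11)
      show "\<forall>v \<in> levels ?t \<union> frames_levels fs. v \<le> b + 1" by (cases f) force+
      show "b + 1 + int (length fs) + 2 < 2 ^ (w - 1)" using Cons.prems(12) by simp
    qed
    then show ?thesis
    proof (rule wp_mono, elim conjE)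
      fix l s2
      assume 2: "l \<le> 450 * (1 + length fs)" "rep w (mem s2) (tmem s2) (close (fix_up ?t) fs)"
        "mem s2 (ad 0 6) = rt (close (fix_up ?t) fs)"
        "touch (insert (ad 0 6) (cells (nids ?t \<union> fnids fs))) ?T s1 s2"
      have "touch ?C ?T s s1" using 1(3) nt(2) by (auto simp: touch_def s0_def cells_Un intro!: M)
      from touch_trans[OF this 2(4)[unfolded nt(1)], of ?C ?T] 2 k show "?Q (Suc (30 + (k + l))) s2" by simp
    qed
  qed
  have "wp w Up ?Q s" unfolding Up_def
    apply (rule wp_While_True)
    subgoal by simp
    subgoal using Cons.prems by simp
    apply (intro wp_Seq wp_Asg; simp?)
    using Cons.prems stk_top[OF Cons.prems(4)] apply (simp add: r1 wr s0_def[symmetric, simplified])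
    apply (rule wp_mono[OF F], elim conjE)
    apply (drule (3) U)
    apply (fold Up_def)
    apply (erule wp_mono)
    apply simp
    done
  then show ?case by simp
qed

section \<open>Search in memory\<close>

definition Cmp :: prog where
  "Cmp = Seq (Asg 19 (Fd (Var 16) 5)) (Seq (Instr (TLoad 2 16))
    (Cond (Less 19 13) (Asg 18 (Num (-1))) (Cond (Less 13 19) (Asg 18 (Num 1))
      (Cond (TLess 2 1) (Asg 18 (Num (-1))) (Cond (TLess 1 2) (Asg 18 (Num 1)) (Asg 18 (Num 0)))))))"

lemma wp_Cmp:
  assumes a: "mem s (ad (reg s 16) 5) = fst a" "tmem s (reg s 16) = snd a" "rng w (reg s 16)"
    and k: "k = (reg s 13, treg s 1)"
    and Q: "\<And>n. n \<le> 20 \<Longrightarrow> Q n (s\<lparr>treg := (treg s)(2 := snd a), reg := (reg s)(19 := fst a,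
      18 := if a < k then -1 else if a = k then 0 else 1)\<rparr>)"
  shows "wp w Cmp Q s"
proof -
  have r: "wrap w (- 1) = - 1" "wrap w 1 = 1" using a(3) by (auto simp: rng_def intro!: rng_wrap)
  obtain a1 a2 where a': "a = (a1, a2)" by (cases a)
  have Q': "Q n (s\<lparr>treg := (treg s)(2 := a2), reg := (reg s)(19 := a1, 18 := c)\<rparr>)"
    if "n \<le> 20" "c = (if a < k then -1 else if a = k then 0 else 1)" for n c
    using Q[OF that(1)] that(2) a' by simp
  show ?thesis unfolding Cmp_def
    apply (intro wp_Seq wp_Asg wp_TLoad; (simp add: a a')?)
    apply (intro wp_Cond wp_Asg; (simp add: r)?)
    by (rule Q'; simp add: a' k)+
qed

text \<open>On a hit register 16 is cleared, which ends the loop just as an empty subtree does;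
  register 18 tells the two outcomes apart.\<close>

definition Find_loop :: prog where
  "Find_loop = While (Less 3 16) (Seq (Asg 17 (Bin Add (Var 17) (Num 1))) (Seq (Sto (Ad (Var 17) 7) (Var 15))
    (Seq Cmp (Cond (Eq 18 3) (Asg 16 (Num 0))
      (Seq (Cond (Less 18 3) (Asg 15 (Ad (Var 16) 1)) (Asg 15 (Ad (Var 16) 0))) (Asg 16 (Mem (Var 15))))))))"

definition stack :: "int set" where
  "stack = {ad j 7 | j. 0 < j}"

lemma ad_in_stack [simp]: "0 \<le> f \<Longrightarrow> f < 8 \<Longrightarrow> ad i f \<in> stack \<longleftrightarrow> 0 < i \<and> f = 7"
  by (auto simp: stack_def)

definition at_pos :: "nat \<Rightarrow> state \<Rightarrow> key tree \<Rightarrow> key frame list \<Rightarrow> bool" where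
  "at_pos w s t fs \<longleftrightarrow> rep w (mem s) (tmem s) t \<and> crep w (mem s) (tmem s) fs \<and> mem s (link fs) = rt t \<and>
     reg s 15 = link fs \<and> reg s 3 = 0"

text \<open>The stack while the link of the current position has not been pushed yet. A miss ends in
  this state, and \<open>Alloc\<close> pushes the link when it adds the node.\<close>

definition pre_stk :: "(int \<Rightarrow> int) \<Rightarrow> key frame list \<Rightarrow> bool" where
  "pre_stk M fs \<longleftrightarrow> (\<forall>f gs. fs = f # gs \<longrightarrow> stk M gs)"

lemma stk_push: "pre_stk M fs \<Longrightarrow> stk (M(ad (1 + int (length fs)) 7 := link fs)) fs"
proof -
  have *: "int (length gs) + 2 \<le> j \<Longrightarrow> stk M gs \<Longrightarrow> stk (M(ad j 7 := x)) gs" for j x gs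
    by (induction gs) auto
  assume "pre_stk M fs" then show ?thesis by (cases fs) (auto simp: pre_stk_def intro: *)
qed

lemma at_pos_stack:
  "at_pos w s t fs \<Longrightarrow> 0 < j \<Longrightarrow> at_pos w (s\<lparr>mem := (mem s)(ad j 7 := x)\<rparr>) t fs"
  unfolding at_pos_def
  apply (elim conjE, intro conjI)
  subgoal by (erule rep_cong) auto
  subgoal by (erule crep_cong) auto
  by (auto dest!: link_cases)

lemma at_pos_cong:
  "at_pos w s t fs \<Longrightarrow> mem s' = mem s \<Longrightarrow> tmem s' = tmem s \<Longrightarrow> reg s' 15 = reg s 15 \<Longrightarrow> reg s' 3 = reg s 3 \<Longrightarrow>
   at_pos w s' t fs"
  unfolding at_pos_def by simp

lemma at_pos_right:
  "at_pos w s (Nd l i v a x r) fs \<Longrightarrow> mem s' = mem s \<Longrightarrow> tmem s' = tmem s \<Longrightarrow> reg s' 15 = ad i 1 \<Longrightarrow>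
   reg s' 3 = 0 \<Longrightarrow> at_pos w s' r (Lo l i v a x # fs)"
  unfolding at_pos_def by simp

lemma at_pos_left:
  "at_pos w s (Nd l i v a x r) fs \<Longrightarrow> mem s' = mem s \<Longrightarrow> tmem s' = tmem s \<Longrightarrow> reg s' 15 = ad i 0 \<Longrightarrow>
   reg s' 3 = 0 \<Longrightarrow> at_pos w s' l (Hi i v a x r # fs)"
  unfolding at_pos_def by simp

definition located :: "nat \<Rightarrow> state \<Rightarrow> key tree \<Rightarrow> key frame list \<Rightarrow> bool" where
  "located w s u gs \<longleftrightarrow> at_pos w s u gs \<and>
     (if u = Lf then reg s 18 \<noteq> 0 \<and> reg s 17 = int (length gs) \<and> pre_stk (mem s) gs
      else reg s 18 = 0 \<and> reg s 17 = 1 + int (length gs) \<and> stk (mem s) gs)"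

lemma wp_Find_loop:
  assumes "at_pos w s t fs" "reg s 16 = rt t" "reg s 17 = int (length fs)" "reg s 18 \<noteq> 0" "pre_stk (mem s) fs"
    "k = (reg s 13, treg s 1)" "rng w (int (length fs + depth t) + 1)" "descend k t fs = (u, gs)"
  shows "wp w Find_loop
    (\<lambda>n s'. n \<le> 80 * (1 + depth t) \<and> located w s' u gs \<and> touch stack {15, 16, 17, 18, 19} s s') s"
  using assms
proof (induction t arbitrary: fs s)
  case Lf
  then show ?case unfolding Find_loop_def
    by (intro wp_While_False) (auto simp: touch_def at_pos_def located_def)
next
  case (Nd l i v a x r)
  let ?t = "Nd l i v a x r" and ?S = "{15, 16, 17, 18, 19} :: nat set"
  have i: "0 < i" "rng w i" "mem s (ad i 5) = fst a" "tmem s i = snd a" "reg s 3 = 0" "reg s 15 = link fs"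
    using Nd.prems(1) by (auto simp: at_pos_def)
  have j: "rng w (int (length fs) + 1)" by (rule rng_mono[OF Nd.prems(7)]) auto
  have j': "wrap w (int (length fs) + 1) = int (length fs) + 1" "wrap w 1 = 1"
    using j by (auto intro!: rng_wrap)
  define M where "M = (mem s)(ad (1 + int (length fs)) 7 := link fs)"
  define R where "R = (reg s)(17 := int (length fs) + 1, 19 := fst a,
    18 := if a < k then -1 else if a = k then 0 else 1 :: int)"
  define T where "T = (treg s)(2 := snd a)"
  let ?s = "\<lambda>R'. s\<lparr>mem := M, treg := T, reg := R'\<rparr>"
  have p: "at_pos w (?s R') ?t fs" if "R' 15 = link fs" "R' 3 = 0" for R'
    using that i by (intro at_pos_cong[OF at_pos_stack[OF Nd.prems(1), of "1 + int (length fs)" "link fs"]])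
      (simp_all add: M_def)
  have st: "stk M fs" using stk_push[OF Nd.prems(5)] by (simp add: M_def)
  have tch: "touch stack ?S s (?s R')" if "\<And>r. r \<notin> ?S \<Longrightarrow> R' r = reg s r" for R'
    using that by (auto simp: touch_def M_def T_def)
  have R: "R 3 = 0" "R 15 = link fs" "R 16 = i" "R 17 = int (length fs) + 1"
    and R18: "R 18 = (if a < k then -1 else if a = k then 0 else 1)" and K: "k = (R 13, T 1)"
    and RS: "\<And>r. r \<notin> ?S \<Longrightarrow> R r = reg s r"
    using Nd.prems(2,6) i by (auto simp: R_def T_def)
  have lr: "M (ad i 0) = rt l" "M (ad i 1) = rt r" using p[of R] R by (auto simp: at_pos_def)
  let ?P = "\<lambda>b n s'. n \<le> b \<and> located w s' u gs \<and> touch stack ?S s s'"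
  let ?B = "80 * (1 + depth ?t)"
  have C: "wp w (Cond (Eq 18 3) (Asg 16 (Num 0))
      (Seq (Cond (Less 18 3) (Asg 15 (Ad (Var 16) 1)) (Asg 15 (Ad (Var 16) 0))) (Asg 16 (Mem (Var 15)))))
      (\<lambda>m. wp w Find_loop (\<lambda>l. ?P (?B - 50) (m + l))) (?s R)"
  proof -
    consider "a = k" | "a \<noteq> k" "a < k" | "a \<noteq> k" "\<not> a < k" by blast
    then show ?thesis
    proof cases
      case 1
      have r: "R 18 = 0" using R18 1 by simp
      have ug: "u = ?t" "gs = fs" using Nd.prems(8) 1 by auto
      have "located w (?s (R(16 := 0))) u gs"
        using p[of "R(16 := 0)"] st R r unfolding ug located_def by simp
      moreover have "touch stack ?S s (?s (R(16 := 0)))" by (rule tch) (simp add: RS)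
      ultimately have F: "wp w Find_loop (?P 1) (?s (R(16 := 0)))"
        unfolding Find_loop_def by (intro wp_While_False) (simp_all add: R)
      show ?thesis
      proof (rule wp_Cond)
        assume "test_val (Eq 18 3) (?s R)"
        show "wp w (Asg 16 (Num 0)) (\<lambda>k. wp w Find_loop (\<lambda>l. ?P (?B - 50) (Suc k + l))) (?s R)"
          by (rule wp_Asg, simp, simp) (simp, rule wp_mono[OF F], simp)
      qed (simp_all add: R r)
    next
      case 2
      let ?s3 = "?s (R(15 := ad i 1, 16 := rt r))" and ?f = "Lo l i v a x"
      have r: "R 18 = -1" using R18 2 by simp
      have d: "descend k r (?f # fs) = (u, gs)" using Nd.prems(8) 2 by simp
      have F: "wp w Find_loop (\<lambda>n s'. n \<le> 80 * (1 + depth r) \<and> located w s' u gs \<and> touch stack ?S ?s3 s') ?s3"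
      proof (rule Nd.IH(2)[OF _ _ _ _ _ _ _ d])
        show "at_pos w ?s3 r (?f # fs)" by (rule at_pos_right[OF p[of R]]) (simp_all add: R)
        show "k = (reg ?s3 13, treg ?s3 1)" using K by simp
        show "rng w (int (length (?f # fs) + depth r) + 1)" by (rule rng_mono[OF Nd.prems(7)]) auto
        show "pre_stk (mem ?s3) (?f # fs)" using st by (simp add: pre_stk_def)
      qed (simp_all add: R r)
      have t3: "touch stack ?S s ?s3" by (rule tch) (simp add: RS)
      have F': "wp w Find_loop (?P (80 * (1 + depth r))) ?s3"
        by (rule wp_mono[OF F]) (use touch_trans[OF t3, of stack ?S _ stack ?S] in blast)
      show ?thesis
      proof (rule wp_Cond, goal_cases)
        case 3
        show ?case
          apply (intro wp_Seq wp_Cond wp_Asg)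
          apply (simp_all add: R r i lr)
          apply (rule wp_mono[OF F'])
          apply (simp add: max_def)
          done
      qed (simp_all add: R r)
    next
      case 3
      let ?s3 = "?s (R(15 := ad i 0, 16 := rt l))" and ?f = "Hi i v a x r"
      have r: "R 18 = 1" using R18 3 by simp
      have d: "descend k l (?f # fs) = (u, gs)" using Nd.prems(8) 3 by simp
      have F: "wp w Find_loop (\<lambda>n s'. n \<le> 80 * (1 + depth l) \<and> located w s' u gs \<and> touch stack ?S ?s3 s') ?s3"
      proof (rule Nd.IH(1)[OF _ _ _ _ _ _ _ d])
        show "at_pos w ?s3 l (?f # fs)" by (rule at_pos_left[OF p[of R]]) (simp_all add: R)
        show "k = (reg ?s3 13, treg ?s3 1)" using K by simp
        show "rng w (int (length (?f # fs) + depth l) + 1)" by (rule rng_mono[OF Nd.prems(7)]) auto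
        show "pre_stk (mem ?s3) (?f # fs)" using st by (simp add: pre_stk_def)
      qed (simp_all add: R r)
      have t3: "touch stack ?S s ?s3" by (rule tch) (simp add: RS)
      have F': "wp w Find_loop (?P (80 * (1 + depth l))) ?s3"
        by (rule wp_mono[OF F]) (use touch_trans[OF t3, of stack ?S _ stack ?S] in blast)
      show ?thesis
      proof (rule wp_Cond, goal_cases)
        case c: 3
        show ?case
          apply (intro wp_Seq wp_Cond wp_Asg)
          apply (simp_all add: R r i lr)
          apply (rule wp_mono[OF F'])
          apply (simp add: max_def)
          done
      qed (simp_all add: R r)
    qed
  qed
  have "wp w Find_loop (?P ?B) s" unfolding Find_loop_def
    apply (rule wp_While_True; (simp add: Nd.prems i)?)
    apply (rule wp_SeqI[OF wp_Asg[where Q = "\<lambda>n s'. n = 4 \<and> s' = s\<lparr>reg := (reg s)(17 := int (length fs) + 1)\<rparr>"]])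
    apply (simp_all add: Nd.prems j')
    apply (intro wp_Seq wp_Sto; (simp add: i j j')?)
    apply (rule wp_Cmp[of _ a _ k])
    subgoal by (simp add: i Nd.prems)
    subgoal by (simp add: i Nd.prems)
    subgoal by (simp add: i Nd.prems)
    subgoal by (simp add: Nd.prems)
    apply (fold Find_loop_def)
    subgoal for n
      \<comment> \<open>Symbolic execution has produced a state written differently from
        \<open>?s R\<close>. The claim is proved for the latter, and the equality of the two states
        remains as the last goal.\<close>
      apply (rule back_subst[where P = "wp w _ _"])
       apply (rule wp_mono[OF C])
       apply (rule wp_mono, assumption)
       apply (simp add: max_def)
      apply (simp add: R_def M_def T_def add.commute)
      done
    done
  then show ?case .
qed

definition Find :: prog where
  "Find = Seq (Asg 15 (Ad (Num 0) 6)) (Seq (Asg 17 (Num 0)) (Seq (Asg 16 (Mem (Var 15)))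
    (Seq (Asg 18 (Num 1)) Find_loop)))"

definition tree_at :: "nat \<Rightarrow> state \<Rightarrow> key tree \<Rightarrow> bool" where
  "tree_at w s t \<longleftrightarrow> rep w (mem s) (tmem s) t \<and> mem s (ad 0 6) = rt t \<and> reg s 3 = 0"

lemma wp_Find:
  assumes "tree_at w s t" "k = (reg s 13, treg s 1)" "rng w (int (depth t) + 1)"
    "descend k t [] = (u, gs)"
  shows "wp w Find
    (\<lambda>n s'. n \<le> 120 * (1 + depth t) \<and> located w s' u gs \<and> touch stack {15, 16, 17, 18, 19} s s') s"
proof -
  let ?S = "{15, 16, 17, 18, 19} :: nat set"
  have r: "rng w 0" "wrap w 1 = 1" using assms(3) by (auto intro: rng_mono rng_wrap)
  define s1 where "s1 = s\<lparr>reg := (reg s)(15 := ad 0 6, 17 := 0, 16 := rt t, 18 := 1)\<rparr>"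
  have L: "wp w Find_loop (\<lambda>n s'. n \<le> 80 * (1 + depth t) \<and> located w s' u gs \<and> touch stack ?S s1 s') s1"
    by (rule wp_Find_loop[where fs = "[]", OF _ _ _ _ _ _ _ assms(4)])
      (use assms in \<open>auto simp: s1_def at_pos_def tree_at_def pre_stk_def\<close>)
  have t1: "touch stack ?S s s1" by (auto simp: touch_def s1_def)
  have L': "wp w Find_loop (\<lambda>n s'. n \<le> 80 * (1 + depth t) \<and> located w s' u gs \<and> touch stack ?S s s') s1"
    by (rule wp_mono[OF L]) (use touch_trans[OF t1, of stack ?S _ stack ?S] in blast)
  show ?thesis unfolding Find_def
    apply (intro wp_Seq wp_Asg; simp?)
    using assms(1) apply (simp add: r tree_at_def)
    apply (rule back_subst[where P = "wp w _ _"])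
     apply (rule wp_mono[OF L'])
     apply simp
    apply (simp add: s1_def)
    done
qed

text \<open>The node found is reached through the link in register 15, as the loop ends with
  register 16 cleared.\<close>

definition Lookup :: prog where
  "Lookup = Seq Find (Cond (Eq 18 3) (Asg 20 (Fd (Mem (Var 15)) 4)) (Asg 20 (Num 0)))"

lemma wp_Lookup:
  assumes "tree_at w s t" "k = (reg s 13, treg s 1)" "rng w (int (depth t) + 1)"
  shows "wp w Lookup (\<lambda>n s'. n \<le> 140 * (1 + depth t) \<and> reg s' 20 = lookup t k \<and>
    touch stack {15, 16, 17, 18, 19, 20} s s') s"
proof -
  obtain u gs where d: "descend k t [] = (u, gs)" by (cases "descend k t []")
  show ?thesis unfolding Lookup_def
  proof (rule wp_SeqI[OF wp_Find[OF assms d]], elim conjE, goal_cases)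
    case (1 n s1)
    note l = 1(2)[unfolded located_def at_pos_def]
    show ?case
      using 1 l descend_lookup[OF d]
      by (intro wp_Cond wp_Asg; cases u; simp add: touch_def)
  qed
qed

section \<open>Prefix sums in memory\<close>

definition Prefix_loop :: prog where
  "Prefix_loop = While (Less 3 16) (Seq Cmp (Cond (Less 3 18) (Asg 16 (Fd (Var 16) 0))
     (Seq (Asg 20 (Bin Add (Var 20) (Bin Add (Fd (Var 16) 4) (Fd (Fd (Var 16) 0) 3))))
       (Asg 16 (Fd (Var 16) 1)))))"

text \<open>The integer \<open>y\<close> is the exact sum collected so far; the accumulator holds
  only its residue, which addition respects.\<close>

lemma wp_Prefix_loop:
  assumes "rep w (mem s) (tmem s) t" "reg s 16 = rt t" "reg s 3 = 0" "k = (reg s 13, treg s 1)"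
    "reg s 20 = wrap w y"
  shows "wp w Prefix_loop (\<lambda>n s'. n \<le> 80 * (1 + depth t) \<and> reg s' 20 = wrap w (y + prefix t k) \<and>
    touch {} {16, 18, 19, 20} s s') s"
  using assms
proof (induction t arbitrary: s y)
  case Lf
  then show ?case unfolding Prefix_loop_def
    by (intro wp_While_False) (auto simp: touch_def)
next
  case (Nd l i v a x r)
  let ?t = "Nd l i v a x r" and ?S = "{16, 18, 19, 20} :: nat set"
  have wr: "wrap w (y + (x + wrap w (tsum l))) = wrap w (y + (x + tsum l))"
    by (metis wrap_add_right add.assoc)
  define z where "z = y + prefix ?t k"
  let ?P = "\<lambda>b n s'. n \<le> b \<and> reg s' 20 = wrap w z \<and> touch {} ?S s s'"
  have rp: "rep w (mem s) (tmem s) l" "rep w (mem s) (tmem s) r" "0 < i" "rng w i"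
    "mem s (ad i 5) = fst a" "tmem s i = snd a" "mem s (ad i 4) = x" "mem s (ad i 0) = rt l"
    "mem s (ad i 1) = rt r" "reg s 16 = i"
    using Nd.prems(1,2) by auto
  note facts = rep_facts[OF rp(1)]
  define R where "R = (reg s)(19 := fst a, 18 := if a < k then -1 else if a = k then 0 else 1 :: int)"
  define T where "T = (treg s)(2 := snd a)"
  let ?s = "\<lambda>R'. s\<lparr>treg := T, reg := R'\<rparr>"
  have R: "R 3 = 0" "R 16 = i" "R 20 = wrap w y"
    and R18: "R 18 = (if a < k then -1 else if a = k then 0 else 1)" and K: "k = (R 13, T 1)"
    and RS: "\<And>r. r \<notin> ?S \<Longrightarrow> R r = reg s r"
    using Nd.prems rp by (auto simp: R_def T_def)
  have tch: "touch {} ?S s (?s R')" if "\<And>r. r \<notin> ?S \<Longrightarrow> R' r = reg s r" for R'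
    using that by (auto simp: touch_def T_def)
  have C: "wp w (Cond (Less 3 18) (Asg 16 (Fd (Var 16) 0))
     (Seq (Asg 20 (Bin Add (Var 20) (Bin Add (Fd (Var 16) 4) (Fd (Fd (Var 16) 0) 3))))
       (Asg 16 (Fd (Var 16) 1)))) (\<lambda>m. wp w Prefix_loop (\<lambda>l. ?P (80 * (1 + depth ?t) - 40) (m + l))) (?s R)"
  proof (rule wp_Cond)
    assume "test_val (Less 3 18) (?s R)"
    then have ak: "\<not> a \<le> k" using R R18 by (auto split: if_splits)
    let ?s3 = "?s (R(16 := rt l))"
    have F: "wp w Prefix_loop (\<lambda>n s'. n \<le> 80 * (1 + depth l) \<and> reg s' 20 = wrap w (y + prefix l k) \<and>
      touch {} ?S ?s3 s') ?s3"
      by (rule Nd.IH(1)) (use rp R K in auto)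
    have t3: "touch {} ?S s ?s3" by (rule tch) (simp add: RS)
    have F': "wp w Prefix_loop (?P (80 * (1 + depth l))) ?s3"
      by (rule wp_mono[OF F]) (use ak touch_trans[OF t3, of "{}" ?S _ "{}" ?S] in \<open>auto simp: z_def\<close>)
    show "wp w (Asg 16 (Fd (Var 16) 0))
      (\<lambda>k'. wp w Prefix_loop (\<lambda>l. ?P (80 * (1 + depth ?t) - 40) (Suc k' + l))) (?s R)"
      apply (intro wp_Asg; simp?)
      apply (simp add: R rp)
      apply (rule wp_mono[OF F'])
      apply (simp add: max_def)
      done
  next
    assume "\<not> test_val (Less 3 18) (?s R)"
    then have ak: "a \<le> k" using R R18 by (auto split: if_splits)
    let ?s3 = "?s (R(20 := wrap w (y + (x + tsum l)), 16 := rt r))"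
    have F: "wp w Prefix_loop (\<lambda>n s'. n \<le> 80 * (1 + depth r) \<and>
      reg s' 20 = wrap w (y + (x + tsum l) + prefix r k) \<and> touch {} ?S ?s3 s') ?s3"
      by (rule Nd.IH(2)) (use rp R K in auto)
    have t3: "touch {} ?S s ?s3" by (rule tch) (simp add: RS)
    have F': "wp w Prefix_loop (?P (80 * (1 + depth r))) ?s3"
      by (rule wp_mono[OF F]) (use ak touch_trans[OF t3, of "{}" ?S _ "{}" ?S] in \<open>auto simp: z_def algebra_simps\<close>)
    show "wp w (Seq (Asg 20 (Bin Add (Var 20) (Bin Add (Fd (Var 16) 4) (Fd (Fd (Var 16) 0) 3))))
       (Asg 16 (Fd (Var 16) 1)))
      (\<lambda>k'. wp w Prefix_loop (\<lambda>l. ?P (80 * (1 + depth ?t) - 40) (Suc k' + l))) (?s R)"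
      apply (intro wp_Seq wp_Asg; simp?)
      apply (simp add: R rp facts wr)
      apply (rule wp_mono[OF F'])
      apply (simp add: max_def)
      done
  qed simp
  have "wp w Prefix_loop (?P (80 * (1 + depth ?t))) s" unfolding Prefix_loop_def
    apply (rule wp_While_True)
    subgoal by simp
    subgoal using rp by (simp add: Nd.prems(3))
    apply (rule wp_Seq)
    apply (rule wp_Cmp[of _ a _ k])
    subgoal using rp by simp
    subgoal using rp by simp
    subgoal using rp by simp
    subgoal by (simp add: Nd.prems)
    apply (fold Prefix_loop_def)
    subgoal for n
      apply (rule back_subst[where P = "wp w _ _"])
       apply (rule wp_mono[OF C])
       apply (rule wp_mono, assumption)
       apply (simp add: max_def)
      apply (simp add: R_def T_def)
      done
    done
  then show ?case by (simp only: z_def)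
qed

definition Prefix :: prog where
  "Prefix = Seq (Asg 16 (Mem (Ad (Num 0) 6))) (Seq (Asg 20 (Num 0)) Prefix_loop)"

lemma wp_Prefix:
  assumes "tree_at w s t" "k = (reg s 13, treg s 1)" "rng w 0"
  shows "wp w Prefix (\<lambda>n s'. n \<le> 100 * (1 + depth t) \<and> reg s' 20 = wrap w (prefix t k) \<and>
    touch {} {16, 18, 19, 20} s s') s"
proof -
  define s1 where "s1 = s\<lparr>reg := (reg s)(16 := rt t, 20 := 0)\<rparr>"
  let ?S = "{16, 18, 19, 20} :: nat set"
  have L: "wp w Prefix_loop (\<lambda>n s'. n \<le> 80 * (1 + depth t) \<and> reg s' 20 = wrap w (0 + prefix t k) \<and>
    touch {} ?S s1 s') s1"
    by (rule wp_Prefix_loop) (use assms in \<open>auto simp: s1_def tree_at_def\<close>)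
  have t1: "touch {} ?S s s1" by (auto simp: touch_def s1_def)
  have L': "wp w Prefix_loop (\<lambda>n s'. n \<le> 80 * (1 + depth t) \<and> reg s' 20 = wrap w (prefix t k) \<and>
    touch {} ?S s s') s1"
    by (rule wp_mono[OF L]) (use touch_trans[OF t1, of "{}" ?S _ "{}" ?S] in auto)
  show ?thesis unfolding Prefix_def
    apply (intro wp_Seq wp_Asg; simp?)
    using assms apply (simp add: tree_at_def)
    apply (rule back_subst[where P = "wp w _ _"])
     apply (rule wp_mono[OF L'])
     apply simp
    apply (simp add: s1_def)
    done
qed

text \<open>What an insertion leaves alone includes the negative addresses, which belong to the
  table of weights, and the nodes above \<open>N\<close>, which a rebuild may still have to
  read.\<close>

definition keep :: "state \<Rightarrow> state \<Rightarrow> int \<Rightarrow> bool" where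
  "keep s s' N \<longleftrightarrow> (\<forall>a<0. mem s' a = mem s a) \<and>
     (\<forall>i>N. \<forall>f\<in>{0..5}. mem s' (ad i f) = mem s (ad i f)) \<and> (\<forall>i>N. tmem s' i = tmem s i) \<and>
     (\<forall>r. r \<notin> {11, 15, 16, 17, 18, 19, 20, 24, 25} \<longrightarrow> reg s' r = reg s r) \<and>
     (\<forall>r. r \<noteq> 2 \<longrightarrow> treg s' r = treg s r)"

lemma keep_trans: "keep s s' N \<Longrightarrow> keep s' s'' N' \<Longrightarrow> N \<le> N' \<Longrightarrow> keep s s'' N'"
  unfolding keep_def by auto

lemma keep_touch:
  assumes "touch A R s s'" "R \<subseteq> {11, 15, 16, 17, 18, 19, 20, 24, 25}"
    "A \<subseteq> stack \<union> insert (ad 0 6) (cells X)" "X \<subseteq> {1..N}" "0 \<le> N"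
  shows "keep s s' N"
proof -
  have M: "mem s' a = mem s a" if "a \<notin> stack" "a \<noteq> ad 0 6" "a \<notin> cells X" for a
    using assms that by (auto simp: touch_def)
  have "a \<notin> stack \<and> a \<noteq> ad 0 6 \<and> a \<notin> cells X" if "a < 0" for a
    using that assms(4) by (auto simp: stack_def cells_def ad_def)
  moreover have "ad i f \<notin> stack \<and> ad i f \<noteq> ad 0 6 \<and> ad i f \<notin> cells X" if "i > N" "f \<in> {0..5}" for i f
    using that assms(4,5) by auto
  ultimately show ?thesis unfolding keep_def
    using assms(1,2) by (intro conjI allI impI ballI M) (auto simp: touch_def)
qed

lemma ad_nonneg: "0 \<le> i \<Longrightarrow> 0 \<le> f \<Longrightarrow> \<not> ad i f < 0"
  by (simp add: ad_def)

section \<open>Insertion in memory\<close>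

definition Alloc :: prog where
  "Alloc = Seq (Cond (Eq 18 3) (Asg 16 (Mem (Var 15)))
    (Seq (Asg 11 (Bin Add (Var 11) (Num 1))) (Seq (Asg 16 (Var 11)) (Seq (Sto (Ad (Var 16) 0) (Num 0))
    (Seq (Sto (Ad (Var 16) 1) (Num 0)) (Seq (Sto (Ad (Var 16) 2) (Num 1)) (Seq (Sto (Ad (Var 16) 5) (Var 13))
    (Seq (Instr (TStore 1 16)) (Seq (Sto (Var 15) (Var 16)) (Seq (Asg 17 (Bin Add (Var 17) (Num 1)))
    (Sto (Ad (Var 17) 7) (Var 15))))))))))))
    (Sto (Ad (Var 16) 4) (Var 14))"

definition ready :: "nat \<Rightarrow> state \<Rightarrow> key tree \<Rightarrow> key frame list \<Rightarrow> bool" where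
  "ready w s u gs \<longleftrightarrow> rep0 w (mem s) (tmem s) u \<and> mem s (link gs) = rt u \<and> crep w (mem s) (tmem s) gs \<and>
     stk (mem s) gs \<and> reg s 17 = 1 + int (length gs) \<and> reg s 3 = 0"

lemma pre_stk_cong: "pre_stk M fs \<Longrightarrow> (\<And>j. M' (ad j 7) = M (ad j 7)) \<Longrightarrow> pre_stk M' fs"
  unfolding pre_stk_def by (auto intro: stk_cong)

lemma wp_Alloc:
  assumes l: "located w s u gs" and N: "reg s 11 = N" "rng w (N + 1)" "0 \<le> N"
    and ids: "nids u \<union> fnids gs \<subseteq> {1..N}" "nids u \<inter> fnids gs = {}" "disj u" "fdisj gs"
    and r: "rng w (1 + int (length gs))" and k: "k = (reg s 13, treg s 1)"
  defines "N' \<equiv> if u = Lf then N + 1 else N"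
  shows "wp w Alloc (\<lambda>n s'. n \<le> 100 \<and> ready w s' (put k (reg s 14) (N + 1) u) gs \<and> reg s' 11 = N' \<and>
    keep s s' N') s"
proof -
  have c: "crep w (mem s) (tmem s) gs" and m: "mem s (link gs) = rt u" and rp: "rep w (mem s) (tmem s) u"
    and 15: "reg s 15 = link gs" and 3: "reg s 3 = 0"
    using l by (auto simp: located_def at_pos_def)
  obtain g f where lk: "link gs = ad g f" "f = 6 \<and> g = 0 \<or> f \<in> {0,1} \<and> 0 < g" "g \<in> insert 0 (fnids gs)"
    using link_cases[OF c] by blast
  have w1: "wrap w 1 = 1" "wrap w (N + 1) = N + 1" "wrap w (int (length gs) + 1) = int (length gs) + 1"
    using N rng_wrap[OF r, of "int (length gs) + 1"] rng_wrap[OF N(2)] by auto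
  have r': "rng w (int (length gs) + 1)" using r by (simp add: add.commute)
  show ?thesis
  proof (cases u)
    case (Nd lt i v a x rt')
    have i: "0 < i" "rng w i" "i \<notin> fnids gs" "i \<in> {1..N}" "i \<noteq> g \<or> f \<noteq> 4" "f \<noteq> 4" using rp ids lk Nd by auto
    define M where "M = (mem s)(ad i 4 := reg s 14)"
    have "crep w M (tmem s) gs" using c unfolding M_def by (rule crep_cong) (use i in auto)
    moreover have "rep0 w M (tmem s) (put k (reg s 14) (N + 1) u)"
      using rp ids Nd by (auto simp: M_def)
    moreover have "stk M gs" using l Nd by (auto simp: located_def M_def intro: stk_cong)
    ultimately have rd: "ready w (s\<lparr>reg := R, mem := M\<rparr>) (put k (reg s 14) (N + 1) u) gs"
      if "R 17 = 1 + int (length gs)" "R 3 = 0" for R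
      using that m lk i Nd unfolding ready_def by (auto simp: M_def)
    have kp: "keep s (s\<lparr>reg := (reg s)(16 := i), mem := M\<rparr>) N"
      using i unfolding keep_def M_def by (auto simp: ad_def)
    have s: "reg s 18 = 0" "reg s 17 = 1 + int (length gs)" using l Nd by (auto simp: located_def)
    show ?thesis unfolding Alloc_def
      apply (intro wp_Seq)
      apply (rule wp_Cond; simp add: s 3)
      apply (intro wp_Asg wp_Sto; simp)
      apply (simp add: 15 m Nd i)
      using rd[of "(reg s)(16 := i)"] kp s 3 N Nd by (simp add: M_def N'_def)
  next
    case Lf
    define j where "j = N + 1"
    have j: "0 < j" "rng w j" "j \<notin> fnids gs" "j \<noteq> 0" "j \<noteq> g" using N ids lk j_def by auto
    have jN: "N + 1 = j" "wrap w j = j" using w1 by (simp_all add: j_def)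
    let ?n = "1 + int (length gs)"
    define M1 where "M1 = (mem s)(ad j 0 := 0, ad j 1 := 0, ad j 2 := 1, ad j 5 := fst k)"
    define M where "M = M1(link gs := j, ad ?n 7 := link gs, ad j 4 := reg s 14)"
    define U where "U = (tmem s)(j := snd k)"
    define R where "R = (reg s)(11 := j, 16 := j, 17 := ?n)"
    have M: "M (ad i f) = mem s (ad i f)" if "i \<noteq> j" "0 \<le> f" "f < 7" "ad i f \<noteq> link gs" for i f
      using that by (simp add: M_def M1_def)
    have "crep w (M1(ad ?n 7 := link gs, ad j 4 := reg s 14)) U gs"
      using c by (rule crep_cong) (use j in \<open>auto simp: M1_def U_def\<close>)
    \<comment> \<open>With \<open>X = {}\<close> this covers the store through the open link, the
      one cell of the context that may change.\<close>
    then have "crep w M U gs"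
      by (rule crep_change[where X = "{}"]) (use ids in \<open>auto simp: M_def\<close>)
    \<comment> \<open>The sum of the new node is not initialised: \<open>rep0\<close> does not ask
      for it, and \<open>Up\<close> computes it.\<close>
    moreover have "rep0 w M U (put k (reg s 14) j u)"
      using rp lk j by (auto simp: M_def M1_def U_def Lf)
    moreover have "pre_stk (M1(link gs := j)) gs"
      using l Lf lk by (auto simp: located_def M1_def intro!: pre_stk_cong[of "mem s"])
    from stk_push[OF this] have "stk M gs" unfolding M_def by (rule stk_cong) simp
    ultimately have rd: "ready w (s\<lparr>mem := M, tmem := U, reg := R\<rparr>) (put k (reg s 14) j u) gs"
      using lk j Lf 3 by (auto simp: ready_def R_def M_def)
    have kp: "keep s (s\<lparr>mem := M, tmem := U, reg := R\<rparr>) j"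
    proof -
      have g: "0 \<le> g" "g < j" using lk ids N j_def by auto
      have "M a = mem s a" if "a < 0" for a
        using that lk g j ad_nonneg[of g f] ad_nonneg[of j] ad_nonneg[of ?n 7] by (auto simp: M_def M1_def)
      moreover have "M (ad i f') = mem s (ad i f')" if "i > j" "f' \<in> {0..5}" for i f'
        using that lk g j by (auto simp: M_def M1_def)
      ultimately show ?thesis unfolding keep_def by (simp add: R_def U_def)
    qed
    have s: "reg s 18 \<noteq> 0" "reg s 17 = int (length gs)" using l Lf by (auto simp: located_def)
    have "wp w Alloc (\<lambda>n s'. n \<le> 100 \<and> s' = s\<lparr>mem := M, tmem := U, reg := R\<rparr>) s"
      unfolding Alloc_def
      apply (intro wp_Seq)
      apply (rule wp_Cond; simp add: s 3)
      apply (rule wp_Seq, rule wp_Asg, simp, simp, simp add: 15 N(1) w1 s 3 j jN k r')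
      apply (rule wp_Seq, rule wp_Asg, simp, simp, simp add: 15 N(1) w1 s 3 j jN k r')
      apply (rule wp_Seq, rule wp_Sto, simp, simp, simp add: 15 N(1) w1 s 3 j jN k r')
      apply (rule wp_Seq, rule wp_Sto, simp, simp, simp add: 15 N(1) w1 s 3 j jN k r')
      apply (rule wp_Seq, rule wp_Sto, simp, simp, simp add: 15 N(1) w1 s 3 j jN k r')
      apply (rule wp_Seq, rule wp_Sto, simp, simp, simp add: 15 N(1) w1 s 3 j jN k r')
      apply (rule wp_Seq, rule wp_TStore, simp, simp add: 15 N(1) w1 s 3 j jN k r')
      apply (rule wp_Seq, rule wp_Sto, simp, simp, simp add: 15 N(1) w1 s 3 j jN k r')
      apply (rule wp_Seq, rule wp_Asg, simp, simp, simp add: 15 N(1) w1 s 3 j jN k r')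
      apply (rule wp_Sto, simp, simp, simp add: 15 N(1) w1 s 3 j jN k r')
      apply (rule wp_Sto, simp, simp, simp add: 15 N(1) w1 s 3 j jN k r')
      by (simp add: M_def M1_def U_def R_def k add.commute)
    then show ?thesis
      by (rule wp_mono) (use rd kp in \<open>auto simp: N'_def Lf j_def R_def\<close>)
  qed
qed

definition Upsert :: prog where
  "Upsert = Seq Find (Seq Alloc Up)"

definition good :: "nat \<Rightarrow> state \<Rightarrow> key tree \<Rightarrow> bool" where
  "good w s t \<longleftrightarrow> tree_at w s t \<and> ordered t \<and> (\<exists>m. aa m t) \<and> disj t \<and> nids t = {1..int (nodes t)} \<and>
     reg s 11 = int (nodes t)"

lemma put_levels: "levels (put k y j u) \<subseteq> insert 1 (levels u)"
  by (cases u) auto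

text \<open>The number \<open>nodes t + 1\<close> is consumed only for a new key, so the numbers in
  use remain an interval from 1. Knowing the multiset of numbers suffices for their set, their count
  and their distinctness.\<close>

lemma ins_good:
  fixes y :: int and k :: key
  assumes "ordered t" "aa m t" "disj t" "nids t = {1..int (nodes t)}"
  defines "t' \<equiv> ins k y (int (nodes t) + 1) t"
  shows "ordered t'" "\<exists>m. aa m t'" "disj t'" "nids t' = {1..int (nodes t')}"
    "nodes t' = (if k \<in> set (keys t) then nodes t else nodes t + 1)"
proof -
  let ?j = "int (nodes t) + 1"
  have ms: "mset (ids t') = (if k \<in> set (keys t) then mset (ids t) else add_mset ?j (mset (ids t)))"
    unfolding t'_def by (rule mset_ids_ins[OF assms(1)])
  have s: "nids t' = (if k \<in> set (keys t) then nids t else insert ?j (nids t))"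
    using arg_cong[OF ms, of set_mset] by (auto simp: nids_ids split: if_splits)
  show n: "nodes t' = (if k \<in> set (keys t) then nodes t else nodes t + 1)"
    using arg_cong[OF ms, of size] by (auto simp: nodes_entries split: if_splits)
  show "ordered t'" unfolding t'_def by (rule ordered_ins[OF assms(1)])
  show "\<exists>m. aa m t'" unfolding t'_def by (rule ins_aa_exists[OF assms(2)])
  show "nids t' = {1..int (nodes t')}" unfolding s n assms(4) by auto
  have "?j \<notin> nids t" unfolding assms(4) by simp
  then have "distinct (?j # ids t)" using assms(3) by (simp add: disj_ids nids_ids del: set_map)
  moreover have "mset (ids t') = mset (?j # ids t) \<or> mset (ids t') = mset (ids t)"
    unfolding ms by simp
  ultimately show "disj t'" unfolding disj_ids
    by (metis mset_eq_imp_distinct_iff distinct.simps(2))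
qed

lemma wp_Upsert:
  assumes g: "good w s t" and k: "k = (reg s 13, treg s 1)" and r: "rng w (2 * int (nodes t) + 4)"
  defines "t' \<equiv> ins k (reg s 14) (int (nodes t) + 1) t"
  shows "wp w Upsert (\<lambda>n s'. n \<le> 1000 * (1 + depth t) \<and> good w s' t' \<and> keep s s' (int (nodes t'))) s"
proof -
  let ?N = "int (nodes t)"
  obtain m where t: "tree_at w s t" "ordered t" "aa m t" "disj t" "nids t = {1..?N}" "reg s 11 = ?N"
    using g by (auto simp: good_def)
  obtain u gs where d: "descend k t [] = (u, gs)" by (cases "descend k t []")
  have dn: "depth t \<le> nodes t" by (rule depth_nodes)
  have lg: "length gs \<le> depth t" using descend_length[OF d] by simp
  have ids: "nids u \<union> fnids gs = nids t" using descend_nids[OF d] by simp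
  have dj: "disj u \<and> fdisj gs \<and> nids u \<inter> fnids gs = {}" using descend_disj[OF d t(4)] by simp
  have idN: "nids u \<union> fnids gs \<subseteq> {1..?N}" using ids t(5) by simp
  have lv: "levels u \<union> frames_levels gs = levels t" using descend_levels[OF d] by simp
  let ?p = "put k (reg s 14) (?N + 1) u"
  have cl: "close (fix_up ?p) gs = t'" using close_descend[OF d] by (simp add: t'_def)
  note t' = ins_good[OF t(2-5), of k "reg s 14", folded t'_def]
  define N' where "N' = (if u = Lf then ?N + 1 else ?N)"
  have N': "int (nodes t') = N'" using descend_Lf[OF d t(2)] t'(5) by (simp add: N'_def)
  have rngs: "rng w (int (depth t) + 1)" "rng w (?N + 1)" "rng w (1 + int (length gs))"
    by (rule rng_mono[OF r]; use dn lg in linarith)+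
  have F: "wp w Find (\<lambda>n s'. n \<le> 120 * (1 + depth t) \<and> located w s' u gs \<and> touch stack {15, 16, 17, 18, 19} s s') s"
    by (rule wp_Find[OF t(1) k rngs(1) d])
  show ?thesis unfolding Upsert_def
  proof (rule wp_SeqI[OF F], elim conjE, goal_cases)
    case 1: (1 n1 s1)
    have k1: "k = (reg s1 13, treg s1 1)" "reg s1 11 = ?N" "reg s1 14 = reg s 14"
      using 1(3) k t(6) by (auto simp: touch_def)
    have ke1: "keep s s1 ?N" by (rule keep_touch[OF 1(3), of "{}"]) auto
    have A: "wp w Alloc (\<lambda>n s'. n \<le> 100 \<and> ready w s' ?p gs \<and> reg s' 11 = N' \<and> keep s1 s' N') s1"
      unfolding N'_def k1(3)[symmetric]
      by (rule wp_Alloc[OF 1(2) k1(2) rngs(2) _ idN _ _ _ rngs(3) k1(1)]) (simp_all add: dj)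
    show ?case
    proof (rule wp_SeqI[OF A], elim conjE, goal_cases)
      case 2: (1 n2 s2)
      have pn: "nids ?p \<union> fnids gs \<subseteq> {1..N'}" "nids ?p \<inter> fnids gs = {}" "disj ?p"
        using idN dj by (cases u; force simp: N'_def)+
      have lb: "\<forall>v \<in> levels ?p \<union> frames_levels gs. v \<le> ?N + 1"
      proof
        fix v assume "v \<in> levels ?p \<union> frames_levels gs"
        then have "v = 1 \<or> v \<in> levels t" using put_levels[of k "reg s 14" "?N + 1" u] lv by blast
        then show "v \<le> ?N + 1" using levels_nodes[OF t(3)] by fastforce
      qed
      \<comment> \<open>Neither a level nor the search path exceeds the number of nodes, so about
        twice that number bounds every level that rebalancing can produce.\<close>
      have "?N + 1 + int (length gs) + 2 < 8 * (2 * ?N + 4) + 16"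
        using order_trans[OF lg dn] of_nat_0_le_iff[of "nodes t", where 'a = int] by (simp del: of_nat_0_le_iff)
      also have "\<dots> \<le> 2 ^ (w - 1)" using r by (simp add: rng_def)
      finally have bd: "?N + 1 + int (length gs) + 2 < 2 ^ (w - 1)" .
      have U: "wp w Up (\<lambda>k s'. k \<le> 450 * (1 + length gs) \<and> rep w (mem s') (tmem s') t' \<and>
          mem s' (ad 0 6) = rt t' \<and>
          touch (insert (ad 0 6) (cells (nids ?p \<union> fnids gs))) {15, 16, 17, 19, 24, 25} s2 s') s2"
        unfolding cl[symmetric]
        by (rule wp_Up[OF _ _ _ _ _ _ pn(3) _ pn(2) rngs(3) lb bd]) (use 2(2) dj in \<open>simp_all add: ready_def\<close>)
      show ?case
      proof (rule wp_mono[OF U], elim conjE, goal_cases)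
        case 3: (1 n3 s3)
        have "keep s2 s3 N'" by (rule keep_touch[OF 3(4) _ _ pn(1)]) (auto simp: N'_def)
        then have ke: "keep s s3 N'"
          using keep_trans[OF ke1 2(4)] by (intro keep_trans[of s s2 N' s3 N']) (auto simp: N'_def)
        have "reg s3 3 = 0" "reg s3 11 = N'" using 3(4) 2(2,3) by (auto simp: touch_def ready_def)
        then have "good w s3 t'" using 3(2,3) t'(1-4) unfolding good_def tree_at_def N' by (intro conjI)
        with ke 1(1) 2(1) 3(1) lg N' show ?case by simp
      qed
    qed
  qed
qed

text \<open>The factor 2 is due to 3-nodes, which put two nodes on a path. The floor keeps step
  counts among the natural numbers.\<close>

definition depth_bound :: "nat \<Rightarrow> nat" where
  "depth_bound N = 2 * nat \<lfloor>log 2 (real N + 1)\<rfloor>"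

lemma depth_bound:
  assumes "aa m t" "nodes t \<le> N"
  shows "depth t \<le> depth_bound N"
proof -
  have "2 ^ m \<le> N + 1" using nodes_aa[OF assms(1)] assms(2) by linarith
  then have "real m \<le> log 2 (real (N + 1))" by (rule le_log2_of_power)
  then have "m \<le> nat \<lfloor>log 2 (real N + 1)\<rfloor>" by (simp add: le_nat_floor add.commute)
  then show ?thesis using depth_aa[OF assms(1)] by (simp add: depth_bound_def)
qed

lemma good_depth: "good w s t \<Longrightarrow> nodes t \<le> N \<Longrightarrow> depth t \<le> depth_bound N"
  unfolding good_def using depth_bound by blast

lemma nodes_card: "ordered t \<Longrightarrow> nodes t = card (set (keys t))"
proof -
  assume "ordered t"
  then have "distinct (keys t)" unfolding ordered_def strict_sorted_iff by blast
  then have "card (set (keys t)) = length (keys t)" by (rule distinct_card)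
  then show ?thesis by (simp add: nodes_entries)
qed

lemma rep_entry:
  "rep w M U t \<Longrightarrow> (i, a, x) \<in> set (entries t) \<Longrightarrow> M (ad i 4) = x \<and> M (ad i 5) = fst a \<and> U i = snd a"
  by (induction t) auto

section \<open>Rebuilding in place\<close>

definition Rebuild_loop :: prog where
  "Rebuild_loop = While (Less 22 21) (Seq (Asg 22 (Bin Add (Var 22) (Num 1))) (Seq (Asg 14 (Fd (Var 22) 4))
    (Cond (Eq 14 3) Skip (Seq (Asg 13 (Fd (Var 22) 5)) (Seq (Instr (TLoad 1 22)) Upsert)))))"

definition Rebuild :: prog where
  "Rebuild = Seq (Asg 21 (Var 11)) (Seq (Asg 22 (Num 0)) (Seq (Asg 11 (Num 0))
    (Seq (Sto (Ad (Num 0) 6) (Num 0)) Rebuild_loop)))"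

text \<open>The data that outlives a change of the tree: the table of weights, the arguments and
  counters in the low registers, the requested time and the bound of all times.\<close>

definition same :: "state \<Rightarrow> state \<Rightarrow> bool" where
  "same s s' \<longleftrightarrow> (\<forall>a<0. mem s' a = mem s a) \<and> (\<forall>r \<le> 12. r \<noteq> 11 \<longrightarrow> reg s' r = reg s r) \<and>
     treg s' 0 = treg s 0 \<and> treg s' 3 = treg s 3"

lemma same_trans: "same s s' \<Longrightarrow> same s' s'' \<Longrightarrow> same s s''"
  unfolding same_def by auto

lemma same_keep: "keep s s' N \<Longrightarrow> same s s'"
  unfolding same_def keep_def by auto

text \<open>After \<open>i\<close> old nodes have been read the new tree has at most
  \<open>i\<close> nodes, numbered from 1, so it has overwritten only nodes already read.
  \<open>\<kappa>\<close> fixes the keys of the old nodes beforehand, as their cells get lost during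
  the run.\<close>

lemma wp_Rebuild_loop:
  fixes F :: "key \<Rightarrow> int" and \<kappa> :: "nat \<Rightarrow> key"
  assumes "good w s t" "i + d = N" "reg s 22 = int i" "reg s 21 = int N" "nodes t \<le> i"
    "lookup t = (\<lambda>k. if k \<in> \<kappa> ` {1..i} then F k else 0)" "set (keys t) \<subseteq> {k. F k \<noteq> 0}"
    "\<And>j. i < j \<Longrightarrow> j \<le> N \<Longrightarrow> mem s (ad (int j) 4) = F (\<kappa> j) \<and> mem s (ad (int j) 5) = fst (\<kappa> j) \<and>
       tmem s (int j) = snd (\<kappa> j)"
    "rng w (2 * int N + 4)"
  shows "wp w Rebuild_loop (\<lambda>n s'. n \<le> d * (1000 * (1 + depth_bound N) + 50) + 1 \<and>
    (\<exists>t'. good w s' t' \<and> lookup t' = (\<lambda>k. if k \<in> \<kappa> ` {1..N} then F k else 0) \<and>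
      set (keys t') \<subseteq> {k. F k \<noteq> 0}) \<and> same s s') s"
  using assms
proof (induction d arbitrary: i s t)
  case 0
  then show ?case unfolding Rebuild_loop_def
    by (intro wp_While_False) (auto simp: same_def)
next
  case (Suc d)
  let ?j = "int i + 1" and ?T = "1000 * (1 + depth_bound N)"
  let ?P = "\<lambda>b n s'. n \<le> b \<and>
    (\<exists>t'. good w s' t' \<and> lookup t' = (\<lambda>k. if k \<in> \<kappa> ` {1..N} then F k else 0) \<and>
      set (keys t') \<subseteq> {k. F k \<noteq> 0}) \<and> same s s'"
  have iN: "i + 1 \<le> N" using Suc.prems(2) by simp
  have rj: "rng w ?j" by (rule rng_mono[OF Suc.prems(9)]) (use iN in auto)
  have wj: "wrap w ?j = ?j" "wrap w 1 = 1" using rj by (auto intro!: rng_wrap)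
  have r3: "reg s 3 = 0" using Suc.prems(1) by (simp add: good_def tree_at_def)
  let ?k = "\<kappa> (Suc i)"
  have kj: "mem s (ad ?j 4) = F ?k" "mem s (ad ?j 5) = fst ?k" "tmem s ?j = snd ?k"
    using Suc.prems(8)[of "Suc i"] iN by (auto simp: add.commute)
  have K: "\<kappa> ` {1..Suc i} = insert ?k (\<kappa> ` {1..i})"
    by (simp add: atLeastAtMostSuc_conv)
  have gd: "good w s1 t" if "reg s1 3 = 0" "reg s1 11 = reg s 11" "mem s1 = mem s" "tmem s1 = tmem s" for s1
    using Suc.prems(1) that unfolding good_def tree_at_def by simp
  have step: "wp w Rebuild_loop (?P (d * (?T + 50) + 1)) s2"
    if "good w s2 t2" "reg s2 22 = ?j" "reg s2 21 = int N" "nodes t2 \<le> Suc i"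
      "lookup t2 = (\<lambda>k. if k \<in> \<kappa> ` {1..Suc i} then F k else 0)" "set (keys t2) \<subseteq> {k. F k \<noteq> 0}"
      "\<And>j f. Suc i < j \<Longrightarrow> f \<in> {0..5} \<Longrightarrow> mem s2 (ad (int j) f) = mem s (ad (int j) f)"
      "\<And>j. Suc i < j \<Longrightarrow> tmem s2 (int j) = tmem s (int j)" "same s s2" for s2 t2
  proof -
    have "wp w Rebuild_loop (\<lambda>n s'. n \<le> d * (?T + 50) + 1 \<and>
      (\<exists>t'. good w s' t' \<and> lookup t' = (\<lambda>k. if k \<in> \<kappa> ` {1..N} then F k else 0) \<and>
        set (keys t') \<subseteq> {k. F k \<noteq> 0}) \<and> same s2 s') s2"
      by (rule Suc.IH[of _ t2 "Suc i"]) (use that Suc.prems(2,8,9) in auto)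
    then show ?thesis by (rule wp_mono) (use same_trans[OF that(9)] in blast)
  qed
  have main: "wp w (Cond (Eq 14 3) Skip (Seq (Asg 13 (Fd (Var 22) 5)) (Seq (Instr (TLoad 1 22)) Upsert)))
      (\<lambda>m. wp w Rebuild_loop (\<lambda>l. ?P (Suc d * (?T + 50) - 30) (m + l)))
      (s\<lparr>reg := (reg s)(22 := ?j, 14 := F ?k)\<rparr>)" (is "wp w _ _ ?s1")
  proof (rule wp_Cond)
    assume "test_val (Eq 14 3) ?s1"
    then have F0: "F ?k = 0" using r3 by simp
    have "wp w Rebuild_loop (?P (d * (?T + 50) + 1)) ?s1"
    proof (rule step)
      show "good w ?s1 t" by (rule gd) (simp_all add: r3)
      show "lookup t = (\<lambda>k. if k \<in> \<kappa> ` {1..Suc i} then F k else 0)"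
        unfolding K Suc.prems(6) using F0 by auto
    qed (use Suc.prems in \<open>auto simp: same_def\<close>)
    then show "wp w Skip (\<lambda>k. wp w Rebuild_loop (\<lambda>l. ?P (Suc d * (?T + 50) - 30) (Suc k + l))) ?s1"
      by (intro wp_Skip) (erule wp_mono, simp)
  next
    assume "\<not> test_val (Eq 14 3) ?s1"
    then have F0: "F ?k \<noteq> 0" using r3 by simp
    define s2 where "s2 = s\<lparr>treg := (treg s)(1 := snd ?k), reg := (reg s)(22 := ?j, 14 := F ?k, 13 := fst ?k)\<rparr>"
    have g2: "good w s2 t" by (rule gd) (simp_all add: s2_def r3)
    have k2: "?k = (reg s2 13, treg s2 1)" "reg s2 14 = F ?k" by (simp_all add: s2_def)
    have r2: "rng w (2 * int (nodes t) + 4)" by (rule rng_mono[OF Suc.prems(9)]) (use iN Suc.prems(5) in auto)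
    let ?t = "ins ?k (F ?k) (int (nodes t) + 1) t"
    have o: "ordered t" using g2 by (simp add: good_def)
    have U: "wp w Upsert (\<lambda>n s'. n \<le> 1000 * (1 + depth t) \<and> good w s' ?t \<and> keep s2 s' (int (nodes ?t))) s2"
      using wp_Upsert[OF g2 k2(1) r2] k2(2) by simp
    have n': "nodes ?t \<le> Suc i"
      using ins_good(5)[of t _ ?k "F ?k"] g2 Suc.prems(5) unfolding good_def by fastforce
    have dt: "depth t \<le> depth_bound N" using good_depth[OF g2] iN Suc.prems(5) by simp
    have s2': "same s s2" by (simp add: same_def s2_def)
    have UR: "wp w Upsert (\<lambda>m. wp w Rebuild_loop (\<lambda>l. ?P (Suc d * (?T + 50) - 49) (m + l))) s2"
    proof (rule wp_mono[OF U], elim conjE, goal_cases)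
      case 3: (1 m s3)
      have R: "wp w Rebuild_loop (?P (d * (?T + 50) + 1)) s3"
      proof (rule step[OF 3(2)])
        show "reg s3 22 = ?j" "reg s3 21 = int N"
          using 3(3) Suc.prems(4) by (auto simp: keep_def s2_def)
        show "lookup ?t = (\<lambda>k. if k \<in> \<kappa> ` {1..Suc i} then F k else 0)"
          unfolding K lookup_ins[OF o] Suc.prems(6) by auto
        show "set (keys ?t) \<subseteq> {k. F k \<noteq> 0}"
          unfolding set_keys_ins using Suc.prems(7) F0 by blast
        show "mem s3 (ad (int j) f) = mem s (ad (int j) f)" if "Suc i < j" "f \<in> {0..5}" for j f
          using 3(3) that n' by (auto simp: keep_def s2_def)
        show "tmem s3 (int j) = tmem s (int j)" if "Suc i < j" for j
          using 3(3) that n' by (auto simp: keep_def s2_def)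
        show "same s s3" using same_trans[OF s2' same_keep[OF 3(3)]] .
      qed (rule n')
      show ?case
      proof (rule wp_mono[OF R], elim conjE, goal_cases)
        case (1 l s4)
        have "m + l \<le> Suc d * (?T + 50) - 49" using 1(1) 3(1) dt by simp
        with 1 show ?case by blast
      qed
    qed
    show "wp w (Seq (Asg 13 (Fd (Var 22) 5)) (Seq (Instr (TLoad 1 22)) Upsert))
      (\<lambda>k. wp w Rebuild_loop (\<lambda>l. ?P (Suc d * (?T + 50) - 30) (Suc k + l))) ?s1"
      apply (rule wp_Seq, rule wp_Asg, simp, simp, simp add: rj kj)
      apply (rule wp_Seq, rule wp_TLoad, simp, simp add: kj)
      apply (rule back_subst[where P = "wp w _ _"])
       apply (rule wp_mono[OF UR])
       apply (erule wp_mono)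
       apply simp
      apply (simp add: s2_def)
      done
  qed simp
  have "wp w Rebuild_loop (?P (Suc d * (?T + 50) + 1)) s"
    unfolding Rebuild_loop_def
    apply (rule wp_While_True)
    subgoal by simp
    subgoal using Suc.prems iN by simp
    apply (rule wp_Seq, rule wp_Asg, simp, simp, simp add: Suc.prems wj)
    apply (rule wp_Seq, rule wp_Asg, simp, simp, simp add: rj kj)
    apply (fold Rebuild_loop_def[unfolded One_nat_def])
    apply (rule wp_mono[OF main[unfolded One_nat_def]])
    apply (erule wp_mono)
    apply simp
    done
  then show ?case .
qed

lemma good_keys:
  assumes "good w s t" "set (keys t) \<subseteq> {k. F k \<noteq> 0}" "finite {k. F k \<noteq> (0::int)}"
  shows "nodes t \<le> card {k. F k \<noteq> 0}"
  using nodes_card[of t] card_mono[OF assms(3,2)] assms(1) by (simp add: good_def)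

lemma wp_Rebuild:
  assumes g: "good w s t" and r: "rng w (2 * int (nodes t) + 4)"
  defines "N \<equiv> nodes t"
  shows "wp w Rebuild (\<lambda>n s'. n \<le> N * (1000 * (1 + depth_bound N) + 50) + 50 \<and>
    (\<exists>t'. good w s' t' \<and> lookup t' = lookup t \<and> nodes t' \<le> card {k. lookup t k \<noteq> 0}) \<and>
    same s s') s"
proof -
  have rp: "rep w (mem s) (tmem s) t" "reg s 3 = 0" "reg s 11 = int N" "ordered t" "nids t = {1..int N}"
    using g by (auto simp: good_def tree_at_def N_def)
  have "\<forall>i \<in> {1..N}. \<exists>k. k \<in> set (keys t) \<and> mem s (ad (int i) 4) = lookup t k \<and> mem s (ad (int i) 5) = fst k \<and>
    tmem s (int i) = snd k"
  proof
    fix i assume "i \<in> {1..N}"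
    then have "int i \<in> set (ids t)" using rp(5) unfolding nids_ids by simp
    then obtain k x where e: "(int i, k, x) \<in> set (entries t)" by auto
    from rep_entry[OF rp(1) e] lookup_entry[OF rp(4) e] e
    show "\<exists>k. k \<in> set (keys t) \<and> mem s (ad (int i) 4) = lookup t k \<and> mem s (ad (int i) 5) = fst k \<and>
      tmem s (int i) = snd k" by force
  qed
  then obtain \<kappa> where \<kappa>: "\<forall>i \<in> {1..N}. \<kappa> i \<in> set (keys t) \<and> mem s (ad (int i) 4) = lookup t (\<kappa> i) \<and>
    mem s (ad (int i) 5) = fst (\<kappa> i) \<and> tmem s (int i) = snd (\<kappa> i)"
    by (rule bchoice[THEN exE]) blast
  \<comment> \<open>Every stored key belongs to a node with a number in \<open>1..N\<close>, and a
    key that is not stored has value 0.\<close>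
  have all: "lookup t k = 0" if "k \<notin> \<kappa> ` {1..N}" for k
  proof (cases "k \<in> set (keys t)")
    case True
    then obtain i x where e: "(i, k, x) \<in> set (entries t)" by auto
    then have "i \<in> nids t" unfolding nids_ids by force
    then have "nat i \<in> {1..N}" "int (nat i) = i" using rp(5) by auto
    with \<kappa> rep_entry[OF rp(1) e] have "\<kappa> (nat i) = k" by (metis prod.collapse)
    with \<open>nat i \<in> {1..N}\<close> that show ?thesis by blast
  qed (rule lookup_notin)
  define s1 where "s1 = s\<lparr>reg := (reg s)(21 := int N, 22 := 0, 11 := 0), mem := (mem s)(ad 0 6 := 0)\<rparr>"
  have r0: "rng w 0" by (rule rng_mono[OF r]) auto
  \<comment> \<open>The sentinel of the old tree serves the new one.\<close>
  have z: "\<forall>f \<in> {0..3}. mem s (ad 0 f) = 0"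
    using rp(1) by (induction t) auto
  have g1: "good w s1 Lf"
    using r0 z rp(2) by (auto simp: good_def tree_at_def s1_def ordered_def intro: aa_Lf)
  have "wp w Rebuild_loop (\<lambda>n s'. n \<le> N * (1000 * (1 + depth_bound N) + 50) + 1 \<and>
    (\<exists>t'. good w s' t' \<and> lookup t' = (\<lambda>k. if k \<in> \<kappa> ` {1..N} then lookup t k else 0) \<and>
      set (keys t') \<subseteq> {k. lookup t k \<noteq> 0}) \<and> same s1 s') s1"
    by (rule wp_Rebuild_loop[OF g1, of 0]) (use \<kappa> r in \<open>auto simp: s1_def N_def\<close>)
  moreover have "(\<lambda>k. if k \<in> \<kappa> ` {1..N} then lookup t k else 0) = lookup t"
    using all by auto
  ultimately have L: "wp w Rebuild_loop (\<lambda>n s'. n \<le> N * (1000 * (1 + depth_bound N) + 50) + 1 \<and>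
    (\<exists>t'. good w s' t' \<and> lookup t' = lookup t \<and> set (keys t') \<subseteq> {k. lookup t k \<noteq> 0}) \<and> same s1 s') s1"
    by simp
  have "{k. lookup t k \<noteq> 0} \<subseteq> set (keys t)" using lookup_notin by blast
  then have fin: "finite {k. lookup t k \<noteq> 0}" using finite_subset by blast
  have same1: "same s s1"
    by (auto simp: same_def s1_def ad_def)
  show ?thesis unfolding Rebuild_def
    apply (rule wp_Seq, rule wp_Asg, simp, simp, simp add: rp)
    apply (rule wp_Seq, rule wp_Asg, simp, simp, simp)
    apply (rule wp_Seq, rule wp_Asg, simp, simp, simp)
    apply (rule wp_Seq, rule wp_Sto, simp, simp, simp add: r0)
    apply (rule back_subst[where P = "wp w _ _"])
     apply (rule wp_mono[OF L])
     apply (elim conjE exE)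
     apply (intro conjI exI)
         apply simp
        apply assumption+
      apply (rule good_keys; assumption?)
      apply (rule fin)
     apply (rule same_trans[OF same1], assumption)
    apply (simp add: s1_def)
    done
qed

section \<open>Timelines and degrees\<close>

fun edge :: "upd \<Rightarrow> nat set" where
  "edge (Insert u v x) = {u, v}"
| "edge (Delete u v) = {u, v}"

fun result :: "upd \<Rightarrow> int option" where
  "result (Insert u v x) = Some x"
| "result (Delete u v) = None"

lemma apply_upd_eq: "apply_upd a G = G(edge a := result a)"
  by (cases a) auto

lemma replay_empty [simp]: "replay S {} = Map.empty"
  by (simp add: replay_def)

lemma replay_insert:
  assumes "finite A" "\<forall>a \<in> A. a < b"
  shows "replay S (insert b A) = (replay S A)(edge (the (S b)) := result (the (S b)))"
proof -
  have "sorted_list_of_set (insert b A) = sorted_list_of_set A @ [b]"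
  proof (rule sorted_distinct_set_unique)
    show "set (sorted_list_of_set (insert b A)) = set (sorted_list_of_set A @ [b])"
      using assms(1) set_sorted_list_of_set[of "insert b A"] by (simp del: sorted_list_of_set_insert_remove)
  qed (use assms in \<open>auto simp: sorted_append intro: less_imp_le simp del: sorted_list_of_set_insert_remove\<close>)
  then show ?thesis by (simp add: replay_def apply_upd_eq)
qed

text \<open>An update overwrites the state of its edge, so the last one decides.\<close>

lemma replay_Max:
  fixes S :: timeline
  assumes "finite A"
  defines "X \<equiv> \<lambda>A. \<lambda>e. {t \<in> A. edge (the (S t)) = e}"
  shows "replay S A e = (if X A e = {} then None else result (the (S (Max (X A e)))))"
  using assms(1)
proof (induction rule: finite_linorder_max_induct)
  case empty
  then show ?case by (simp add: X_def)
next
  case (insert b A)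
  show ?case
  proof (cases "edge (the (S b)) = e")
    case True
    then have "X (insert b A) e = insert b (X A e)" by (auto simp: X_def)
    moreover have "Max (insert b (X A e)) = b"
      using insert by (intro Max_eqI) (auto simp: X_def intro: less_imp_le)
    ultimately show ?thesis using insert True by (simp add: replay_insert)
  next
    case False
    then have "X (insert b A) e = X A e" by (auto simp: X_def)
    then show ?thesis using insert False by (auto simp: replay_insert)
  qed
qed

text \<open>Only the updates of the edge \<open>e\<close> have to agree. This isolates the effect of
  a new or removed update on its own edge.\<close>

lemma replay_cong:
  assumes "finite A" "finite B"
    "{t \<in> A. edge (the (S t)) = e} = {t \<in> B. edge (the (S' t)) = e}"
    "\<And>t. t \<in> A \<Longrightarrow> edge (the (S t)) = e \<Longrightarrow> S' t = S t"
  shows "replay S A e = replay S' B e"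
proof -
  let ?X = "{t \<in> A. edge (the (S t)) = e}"
  have *: "S' (Max ?X) = S (Max ?X)" if "?X \<noteq> {}"
    using Max_in[of ?X] that assms(1,4) by auto
  show ?thesis unfolding replay_Max[OF assms(1)] replay_Max[OF assms(2)] assms(3)[symmetric]
    by (rule if_cong[OF refl refl], drule *, simp only:)
qed

lemma replay_SomeD:
  assumes "finite A" "replay S A e = Some x"
  shows "\<exists>t \<in> A. edge (the (S t)) = e \<and> result (the (S t)) = Some x"
proof -
  let ?X = "{t \<in> A. edge (the (S t)) = e}"
  have "?X \<noteq> {} \<and> result (the (S (Max ?X))) = Some x"
    using assms(2) unfolding replay_Max[OF assms(1)] by (auto split: if_splits)
  then show ?thesis using Max_in[of ?X] assms(1) by auto
qed

text \<open>In other words, a legal update toggles the presence of its edge.\<close>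

lemma legal_upd_result: "legal_upd n B G a \<Longrightarrow> edge a \<in> dom G \<longleftrightarrow> result a = None"
  by (cases a) auto

lemma legal_timelineD:
  "legal_timeline n B S \<Longrightarrow> S t = Some a \<Longrightarrow> legal_upd n B (graph_before S t) a"
  unfolding legal_timeline_def by (metis domI option.sel)

lemma legal_edge:
  assumes "legal_timeline n B S" "finite (dom S)" "A \<subseteq> dom S" "replay S A e = Some x"
  shows "\<exists>u v. e = {u, v} \<and> u < n \<and> v < n \<and> u \<noteq> v" "\<bar>x\<bar> \<le> int B"
proof -
  obtain t where t: "t \<in> A" "edge (the (S t)) = e" "result (the (S t)) = Some x"
    using replay_SomeD[OF finite_subset[OF assms(3,2)] assms(4)] by blast
  obtain a where a: "S t = Some a" using t(1) assms(3) by auto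
  from legal_timelineD[OF assms(1) a] t a
  show "\<exists>u v. e = {u, v} \<and> u < n \<and> v < n \<and> u \<noteq> v" "\<bar>x\<bar> \<le> int B" by (cases a; auto)+
qed

text \<open>Before and after the insertion of an update, the updates of its edge alternate between
  insertions and deletions, so it has no place between two of them.\<close>

lemma created_last:
  assumes fin: "finite (dom S)" and t: "t \<notin> dom S"
    and legal: "legal_timeline n B S" "legal_timeline n B (S(t \<mapsto> a))"
    and s: "S s = Some b" "edge b = edge a"
  shows "s < t"
proof (rule ccontr)
  assume "\<not> s < t"
  let ?e = "edge a" and ?S = "S(t \<mapsto> a)"
  let ?L = "{s \<in> dom S. t < s \<and> edge (the (S s)) = ?e}"
  have "s \<noteq> t" using s t by auto
  with \<open>\<not> s < t\<close> s have "s \<in> ?L" by auto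
  then have "?L \<noteq> {}" by blast
  define m where "m = Min ?L"
  have "m \<in> ?L" unfolding m_def by (rule Min_in) (use fin \<open>?L \<noteq> {}\<close> in auto)
  then obtain c where c: "S m = Some c" "t < m" "edge c = ?e" by auto
  have least: "r < t" if "r < m" "r \<in> dom S" "edge (the (S r)) = ?e" for r
  proof (rule ccontr)
    assume "\<not> r < t"
    moreover have "r \<noteq> t" using that t by auto
    ultimately have "r \<in> ?L" using that by auto
    then have "m \<le> r" unfolding m_def using fin by (intro Min_le) auto
    with that show False by simp
  qed
  \<comment> \<open>No update of the edge lies strictly between \<open>t\<close> and
    \<open>m\<close>. So before \<open>m\<close> the edge is in its state before \<open>t\<close>
    under \<open>S\<close>, but in the state \<open>result a\<close> under the new timeline. As
    \<open>a\<close> toggles the presence of the edge, \<open>c\<close> cannot be legal in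
    both.\<close>
  have "graph_before S m ?e = graph_before ?S t ?e"
    unfolding graph_before_def
    by (rule replay_cong) (use fin least c(2) t in \<open>auto simp: domI\<close>)
  moreover have "graph_before ?S m ?e = result a"
  proof -
    have "{r \<in> {r \<in> dom ?S. r < m}. edge (the (?S r)) = ?e} = insert t {r \<in> dom S. r < t \<and> edge (the (S r)) = ?e}"
      using least c(2) t by auto
    moreover have "Max (insert t {r \<in> dom S. r < t \<and> edge (the (S r)) = ?e}) = t"
      by (rule Max_eqI) (use fin in auto)
    ultimately show ?thesis using fin unfolding graph_before_def by (subst replay_Max) simp_all
  qed
  moreover have "?e \<in> dom (graph_before S m) \<longleftrightarrow> result c = None"
    "?e \<in> dom (graph_before ?S m) \<longleftrightarrow> result c = None"
    "?e \<in> dom (graph_before ?S t) \<longleftrightarrow> result a = None"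
    using legal_upd_result[OF legal_timelineD[OF legal(1) c(1)]]
      legal_upd_result[OF legal_timelineD[OF legal(2), of m c]]
      legal_upd_result[OF legal_timelineD[OF legal(2), of t a]] c by auto
  ultimately show False by (auto simp: domIff)
qed

section \<open>Degrees as sums of changes\<close>

definition change :: "timeline \<Rightarrow> real \<Rightarrow> int" where
  "change S t = (case result (the (S t)) of Some x \<Rightarrow> x
     | None \<Rightarrow> - the (graph_before S t (edge (the (S t)))))"

lemma finite_dom_replay: "finite A \<Longrightarrow> finite (dom (replay S A))"
proof (induction rule: finite_linorder_max_induct)
  case (insert b A)
  have "dom (replay S (insert b A)) \<subseteq> insert (edge (the (S b))) (dom (replay S A))"
    unfolding replay_insert[OF insert(1,2)] by (auto split: if_splits)
  then show ?case using insert finite_subset by blast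
qed simp

lemma weighted_degree_insert:
  assumes "finite (dom G)" "e \<notin> dom G"
  shows "weighted_degree (G(e \<mapsto> x)) v = weighted_degree G v + (if v \<in> e then x else 0)"
proof -
  let ?E = "{e \<in> dom G. v \<in> e}"
  have "{e' \<in> dom (G(e \<mapsto> x)). v \<in> e'} = (if v \<in> e then insert e ?E else ?E)" by auto
  moreover have "(\<Sum>e' \<in> ?E. the ((G(e \<mapsto> x)) e')) = (\<Sum>e' \<in> ?E. the (G e'))"
    using assms(2) by (intro sum.cong) auto
  ultimately show ?thesis using assms by (simp add: weighted_degree_def)
qed

lemma weighted_degree_delete:
  assumes "finite (dom G)" "e \<in> dom G"
  shows "weighted_degree (G(e := None)) v = weighted_degree G v - (if v \<in> e then the (G e) else 0)"
proof -
  have "G = (G(e := None))(e \<mapsto> the (G e))" using assms(2) by auto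
  then show ?thesis
    using weighted_degree_insert[of "G(e := None)" e "the (G e)" v] assms by simp
qed

text \<open>\<open>A\<close> is downward closed, so the graph before its last update is the replay
  of the rest, and this is the graph that legality and \<open>change\<close> refer to.\<close>

lemma weighted_degree_replay:
  assumes fin: "finite (dom S)" and legal: "legal_timeline n B S"
    and A: "finite A" "A \<subseteq> dom S" "\<And>s t. t \<in> A \<Longrightarrow> s \<in> dom S \<Longrightarrow> s < t \<Longrightarrow> s \<in> A"
  shows "weighted_degree (replay S A) v = (\<Sum>t \<in> A. if v \<in> edge (the (S t)) then change S t else 0)"
  using A
proof (induction rule: finite_linorder_max_induct)
  case empty
  then show ?case by (simp add: weighted_degree_def)
next
  case (insert b A)
  obtain a where a: "S b = Some a" using insert.prems by auto
  have "A = {t \<in> dom S. t < b}"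
  proof (intro set_eqI iffI)
    fix x assume "x \<in> {t \<in> dom S. t < b}"
    then have x: "x \<in> dom S" "x < b" by auto
    from insert.prems(2)[OF _ this] have "x \<in> insert b A" by simp
    with x(2) show "x \<in> A" by simp
  qed (use insert.prems(1) insert.hyps(2) in blast)
  then have G: "replay S A = graph_before S b" by (simp add: graph_before_def)
  have l: "legal_upd n B (graph_before S b) a" by (rule legal_timelineD[OF legal a])
  have f: "finite (dom (graph_before S b))"
    unfolding graph_before_def by (rule finite_dom_replay) (use fin in auto)
  have "weighted_degree (replay S (insert b A)) v =
      weighted_degree (graph_before S b) v + (if v \<in> edge a then change S b else 0)"
    unfolding replay_insert[OF insert.hyps(1,2)] G using l f
    by (cases a) (auto simp: a change_def weighted_degree_insert weighted_degree_delete)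
  moreover have "weighted_degree (replay S A) v = (\<Sum>t \<in> A. if v \<in> edge (the (S t)) then change S t else 0)"
  proof (rule insert.IH)
    show "s \<in> A" if "t \<in> A" "s \<in> dom S" "s < t" for s t
    proof -
      have "s \<in> insert b A" by (rule insert.prems(2)[of t s]) (use that in auto)
      moreover have "s < b" using that insert.hyps(2) by force
      ultimately show ?thesis by simp
    qed
  qed (use insert.prems in auto)
  ultimately show ?case using insert.hyps G a by auto
qed

lemma weighted_degree_graph_at:
  assumes "finite (dom S)" "legal_timeline n B S"
  shows "weighted_degree (graph_at S t) v =
    (\<Sum>s \<in> {s \<in> dom S. s \<le> t}. if v \<in> edge (the (S s)) then change S s else 0)"
  unfolding graph_at_def by (rule weighted_degree_replay[OF assms]) (use assms in auto)

text \<open>A change depends on the earlier updates of its own edge only, and by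
  \<open>created_last\<close> the new update comes after all those of its edge.\<close>

lemma change_created:
  assumes fin: "finite (dom S)" and t: "t \<notin> dom S"
    and legal: "legal_timeline n B S" "legal_timeline n B (S(t \<mapsto> a))"
    and s: "s \<in> dom S"
  shows "change (S(t \<mapsto> a)) s = change S s"
proof -
  obtain b where b: "S s = Some b" using s by auto
  have st: "s \<noteq> t" using s t by auto
  have "graph_before (S(t \<mapsto> a)) s (edge b) = graph_before S s (edge b)"
    unfolding graph_before_def
  proof (rule replay_cong)
    have "s < t" if "edge a = edge b" using created_last[OF fin t legal b] that by simp
    then show "{r \<in> {r \<in> dom (S(t \<mapsto> a)). r < s}. edge (the ((S(t \<mapsto> a)) r)) = edge b} =
      {r \<in> {r \<in> dom S. r < s}. edge (the (S r)) = edge b}" using t by auto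
    show "S r = (S(t \<mapsto> a)) r" if "r \<in> {r \<in> dom (S(t \<mapsto> a)). r < s}" "edge (the ((S(t \<mapsto> a)) r)) = edge b" for r
    proof -
      have "r \<noteq> t" using that \<open>edge a = edge b \<Longrightarrow> s < t\<close> by (metis (no_types, lifting) fun_upd_same less_asym mem_Collect_eq option.sel)
      then show ?thesis by simp
    qed
  qed (use fin in auto)
  then show ?thesis using b st by (cases "result b") (simp_all add: change_def)
qed

text \<open>As no update of the edge follows \<open>t\<close>, its state just before
  \<open>t\<close> is its present one, wherever \<open>t\<close> lies among the times of other
  edges.\<close>

lemma replay_created:
  assumes fin: "finite (dom S)" and t: "t \<notin> dom S"
    and legal: "legal_timeline n B S" "legal_timeline n B (S(t \<mapsto> a))"
  shows "replay (S(t \<mapsto> a)) (dom (S(t \<mapsto> a))) = (replay S (dom S))(edge a := result a)"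
    "graph_before (S(t \<mapsto> a)) t (edge a) = replay S (dom S) (edge a)"
proof -
  let ?S = "S(t \<mapsto> a)"
  have last: "s < t" if "s \<in> dom S" "edge (the (S s)) = edge a" for s
    using created_last[OF fin t legal, of s "the (S s)"] that by auto
  show "graph_before ?S t (edge a) = replay S (dom S) (edge a)"
    unfolding graph_before_def by (rule replay_cong) (use fin last t in \<open>auto simp: domI\<close>)
  show "replay ?S (dom ?S) = (replay S (dom S))(edge a := result a)"
  proof
    fix e
    show "replay ?S (dom ?S) e = ((replay S (dom S))(edge a := result a)) e"
    proof (cases "e = edge a")
      case True
      have "Max {s \<in> dom ?S. edge (the (?S s)) = edge a} = t"
        by (rule Max_eqI) (use fin last in \<open>auto intro: less_imp_le split: if_splits\<close>)
      then show ?thesis using fin True by (subst replay_Max) (auto)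
    next
      case False
      have "replay ?S (dom ?S) e = replay S (dom S) e"
        by (rule replay_cong) (use fin t False in \<open>auto split: if_splits\<close>)
      then show ?thesis using False by simp
    qed
  qed
qed

section \<open>The entries kept by the data structure\<close>

fun ends :: "upd \<Rightarrow> nat \<times> nat" where
  "ends (Insert u v x) = (u, v)"
| "ends (Delete u v) = (u, v)"

lemma edge_ends: "edge a = {fst (ends a), snd (ends a)}"
  by (cases a) auto

lemma legal_ends:
  assumes "legal_timeline n B S" "finite (dom S)" "S t = Some a"
  shows "fst (ends a) < n" "snd (ends a) < n" "fst (ends a) \<noteq> snd (ends a)"
proof -
  note l = legal_timelineD[OF assms(1,3)]
  have "fst (ends a) < n \<and> snd (ends a) < n \<and> fst (ends a) \<noteq> snd (ends a)"
  proof (cases a)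
    case (Insert u v x)
    then show ?thesis using l by simp
  next
    case (Delete u v)
    then obtain x where "replay S {t' \<in> dom S. t' < t} {u, v} = Some x"
      using l by (auto simp: graph_before_def)
    from legal_edge(1)[OF assms(1,2) _ this] show ?thesis
      using Delete by (auto simp: doubleton_eq_iff)
  qed
  then show "fst (ends a) < n" "snd (ends a) < n" "fst (ends a) \<noteq> snd (ends a)" by auto
qed

lemma change_bound:
  assumes "legal_timeline n B S" "finite (dom S)" "t \<in> dom S"
  shows "\<bar>change S t\<bar> \<le> int B"
proof -
  obtain a where a: "S t = Some a" using assms(3) by auto
  note l = legal_timelineD[OF assms(1) a]
  show ?thesis
  proof (cases a)
    case (Insert u v x)
    then show ?thesis using l a by (simp add: change_def)
  next
    case (Delete u v)
    then obtain x where x: "replay S {t' \<in> dom S. t' < t} {u, v} = Some x"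
      using l by (auto simp: graph_before_def)
    from legal_edge(2)[OF assms(1,2) _ this] x show ?thesis
      using Delete a by (simp add: change_def graph_before_def)
  qed
qed

text \<open>The map kept by the data structure: the key \<open>(v, t)\<close> holds the change of the degree of the
  vertex \<open>v\<close> at time \<open>t\<close>, and the key \<open>(n, t)\<close> the two ends of the edge updated at time \<open>t\<close>, with
  a negative sign for a deletion.\<close>

fun code :: "nat \<Rightarrow> upd \<Rightarrow> int" where
  "code n (Insert u v x) = int u * int n + int v"
| "code n (Delete u v) = - (int u * int n + int v)"

definition entry :: "nat \<Rightarrow> timeline \<Rightarrow> int \<times> real \<Rightarrow> int" where
  "entry n S = (\<lambda>(x, t). case S t of None \<Rightarrow> 0
     | Some a \<Rightarrow> if x = int n then code n a else if x \<in> int ` edge a then change S t else 0)"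

lemma entry_created:
  assumes "finite (dom S)" "t \<notin> dom S" "legal_timeline n B S" "legal_timeline n B (S(t \<mapsto> a))"
  defines "\<delta> \<equiv> change (S(t \<mapsto> a)) t"
  shows "entry n (S(t \<mapsto> a)) = (entry n S)((int (fst (ends a)), t) := \<delta>, (int (snd (ends a)), t) := \<delta>,
    (int n, t) := code n a)"
proof
  fix k :: "int \<times> real"
  obtain x s where k: "k = (x, s)" by (cases k)
  have "fst (ends a) < n" "snd (ends a) < n"
    using legal_ends[OF assms(4), of t a] assms(1) by simp_all
  moreover have "change (S(t \<mapsto> a)) s = change S s" if "s \<in> dom S"
    by (rule change_created[OF assms(1-4) that])
  ultimately show "entry n (S(t \<mapsto> a)) k = ((entry n S)((int (fst (ends a)), t) := \<delta>,
      (int (snd (ends a)), t) := \<delta>, (int n, t) := code n a)) k"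
    using assms(2) unfolding k by (auto simp: entry_def \<delta>_def edge_ends split: option.split)
qed

text \<open>Cancellation undoes creation: \<open>entry_created\<close> is applied to the timeline
  without \<open>t\<close>, where all entries at time \<open>t\<close> are 0.\<close>

lemma entry_cancelled:
  assumes "finite (dom S)" "S t = Some a" "legal_timeline n B S" "legal_timeline n B (S(t := None))"
  shows "entry n (S(t := None)) = (entry n S)((int (fst (ends a)), t) := 0, (int (snd (ends a)), t) := 0,
    (int n, t) := 0)"
proof -
  let ?S = "S(t := None)"
  have S: "?S(t \<mapsto> a) = S" using assms(2) by auto
  have "entry n ?S (x, t) = 0" for x by (simp add: entry_def)
  then show ?thesis
    using entry_created[of ?S t n B a] assms(1,3,4) unfolding S by (auto simp: fun_eq_iff)
qed

lemma entry_support: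
  assumes "finite (dom S)"
  shows "finite {k. entry n S k \<noteq> 0}" "card {k. entry n S k \<noteq> 0} \<le> 3 * card (dom S)"
proof -
  let ?f = "\<lambda>t. {(int (fst (ends (the (S t)))), t), (int (snd (ends (the (S t)))), t), (int n, t)}"
  have sub: "{k. entry n S k \<noteq> 0} \<subseteq> (\<Union>t \<in> dom S. ?f t)"
  proof
    fix k assume k: "k \<in> {k. entry n S k \<noteq> 0}"
    obtain x s where xs: "k = (x, s)" by (cases k)
    with k obtain a where a: "S s = Some a" by (cases "S s") (auto simp: entry_def)
    have "k \<in> ?f s" using k a by (auto simp: xs entry_def edge_ends split: if_splits)
    moreover have "s \<in> dom S" using a by auto
    ultimately show "k \<in> (\<Union>t \<in> dom S. ?f t)" by (rule UN_I[rotated])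
  qed
  have fin: "finite (\<Union>t \<in> dom S. ?f t)" using assms by auto
  show "finite {k. entry n S k \<noteq> 0}" by (rule finite_subset[OF sub fin])
  have "card {k. entry n S k \<noteq> 0} \<le> card (\<Union>t \<in> dom S. ?f t)" by (rule card_mono[OF fin sub])
  also have "\<dots> \<le> (\<Sum>t \<in> dom S. card (?f t))" by (rule card_UN_le[OF assms])
  also have "\<dots> \<le> (\<Sum>t \<in> dom S. 3)" by (intro sum_mono) (simp add: card_insert_if)
  finally show "card {k. entry n S k \<noteq> 0} \<le> 3 * card (dom S)" by simp
qed

text \<open>Lexicographically, the keys between the two bounds are those of vertex \<open>v\<close>
  up to time \<open>t\<close>, where \<open>M\<close> acts as an infinite time. Keys of cancelled
  updates may lie beyond \<open>M\<close>, but their entries are 0.\<close>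

lemma degree_from_prefixes:
  assumes fin: "finite (dom S)" and legal: "legal_timeline n B S"
    and K: "finite K" "{k. entry n S k \<noteq> 0} \<subseteq> K"
    and M: "\<forall>s \<in> dom S. s \<le> M" and v: "v < n"
  shows "(\<Sum>k \<in> {k \<in> K. k \<le> (int v, t)}. entry n S k) - (\<Sum>k \<in> {k \<in> K. k \<le> (int v - 1, M)}. entry n S k) =
    weighted_degree (graph_at S t) v"
proof -
  let ?A = "{k \<in> K. k \<le> (int v, t)}" and ?B = "{k \<in> K. k \<le> (int v - 1, M)}" and ?f = "entry n S"
  let ?T = "{s \<in> dom S. s \<le> t}" let ?C = "Pair (int v) ` ?T"
  have "?B \<subseteq> ?A" by (auto simp: less_eq_prod_def)
  then have "sum ?f ?A - sum ?f ?B = sum ?f (?A - ?B)" using K(1) by (subst sum_diff) auto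
  also have "\<dots> = sum ?f ?C"
  proof (rule sum.mono_neutral_cong)
    show "?f k = 0" if "k \<in> ?C - (?A - ?B)" for k
      using that K(2) by (auto simp: less_eq_prod_def)
    show "?f k = 0" if "k \<in> ?A - ?B - ?C" for k
    proof -
      obtain x s where k: "k = (x, s)" by (cases k)
      have "s \<notin> dom S"
      proof
        assume s: "s \<in> dom S"
        with M have "s \<le> M" by blast
        with that k s show False by (auto simp: less_eq_prod_def)
      qed
      then show ?thesis by (simp add: k entry_def domIff)
    qed
  qed (use K(1) fin in auto)
  also have "\<dots> = (\<Sum>s \<in> ?T. ?f (int v, s))" by (subst sum.reindex) (auto simp: inj_on_def)
  also have "\<dots> = (\<Sum>s \<in> ?T. if v \<in> edge (the (S s)) then change S s else 0)"
    using v by (intro sum.cong) (auto simp: entry_def)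
  also have "\<dots> = weighted_degree (graph_at S t) v"
    by (rule weighted_degree_graph_at[OF fin legal, symmetric])
  finally show ?thesis .
qed

lemma weighted_degree_bound:
  assumes "finite (dom S)" "legal_timeline n B S"
  shows "\<bar>weighted_degree (graph_at S t) v\<bar> \<le> int (card (dom S) * B)"
proof -
  let ?T = "{s \<in> dom S. s \<le> t}"
  have "\<bar>weighted_degree (graph_at S t) v\<bar> \<le> (\<Sum>s \<in> ?T. \<bar>if v \<in> edge (the (S s)) then change S s else 0\<bar>)"
    unfolding weighted_degree_graph_at[OF assms] by (rule sum_abs)
  also have "\<dots> \<le> (\<Sum>s \<in> ?T. int B)"
    using change_bound[OF assms(2,1)] by (intro sum_mono) auto
  also have "\<dots> \<le> int (card (dom S) * B)"
    using card_mono[OF assms(1), of ?T] by (auto intro!: mult_right_mono)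
  finally show ?thesis .
qed

section \<open>The data structure\<close>

lemma depth_bound_mono: "M \<le> N \<Longrightarrow> depth_bound M \<le> depth_bound N"
  unfolding depth_bound_def by (intro mult_left_mono nat_mono floor_mono) auto

section \<open>Writing the entries of an update\<close>

definition Set_entry :: "nat \<Rightarrow> nat \<Rightarrow> prog" where
  "Set_entry x y = Seq (Asg 13 (Var x)) (Seq (Asg 14 (Var y)) Upsert)"

lemma wp_Set_entry:
  assumes g: "good w s t" and N: "nodes t \<le> N" "rng w (2 * int N + 4)"
    and x: "x \<le> 12" "x \<noteq> 11" "y \<le> 12" "y \<noteq> 11"
  shows "wp w (Set_entry x y) (\<lambda>n s'. n \<le> 1010 * (1 + depth_bound N) \<and>
    (\<exists>t'. good w s' t' \<and> lookup t' = (lookup t)((reg s x, treg s 1) := reg s y) \<and> nodes t' \<le> nodes t + 1) \<and>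
    same s s' \<and> treg s' 1 = treg s 1) s"
proof -
  define s1 where "s1 = s\<lparr>reg := (reg s)(13 := reg s x, 14 := reg s y)\<rparr>"
  have g1: "good w s1 t" using g by (simp add: good_def tree_at_def s1_def)
  have k: "(reg s x, treg s 1) = (reg s1 13, treg s1 1)" by (simp add: s1_def)
  have r: "rng w (2 * int (nodes t) + 4)" by (rule rng_mono[OF N(2)]) (use N(1) in auto)
  let ?t = "ins (reg s x, treg s 1) (reg s1 14) (int (nodes t) + 1) t"
  have t: "ordered t" "\<exists>m. aa m t" "disj t" "nids t = {1..int (nodes t)}" using g by (auto simp: good_def)
  have l: "lookup ?t = (lookup t)((reg s x, treg s 1) := reg s y)"
    unfolding lookup_ins[OF t(1)] by (simp add: s1_def)
  have n: "nodes ?t \<le> nodes t + 1"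
    using t(2) ins_good(5)[OF t(1) _ t(3,4), of _ "(reg s x, treg s 1)" "reg s1 14"] by auto
  have d: "depth t \<le> depth_bound N" by (rule good_depth[OF g N(1)])
  have s1: "same s s1" "treg s1 1 = treg s 1" by (auto simp: same_def s1_def)
  have U: "wp w Upsert (\<lambda>n s'. n \<le> 1000 * (1 + depth_bound N) \<and>
    (\<exists>t'. good w s' t' \<and> lookup t' = (lookup t)((reg s x, treg s 1) := reg s y) \<and> nodes t' \<le> nodes t + 1) \<and>
    same s s' \<and> treg s' 1 = treg s 1) s1"
  proof (rule wp_mono[OF wp_Upsert[OF g1 k r]], elim conjE, goal_cases)
    case (1 n' s')
    then have "same s s'" "treg s' 1 = treg s 1"
      using same_trans[OF s1(1) same_keep] s1(2) by (auto simp: keep_def)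
    moreover have "n' \<le> 1000 * (1 + depth_bound N)" using 1(1) d by simp
    ultimately show ?case using 1(2) l n by blast
  qed
  show ?thesis unfolding Set_entry_def
    apply (rule wp_Seq, rule wp_Asg)
    subgoal using x by simp
    subgoal using x by simp
    apply (rule wp_Seq, rule wp_Asg)
    subgoal by simp
    subgoal using x by simp
    apply (rule back_subst[where P = "wp w _ _"])
     apply (rule wp_mono[OF U], simp)
    using x by (simp add: s1_def)
qed

text \<open>Shared by creation and cancellation: register 4 holds the entry for both ends, register
  5 the code of the edge, register 6 the increment of \<open>T\<close>. For a cancellation these are
  0, 0 and -1.\<close>

definition Update :: prog where
  "Update = Seq (Instr (TMove 1 0)) (Seq (Set_entry 0 4) (Seq (Set_entry 1 4) (Seq (Set_entry 10 5)
    (Seq (Asg 12 (Bin Add (Var 12) (Var 6))) (Seq (Asg 21 (Bin Mul (Num 6) (Var 12)))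
      (Cond (Less 21 11) Rebuild Skip))))))"

lemma wp_Update:
  assumes g: "good w s t" and r: "rng w (2 * int (nodes t + 3) + 4)"
    and T: "int T = reg s 12 + reg s 6" "rng w (int T)"
  defines "N \<equiv> nodes t + 3"
  defines "f \<equiv> (lookup t)((reg s 0, treg s 0) := reg s 4, (reg s 1, treg s 0) := reg s 4,
    (reg s 10, treg s 0) := reg s 5)"
  shows "wp w Update (\<lambda>n s'. (\<exists>t'. good w s' t' \<and> lookup t' = f \<and>
      (nodes t' \<le> N \<and> nodes t' \<le> 6 * T \<and> n \<le> 3200 * (1 + depth_bound N) \<or>
       6 * T < N \<and> nodes t' \<le> card {k. f k \<noteq> 0} \<and> n \<le> 3200 * (1 + depth_bound N) * (N + 1))) \<and>
    reg s' 12 = int T \<and> reg s' 10 = reg s 10 \<and> treg s' 3 = treg s 3 \<and> (\<forall>a<0. mem s' a = mem s a)) s"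
    (is "wp w _ ?Q s")
proof -
  let ?D = "1010 * (1 + depth_bound N)" and ?\<tau> = "treg s 0"
  define s0 where "s0 = s\<lparr>treg := (treg s)(1 := ?\<tau>)\<rparr>"
  have rN: "rng w (2 * int N + 4)" using r by (simp add: N_def)
  have g0: "good w s0 t" using g by (simp add: good_def tree_at_def s0_def)
  have T': "wrap w (reg s 12 + reg s 6) = int T" "wrap w (6 * int T) = 6 * int T" "wrap w 6 = 6"
    using T rng_wrap[OF T(2), of "int T"] rng_wrap[OF T(2), of "6 * int T"] rng_wrap[OF T(2), of 6] by simp_all
  have fin: "wp w (Cond (Less 21 11) Rebuild Skip) (\<lambda>n. ?Q (n + m)) s4"
    if "good w s4 t3" "lookup t3 = f" "nodes t3 \<le> N" "reg s4 12 = int T" "reg s4 21 = 6 * int T"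
      "reg s4 10 = reg s 10" "treg s4 3 = treg s 3" "\<forall>a<0. mem s4 a = mem s a" "m \<le> 3 * ?D + 20" for s4 t3 m
  proof (rule wp_Cond)
    have r11: "reg s4 11 = int (nodes t3)" using that(1) by (simp add: good_def)
    { assume "test_val (Less 21 11) s4"
      then have big: "6 * T < nodes t3" using that(5) r11 by simp
      have r3: "rng w (2 * int (nodes t3) + 4)" by (rule rng_mono[OF rN]) (use that(3) in auto)
      show "wp w Rebuild (\<lambda>n. ?Q (Suc n + m)) s4"
      proof (rule wp_mono[OF wp_Rebuild[OF that(1) r3]], elim conjE exE, goal_cases)
        case (1 n s' t')
        have "n \<le> N * (1050 * (1 + depth_bound N)) + 50"
        proof -
          have "nodes t3 * (1000 * (1 + depth_bound (nodes t3)) + 50) \<le> N * (1050 * (1 + depth_bound N))"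
            using depth_bound_mono[OF that(3)] by (intro mult_mono that(3)) auto
          with 1(1) show ?thesis by simp
        qed
        moreover have "N * (1050 * (1 + depth_bound N)) \<le> 3200 * (1 + depth_bound N) * N" by simp
        ultimately have "Suc n + m \<le> 3200 * (1 + depth_bound N) * (N + 1)"
          using that(9) by (simp add: algebra_simps)
        moreover have "6 * T < N" using big that(3) by simp
        ultimately show ?case using 1 that by (auto simp: same_def)
      qed }
    { assume "\<not> test_val (Less 21 11) s4"
      then have "nodes t3 \<le> 6 * T" using that(5) r11 by simp
      then show "wp w Skip (\<lambda>n. ?Q (Suc n + m)) s4"
        by (intro wp_Skip) (use that in auto) }
  qed simp
  have S1: "wp w (Set_entry 0 4) (\<lambda>n s'. n \<le> ?D \<and> (\<exists>t'. good w s' t' \<and>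
      lookup t' = (lookup t)((reg s0 0, treg s0 1) := reg s0 4) \<and> nodes t' \<le> nodes t + 1) \<and>
    same s0 s' \<and> treg s' 1 = treg s0 1) s0"
    by (rule wp_Set_entry[OF g0 _ rN]) (simp_all add: N_def)
  show ?thesis unfolding Update_def
  proof (rule wp_Seq, rule wp_TMove, fold s0_def, rule wp_SeqI[OF S1], elim conjE exE, goal_cases)
    case 1: (1 n1 s1 t1)
    have r1: "reg s1 r = reg s r" if "r \<le> 12" "r \<noteq> 11" for r using 1(2) that by (simp add: same_def s0_def)
    have S2: "wp w (Set_entry 1 4) (\<lambda>n s'. n \<le> ?D \<and> (\<exists>t'. good w s' t' \<and>
        lookup t' = (lookup t1)((reg s1 1, treg s1 1) := reg s1 4) \<and> nodes t' \<le> nodes t1 + 1) \<and>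
      same s1 s' \<and> treg s' 1 = treg s1 1) s1"
      by (rule wp_Set_entry[OF 1(4) _ rN]) (use 1(6) in \<open>simp_all add: N_def\<close>)
    show ?case
    proof (rule wp_SeqI[OF S2], elim conjE exE, goal_cases)
      case 2: (1 n2 s2 t2)
      have r2: "reg s2 r = reg s r" if "r \<le> 12" "r \<noteq> 11" for r
        using 2(2) r1[OF that] that by (simp add: same_def)
      have S3: "wp w (Set_entry 10 5) (\<lambda>n s'. n \<le> ?D \<and> (\<exists>t'. good w s' t' \<and>
          lookup t' = (lookup t2)((reg s2 10, treg s2 1) := reg s2 5) \<and> nodes t' \<le> nodes t2 + 1) \<and>
        same s2 s' \<and> treg s' 1 = treg s2 1) s2"
        by (rule wp_Set_entry[OF 2(4) _ rN]) (use 1(6) 2(6) in \<open>simp_all add: N_def\<close>)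
      show ?case
      proof (rule wp_SeqI[OF S3], elim conjE exE, goal_cases)
        case 3: (1 n3 s3 t3)
        have sm: "same s0 s3" using same_trans[OF same_trans[OF 1(2) 2(2)] 3(2)] .
        have r3: "reg s3 r = reg s r" if "r \<le> 12" "r \<noteq> 11" for r
          using 3(2) r2[OF that] that by (simp add: same_def)
        have \<tau>: "treg s0 1 = ?\<tau>" "treg s1 1 = ?\<tau>" "treg s2 1 = ?\<tau>" using 1(3) 2(3) by (simp_all add: s0_def)
        have f: "lookup t3 = f"
          unfolding 3(5) 2(5) 1(5) f_def \<tau> using r1 r2 by (simp add: s0_def)
        define s4 where "s4 = s3\<lparr>reg := (reg s3)(12 := int T, 21 := 6 * int T)\<rparr>"
        have g4: "good w s4 t3" using 3(4) by (simp add: good_def tree_at_def s4_def)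
        have F: "wp w (Cond (Less 21 11) Rebuild Skip) (\<lambda>n. ?Q (n + (n1 + n2 + n3 + 9))) s4"
          by (rule fin[OF g4 f]) (use 1(1,6) 2(1,6) 3(1,6) sm in \<open>auto simp: N_def s4_def same_def s0_def\<close>)
        show ?case
          apply (rule wp_Seq, rule wp_Asg, simp, simp)
          apply (rule wp_Seq, rule wp_Asg, simp, simp)
          apply (rule back_subst[where P = "wp w _ _"])
           apply (rule wp_mono[OF F])
           apply (simp add: ac_simps)
          apply (simp add: s4_def r3 T')
          done
      qed
    qed
  qed
qed

text \<open>The first inequality makes room for node numbers, for the stack and for degrees, which
  are at most \<open>B * B\<close> in absolute value; the second for the codes
  \<open>u * n + v\<close> of edges.\<close>

definition room :: "nat \<Rightarrow> nat \<Rightarrow> nat \<Rightarrow> bool" where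
  "room w n B \<longleftrightarrow> 100 * (int B + 2)\<^sup>2 \<le> 2 ^ (w - 1) \<and> (int n + 1)\<^sup>2 \<le> 2 ^ (w - 1)"

lemma room_rng: "room w n B \<Longrightarrow> 0 \<le> i \<Longrightarrow> i \<le> 12 * int B + 20 \<Longrightarrow> rng w i"
proof -
  assume a: "room w n B" "0 \<le> i" "i \<le> 12 * int B + 20"
  have "(int B + 2)\<^sup>2 = int B * int B + 4 * int B + 4" by (simp add: power2_eq_square algebra_simps)
  moreover have "0 \<le> int B * int B" "0 \<le> int B" by simp_all
  ultimately have "8 * i + 16 \<le> 100 * (int B + 2)\<^sup>2" using a(2,3) by linarith
  with a show "rng w i" by (simp add: rng_def room_def)
qed

lemma room_edge: "room w n B \<Longrightarrow> u < n \<Longrightarrow> v < n \<Longrightarrow> wrap w (int u * int n + int v) = int u * int n + int v \<and>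
   wrap w (- (int u * int n + int v)) = - (int u * int n + int v)"
proof -
  assume a: "room w n B" "u < n" "v < n"
  have "int u * int n + int v < (int n + 1)\<^sup>2"
  proof -
    have "int u * int n \<le> int n * int n" using a by (intro mult_right_mono) auto
    moreover have "(int n + 1)\<^sup>2 = int n * int n + 2 * int n + 1"
      by (simp add: power2_eq_square algebra_simps)
    moreover have "int v < int n" "0 \<le> int n" using a(3) by simp_all
    ultimately show ?thesis by linarith
  qed
  then have "int u * int n + int v < 2 ^ (w - 1)" using a(1) by (simp add: room_def)
  moreover have "0 \<le> int u * int n + int v" by simp
  ultimately show ?thesis by (intro conjI wrap_id) linarith+
qed

lemma room_n: "room w n B \<Longrightarrow> u < n \<Longrightarrow> wrap w (int u) = int u"
proof -
  assume a: "room w n B" "u < n"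
  have "int u < (int n + 1) * 1" using a(2) by simp
  also have "\<dots> \<le> (int n + 1)\<^sup>2" unfolding power2_eq_square by (intro mult_left_mono) auto
  also have "\<dots> \<le> 2 ^ (w - 1)" using a(1) by (simp add: room_def)
  finally show ?thesis by (intro wrap_id) (auto intro: order_trans[of _ 0])
qed

text \<open>The tree uses no negative addresses, which leaves them to the table of current weights.\<close>

definition weights :: "nat \<Rightarrow> timeline \<Rightarrow> (int \<Rightarrow> int) \<Rightarrow> bool" where
  "weights n S M \<longleftrightarrow> (\<forall>u<n. \<forall>v<n. \<forall>x. replay S (dom S) {u, v} = Some x \<longrightarrow>
     M (- (int u * int n + int v)) = x)"

text \<open>The number of nodes is a parameter because the amortized analysis has to see it. Time
  register 3 may exceed all present times, as cancellations do not lower it.\<close>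

definition Inv :: "nat \<Rightarrow> nat \<Rightarrow> nat \<Rightarrow> timeline \<Rightarrow> nat \<Rightarrow> state \<Rightarrow> bool" where
  "Inv w n B S N s \<longleftrightarrow> (\<exists>t. good w s t \<and> lookup t = entry n S \<and> nodes t = N) \<and> reg s 10 = int n \<and>
     reg s 12 = int (card (dom S)) \<and> finite (dom S) \<and> legal_timeline n B S \<and>
     (\<forall>\<tau> \<in> dom S. \<tau> \<le> treg s 3) \<and> weights n S (mem s) \<and> N \<le> 6 * card (dom S) \<and> card (dom S) \<le> B"

text \<open>The alternatives are an update without and with a rebuild. A rebuild is decided after
  three possible new nodes and with the new \<open>T\<close>, hence \<open>N + 3\<close>.\<close>

definition step_cost :: "nat \<Rightarrow> nat \<Rightarrow> nat \<Rightarrow> nat \<Rightarrow> bool" where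
  "step_cost N T N' c \<longleftrightarrow> (let D = 5000 * (1 + depth_bound (N + 3)) in
     N' \<le> N + 3 \<and> c \<le> D \<or> 6 * T < N + 3 \<and> N' \<le> 3 * T \<and> c \<le> D * (N + 4))"

text \<open>Distinct ends exclude \<open>u = v = 0\<close>, the one pair whose address would be 0, a
  cell of the sentinel.\<close>

lemma address_neg: "u \<noteq> v \<Longrightarrow> u < n \<Longrightarrow> v < n \<Longrightarrow> - (int u * int n + int v) < 0"
proof -
  assume "u \<noteq> v" "u < n" "v < n"
  then have "0 < u * n + v" by (cases u) auto
  then have "0 < int (u * n + v)" by (simp only: of_nat_0_less_iff)
  then show ?thesis by simp
qed

lemma weights_cong:
  assumes "weights n S M" "finite (dom S)" "legal_timeline n B S" "\<And>a. a < 0 \<Longrightarrow> M' a = M a"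
  shows "weights n S M'"
  unfolding weights_def
proof (intro allI impI)
  fix u v x assume a: "u < n" "v < n" "replay S (dom S) {u, v} = Some x"
  from legal_edge(1)[OF assms(3,2) order_refl a(3)] have "u \<noteq> v" by (auto simp: doubleton_eq_iff)
  from assms(4)[OF address_neg[OF this a(1,2)]] show "M' (- (int u * int n + int v)) = x"
    using assms(1) a unfolding weights_def by simp
qed

lemma step_cost_mono: "step_cost N T N' c \<Longrightarrow> N = M \<Longrightarrow> c' \<le> c \<Longrightarrow> step_cost M T N' c'"
  unfolding step_cost_def Let_def by auto

text \<open>\<open>p\<close> is the time spent before \<open>Update\<close> is entered, which
  differs between creation and cancellation.\<close>

lemma wp_Update_Inv:
  assumes g: "good w s t" and N: "nodes t \<le> 6 * B" and room: "room w n B"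
    and f: "(lookup t)((reg s 0, treg s 0) := reg s 4, (reg s 1, treg s 0) := reg s 4,
      (int n, treg s 0) := reg s 5) = entry n S"
    and T: "reg s 12 + reg s 6 = int (card (dom S))" "card (dom S) \<le> B"
    and n: "reg s 10 = int n" and S: "finite (dom S)" "legal_timeline n B S"
    and M: "\<forall>\<tau> \<in> dom S. \<tau> \<le> treg s 3" "weights n S (mem s)"
    and p: "p \<le> 1000 * (1 + depth_bound (nodes t + 3))"
  shows "wp w Update (\<lambda>c s'. \<exists>N'. Inv w n B S N' s' \<and> step_cost (nodes t) (card (dom S)) N' (p + c)) s"
proof -
  let ?N = "nodes t + 3" and ?T = "card (dom S)"
  have r: "rng w (2 * int ?N + 4)" "rng w (int ?T)"
    by (rule room_rng[OF room]; use N T(2) in simp)+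
  show ?thesis
  proof (rule wp_mono[OF wp_Update[OF g r(1) T(1)[symmetric] r(2)]], elim conjE exE, goal_cases)
    case (1 c s' t')
    have f': "lookup t' = entry n S" using 1(6) f n by simp
    have "weights n S (mem s')" by (rule weights_cong[OF M(2) S]) (use 1(4) in simp)
    moreover have "nodes t' \<le> 3 * ?T" if "nodes t' \<le> card {k. ((lookup t)((reg s 0, treg s 0) := reg s 4, (reg s 1, treg s 0) := reg s 4,
      (reg s 10, treg s 0) := reg s 5)) k \<noteq> 0}"
      using that entry_support(2)[OF S(1), of n] unfolding n f by simp
    ultimately have "Inv w n B S (nodes t') s'"
      using 1 f' n T(2) S M(1) unfolding Inv_def by auto
    moreover have "step_cost (nodes t) ?T (nodes t') (p + c)"
      using 1(7)
    proof (elim disjE conjE)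
      assume "nodes t' \<le> ?N" "c \<le> 3200 * (1 + depth_bound ?N)"
      then show ?thesis using p unfolding step_cost_def Let_def by auto
    next
      assume a: "6 * ?T < ?N" "c \<le> 3200 * (1 + depth_bound ?N) * (?N + 1)"
        "nodes t' \<le> card {k. ((lookup t)((reg s 0, treg s 0) := reg s 4, (reg s 1, treg s 0) := reg s 4,
          (reg s 10, treg s 0) := reg s 5)) k \<noteq> 0}"
      then have "nodes t' \<le> 3 * ?T" using entry_support(2)[OF S(1), of n] unfolding n f by simp
      moreover have "p \<le> 1000 * (1 + depth_bound ?N) * (?N + 1)" using p by (rule order_trans) simp
      ultimately show ?thesis using a unfolding step_cost_def Let_def
        by (intro disjI2) (simp add: algebra_simps)
    qed
    ultimately show ?case by blast
  qed
qed

lemma good_neg: "good w s t \<Longrightarrow> a < 0 \<Longrightarrow> good w (s\<lparr>mem := (mem s)(a := x)\<rparr>) t"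
proof -
  assume a: "good w s t" "a < 0"
  have neq: "ad i f \<noteq> a" if "0 \<le> i" "0 \<le> f" for i f using that a(2) by (auto simp: ad_def)
  have "rep w (mem s) (tmem s) t" "nids t = {1..int (nodes t)}"
    using a(1) by (auto simp: good_def tree_at_def)
  then have "rep w ((mem s)(a := x)) (tmem s) t"
  proof (elim rep_cong)
    fix i f :: int assume "i \<in> insert 0 (nids t)" "f \<in> {0..5}"
    then have "ad i f \<noteq> a" using \<open>nids t = _\<close> by (intro neq) auto
    then show "((mem s)(a := x)) (ad i f) = mem s (ad i f)" by simp
  qed simp
  moreover have "ad 0 6 \<noteq> a" by (rule neq) auto
  ultimately show ?thesis using a(1) unfolding good_def tree_at_def by auto
qed

section \<open>Creating updates\<close>

definition Ea :: "nat \<Rightarrow> nat \<Rightarrow> expr" where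
  "Ea x y = Bin Sub (Num 0) (Bin Add (Bin Mul (Var x) (Var 10)) (Var y))"

lemma Ea_simps [simp]: "cost (Ea x y) = 7" "low (Ea x y) \<longleftrightarrow> x < 30 \<and> y < 30"
  by (auto simp: Ea_def)

lemma eval_Ea:
  assumes "room w n B" "reg s x = int u" "reg s y = int v" "reg s 10 = int n" "u < n" "v < n"
  shows "eval w (Ea x y) s = - (int u * int n + int v)"
  using room_edge[OF assms(1,5,6)] assms(2-4) by (simp add: Ea_def)

lemma edge_address_inj:
  assumes "int u * int n + int v = int u' * int n + int v'" "v < n" "v' < n"
  shows "u = u' \<and> v = v'"
proof -
  have "int (u * n + v) = int (u' * n + v')" using assms(1) by simp
  then have eq: "u * n + v = u' * n + v'" by (simp only: of_nat_eq_iff)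
  have "(u * n + v) div n = u" "(u' * n + v') div n = u'" using assms(2,3) by simp_all
  then show ?thesis using eq by auto
qed

text \<open>The address depends on the order of the ends, so both orders are written. Other edges
  keep their cells because \<open>u * n + v\<close> determines the pair.\<close>

lemma weights_update:
  assumes "weights n S M" "u < n" "v < n"
    and "\<And>e. e \<noteq> {u, v} \<Longrightarrow> replay S' (dom S') e = replay S (dom S) e"
    and "\<And>x. replay S' (dom S') {u, v} = Some x \<Longrightarrow> x = y"
  shows "weights n S' (M(- (int u * int n + int v) := y, - (int v * int n + int u) := y))"
  unfolding weights_def
proof (intro allI impI)
  fix u' v' x assume a: "u' < n" "v' < n" "replay S' (dom S') {u', v'} = Some x"
  show "(M(- (int u * int n + int v) := y, - (int v * int n + int u) := y)) (- (int u' * int n + int v')) = x"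
  proof (cases "{u', v'} = {u, v}")
    case True
    then have "x = y" using a assms(5) by simp
    with True show ?thesis by (auto simp: doubleton_eq_iff)
  next
    case False
    then have "replay S (dom S) {u', v'} = Some x" using a assms(4) by metis
    then have "M (- (int u' * int n + int v')) = x" using assms(1) a unfolding weights_def by blast
    moreover have "int u' * int n + int v' \<noteq> int u * int n + int v"
      "int u' * int n + int v' \<noteq> int v * int n + int u"
      using False edge_address_inj[of u' n v'] assms(2,3) a(1,2) by (metis insert_commute)+
    ultimately show ?thesis by simp
  qed
qed

definition Latest :: prog where
  "Latest = Cond (TLess 3 0) (Instr (TMove 3 0)) Skip"

lemma wp_Latest:
  "(\<And>n. n \<le> 2 \<Longrightarrow> Q n (s\<lparr>treg := (treg s)(3 := max (treg s 3) (treg s 0))\<rparr>)) \<Longrightarrow> wp w Latest Q s"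
  unfolding Latest_def by (intro wp_Cond wp_TMove wp_Skip) (auto simp: max_def)

definition Insert_code :: prog where
  "Insert_code = Seq Latest (Seq (Sto (Ea 0 1) (Var 2)) (Seq (Sto (Ea 1 0) (Var 2)) (Seq (Asg 4 (Var 2))
    (Seq (Asg 5 (Bin Add (Bin Mul (Var 0) (Var 10)) (Var 1))) (Seq (Asg 6 (Num 1)) Update)))))"

definition Delete_code :: prog where
  "Delete_code = Seq Latest (Seq (Asg 2 (Mem (Ea 0 1))) (Seq (Asg 4 (Bin Sub (Num 0) (Var 2)))
    (Seq (Asg 5 (Ea 0 1)) (Seq (Asg 6 (Num 1)) Update))))"

lemma room_B: "room w n B \<Longrightarrow> \<bar>x\<bar> \<le> int B \<Longrightarrow> wrap w x = x \<and> wrap w (- x) = - x"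
  using rng_wrap[OF room_rng[of w n B "int B + 1"]]
    wrap_id[of w x] wrap_id[of w "- x"] room_rng[of w n B "int B + 1"] by (auto simp: rng_def abs_le_iff)

lemma card_created: "finite (dom S) \<Longrightarrow> \<tau> \<notin> dom S \<Longrightarrow> card (dom (S(\<tau> \<mapsto> a))) = card (dom S) + 1"
  by simp

lemma latest_created: "\<forall>\<sigma> \<in> dom S. \<sigma> \<le> m \<Longrightarrow> \<forall>\<sigma> \<in> dom (S(\<tau> \<mapsto> a)). \<sigma> \<le> max m (\<tau> :: real)"
  by (metis domIff fun_upd_other max.coboundedI1 max.cobounded2)

lemma wp_Insert:
  assumes inv: "Inv w n B S N s" and room: "room w n B"
    and s: "reg s 0 = int u" "reg s 1 = int v" "reg s 2 = x" "treg s 0 = \<tau>"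
    and \<tau>: "\<tau> \<notin> dom S" and S': "legal_timeline n B (S(\<tau> \<mapsto> Insert u v x))"
    "card (dom (S(\<tau> \<mapsto> Insert u v x))) \<le> B"
  defines "S' \<equiv> S(\<tau> \<mapsto> Insert u v x)"
  shows "wp w Insert_code (\<lambda>c s'. \<exists>N'. Inv w n B S' N' s' \<and> step_cost N (card (dom S')) N' c) s"
proof -
  obtain t where t: "good w s t" "lookup t = entry n S" "nodes t = N"
    and i: "reg s 10 = int n" "reg s 12 = int (card (dom S))" "finite (dom S)" "legal_timeline n B S"
      "\<forall>\<tau> \<in> dom S. \<tau> \<le> treg s 3" "weights n S (mem s)" "N \<le> 6 * card (dom S)" "card (dom S) \<le> B"
    using inv unfolding Inv_def by blast
  have uv: "u < n" "v < n" "u \<noteq> v" "\<bar>x\<bar> \<le> int B"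
    using legal_ends[OF S'(1), of \<tau> "Insert u v x"] legal_timelineD[OF S'(1), of \<tau> "Insert u v x"] i(3) by auto
  note cr = replay_created[OF i(3) \<tau> i(4) S'(1), folded S'_def]
  have ch: "change S' \<tau> = x" by (simp add: change_def S'_def)
  let ?a = "- (int u * int n + int v)" and ?b = "- (int v * int n + int u)"
  have ab: "?a < 0" "?b < 0" using uv address_neg[of u v n] address_neg[of v u n] by auto
  define M where "M = (mem s)(?a := x, ?b := x)"
  define T where "T = (treg s)(3 := max (treg s 3) \<tau>)"
  define s1 where "s1 = s\<lparr>treg := T, mem := M, reg := (reg s)(4 := x, 5 := int u * int n + int v, 6 := 1)\<rparr>"
  have "good w (s\<lparr>mem := M\<rparr>) t"
    using good_neg[OF good_neg[OF t(1) ab(1), of x] ab(2), of x] by (simp add: M_def)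
  then have g: "good w s1 t" by (simp add: good_def tree_at_def s1_def)
  have U: "wp w Update (\<lambda>c s'. \<exists>N'. Inv w n B S' N' s' \<and> step_cost (nodes t) (card (dom S')) N' (100 + c)) s1"
  proof (rule wp_Update_Inv[OF g _ room])
    show "nodes t \<le> 6 * B" using t(3) i(7,8) by simp
    show "(lookup t)((reg s1 0, treg s1 0) := reg s1 4, (reg s1 1, treg s1 0) := reg s1 4,
      (int n, treg s1 0) := reg s1 5) = entry n S'"
      using entry_created[OF i(3) \<tau> i(4) S'(1), folded S'_def] t(2) s by (simp add: s1_def T_def ch)
    show "reg s1 12 + reg s1 6 = int (card (dom S'))"
      using card_created[OF i(3) \<tau>] i(2) by (simp add: s1_def S'_def)
    show "card (dom S') \<le> B" "legal_timeline n B S'" "finite (dom S')" "reg s1 10 = int n"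
      using S' i by (simp_all add: S'_def s1_def)
    have "treg s1 3 = max (treg s 3) \<tau>" by (simp add: s1_def T_def)
    then show "\<forall>\<sigma> \<in> dom S'. \<sigma> \<le> treg s1 3" using latest_created[OF i(5)] by (simp only: S'_def)
    have "weights n S' M" unfolding M_def
      by (rule weights_update[OF i(6) uv(1,2)]) (simp_all add: cr(1))
    then show "weights n S' (mem s1)" by (simp add: s1_def)
  qed simp
  note e = eval_Ea[OF room _ _ _ uv(1,2)] eval_Ea[OF room _ _ _ uv(2,1)]
  have w1: "wrap w 1 = 1" by (rule rng_wrap[OF room_rng[OF room, of 0]]) auto
  note s' = s(2)[unfolded One_nat_def]
  show ?thesis unfolding Insert_code_def
    apply (rule wp_Seq, rule wp_Latest)
    apply (rule wp_Seq, rule wp_Sto, simp, simp, simp add: e s s' i)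
    apply (rule wp_Seq, rule wp_Sto, simp, simp, simp add: e s s' i)
    apply (rule wp_Seq, rule wp_Asg, simp, simp, simp add: s s')
    apply (rule wp_Seq, rule wp_Asg, simp, simp, simp add: s s' i room_edge[OF room uv(1,2)])
    apply (rule wp_Seq, rule wp_Asg, simp, simp, simp add: w1)
    apply (rule back_subst[where P = "wp w _ _"])
     apply (rule wp_mono[OF U], elim exE conjE, intro exI conjI, assumption)
     apply (erule step_cost_mono[OF _ t(3)], simp)
    apply (simp add: s1_def M_def T_def s s')
    done
qed

lemma wp_Delete:
  assumes inv: "Inv w n B S N s" and room: "room w n B"
    and s: "reg s 0 = int u" "reg s 1 = int v" "treg s 0 = \<tau>"
    and \<tau>: "\<tau> \<notin> dom S" and S': "legal_timeline n B (S(\<tau> \<mapsto> Delete u v))"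
    "card (dom (S(\<tau> \<mapsto> Delete u v))) \<le> B"
  defines "S' \<equiv> S(\<tau> \<mapsto> Delete u v)"
  shows "wp w Delete_code (\<lambda>c s'. \<exists>N'. Inv w n B S' N' s' \<and> step_cost N (card (dom S')) N' c) s"
proof -
  obtain t where t: "good w s t" "lookup t = entry n S" "nodes t = N"
    and i: "reg s 10 = int n" "reg s 12 = int (card (dom S))" "finite (dom S)" "legal_timeline n B S"
      "\<forall>\<tau> \<in> dom S. \<tau> \<le> treg s 3" "weights n S (mem s)" "N \<le> 6 * card (dom S)" "card (dom S) \<le> B"
    using inv unfolding Inv_def by blast
  have uv: "u < n" "v < n" "u \<noteq> v"
    using legal_ends[OF S'(1), of \<tau> "Delete u v"] i(3) by auto
  note cr = replay_created[OF i(3) \<tau> i(4) S'(1), folded S'_def]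
  have "{u, v} \<in> dom (graph_before S' \<tau>)"
    using legal_timelineD[OF S'(1), of \<tau> "Delete u v"] by (simp add: S'_def)
  then obtain x where "graph_before S' \<tau> {u, v} = Some x" by auto
  then have x: "replay S (dom S) {u, v} = Some x" using cr(2) by simp
  have xB: "wrap w (- x) = - x" using room_B[OF room legal_edge(2)[OF i(4,3) order_refl x]] by simp
  have ch: "change S' \<tau> = - x" using cr(2) x by (simp add: change_def S'_def)
  have m: "mem s (- (int u * int n + int v)) = x" using i(6) uv x unfolding weights_def by blast
  define T where "T = (treg s)(3 := max (treg s 3) \<tau>)"
  define s1 where "s1 = s\<lparr>treg := T, reg := (reg s)(2 := x, 4 := - x, 5 := - (int u * int n + int v), 6 := 1)\<rparr>"
  have g: "good w s1 t" using t(1) by (simp add: good_def tree_at_def s1_def)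
  have U: "wp w Update (\<lambda>c s'. \<exists>N'. Inv w n B S' N' s' \<and> step_cost (nodes t) (card (dom S')) N' (100 + c)) s1"
  proof (rule wp_Update_Inv[OF g _ room])
    show "nodes t \<le> 6 * B" using t(3) i(7,8) by simp
    show "(lookup t)((reg s1 0, treg s1 0) := reg s1 4, (reg s1 1, treg s1 0) := reg s1 4,
      (int n, treg s1 0) := reg s1 5) = entry n S'"
      using entry_created[OF i(3) \<tau> i(4) S'(1), folded S'_def] t(2) s by (simp add: s1_def T_def ch)
    show "reg s1 12 + reg s1 6 = int (card (dom S'))"
      using card_created[OF i(3) \<tau>] i(2) by (simp add: s1_def S'_def)
    show "card (dom S') \<le> B" "legal_timeline n B S'" "finite (dom S')" "reg s1 10 = int n"
      using S' i by (simp_all add: S'_def s1_def)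
    have "treg s1 3 = max (treg s 3) \<tau>" by (simp add: s1_def T_def)
    then show "\<forall>\<sigma> \<in> dom S'. \<sigma> \<le> treg s1 3" using latest_created[OF i(5)] by (simp only: S'_def)
    \<comment> \<open>A deletion leaves the table as it is, since \<open>weights\<close> constrains
      the cells of present edges only.\<close>
    show "weights n S' (mem s1)" unfolding weights_def
    proof (intro allI impI)
      fix u' v' y assume a: "u' < n" "v' < n" "replay S' (dom S') {u', v'} = Some y"
      then have "replay S (dom S) {u', v'} = Some y" unfolding cr(1) by (simp split: if_splits)
      then show "mem s1 (- (int u' * int n + int v')) = y"
        using i(6) a(1,2) unfolding weights_def s1_def by simp
    qed
  qed simp
  note e = eval_Ea[OF room _ _ _ uv(1,2)]
  have w1: "wrap w 1 = 1" by (rule rng_wrap[OF room_rng[OF room, of 0]]) auto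
  note s' = s(2)[unfolded One_nat_def]
  have m': "mem s (- (int u * int n) - int v) = x" using m by simp
  show ?thesis unfolding Delete_code_def
    apply (rule wp_Seq, rule wp_Latest)
    apply (rule wp_Seq, rule wp_Asg, simp, simp, simp add: e s s' i m')
    apply (rule wp_Seq, rule wp_Asg, simp, simp, simp add: xB)
    apply (rule wp_Seq, rule wp_Asg, simp, simp, simp add: e s s' i)
    apply (rule wp_Seq, rule wp_Asg, simp, simp, simp add: w1)
    apply (rule back_subst[where P = "wp w _ _"])
     apply (rule wp_mono[OF U], elim exE conjE, intro exI conjI, assumption)
     apply (erule step_cost_mono[OF _ t(3)], simp)
    apply (simp add: s1_def T_def s s')
    done
qed

section \<open>Cancelling updates\<close>

definition Cancel_edge :: prog where
  "Cancel_edge = Seq (Asg 13 (Var 0)) (Seq Lookup (Seq (Asg 2 (Bin Sub (Num 0) (Var 20)))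
    (Seq (Sto (Ea 0 1) (Var 2)) (Seq (Sto (Ea 1 0) (Var 2)) (Seq (Asg 4 (Num 0)) (Seq (Asg 5 (Num 0))
    (Seq (Asg 6 (Num (- 1))) Update)))))))"

text \<open>The edge is decoded from the entry under \<open>(n, t)\<close>: after removal of the
  sign, division by \<open>n\<close> yields one end and the remainder the other.\<close>

definition Cancel_code :: prog where
  "Cancel_code = Seq (Instr (TMove 1 0)) (Seq (Asg 13 (Var 10)) (Seq Lookup (Seq (Asg 5 (Var 20))
    (Seq (Cond (Less 5 3) (Asg 5 (Bin Sub (Num 0) (Var 5))) Skip) (Seq (Asg 0 (Bin Div (Var 5) (Var 10)))
    (Seq (Asg 1 (Bin Mod (Var 5) (Var 10))) Cancel_edge))))))"

lemma touch_stack_neg: "touch stack R s s' \<Longrightarrow> a < 0 \<Longrightarrow> mem s' a = mem s a"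
  by (auto simp: touch_def stack_def ad_def)

lemma good_touch: "good w s t \<Longrightarrow> touch stack R s s' \<Longrightarrow> 3 \<notin> R \<Longrightarrow> 11 \<notin> R \<Longrightarrow> good w s' t"
proof -
  assume a: "good w s t" "touch stack R s s'" "3 \<notin> R" "11 \<notin> R"
  have m: "mem s' (ad i f) = mem s (ad i f)" if "0 \<le> f" "f < 7" for i f
    using a(2) that by (simp add: touch_def)
  have "rep w (mem s') (tmem s') t"
    using a(1) unfolding good_def tree_at_def
    by (elim conjE rep_cong) (use m a(2) in \<open>auto simp: touch_def\<close>)
  with a m show ?thesis by (auto simp: good_def tree_at_def touch_def)
qed

lemma wp_Cancel:
  assumes inv: "Inv w n B S N s" and room: "room w n B"
    and s: "treg s 0 = \<tau>" and \<tau>: "S \<tau> = Some a" and S': "legal_timeline n B (S(\<tau> := None))"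
  defines "S' \<equiv> S(\<tau> := None)"
  shows "wp w Cancel_code (\<lambda>c s'. \<exists>N'. Inv w n B S' N' s' \<and> step_cost N (card (dom S')) N' c) s"
proof -
  obtain t where t: "good w s t" "lookup t = entry n S" "nodes t = N"
    and i: "reg s 10 = int n" "reg s 12 = int (card (dom S))" "finite (dom S)" "legal_timeline n B S"
      "\<forall>\<tau> \<in> dom S. \<tau> \<le> treg s 3" "weights n S (mem s)" "N \<le> 6 * card (dom S)" "card (dom S) \<le> B"
    using inv unfolding Inv_def by blast
  define u v where uv_def: "u = fst (ends a)" "v = snd (ends a)"
  have uv: "u < n" "v < n" "u \<noteq> v" using legal_ends[OF i(4,3) \<tau>] by (simp_all add: uv_def)
  have eq: "S'(\<tau> \<mapsto> a) = S" using \<tau> by (auto simp: S'_def)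
  have fin': "finite (dom S')" "\<tau> \<notin> dom S'" using i(3) by (auto simp: S'_def)
  note cr = replay_created[OF fin' S'[folded S'_def], of a, unfolded eq, OF i(4)]
  let ?c = "int u * int n + int v" and ?x = "change S \<tau>"
  have ea: "edge a = {u, v}" by (simp add: edge_ends uv_def)
  have en: "entry n S (int n, \<tau>) = code n a" "entry n S (int u, \<tau>) = ?x"
    using \<tau> uv by (simp_all add: entry_def ea)
  have cpos: "0 < ?c" using address_neg[OF uv(3,1,2)] by simp
  have cabs: "code n a = ?c \<or> code n a = - ?c" by (cases a) (auto simp: uv_def)
  have cdiv: "?c div int n = int u" "?c mod int n = int v" using uv(1,2) by auto
  have xB: "wrap w (- ?x) = - ?x"
    using room_B[OF room change_bound[OF i(4,3)], of \<tau>] \<tau> by auto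
  \<comment> \<open>The table receives the negated change in either case. For a cancelled deletion
    this is the weight that the edge regains; after a cancelled insertion the edge is absent, so any
    value will do.\<close>
  have wts: "weights n S' (M(- ?c := - ?x, - (int v * int n + int u) := - ?x))"
    if "weights n S M" for M
  proof (rule weights_update[OF that uv(1,2)])
    show "replay S' (dom S') e = replay S (dom S) e" if "e \<noteq> {u, v}" for e
      unfolding cr(1) using that by (simp add: ea)
    show "y = - ?x" if "replay S' (dom S') {u, v} = Some y" for y
    proof -
      have gb: "graph_before S \<tau> {u, v} = Some y" using cr(2) that by (simp add: ea)
      then have "{u, v} \<in> dom (graph_before S \<tau>)" by auto
      with legal_upd_result[OF legal_timelineD[OF i(4) \<tau>]] have "result a = None" by (simp add: ea)
      then show ?thesis using gb \<tau> by (simp add: change_def ea)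
    qed
  qed
  have dN: "depth t \<le> depth_bound (N + 3)" by (rule good_depth[OF t(1)]) (simp add: t(3))
  have rd: "rng w (int (depth t) + 1)"
    by (rule room_rng[OF room]) (use depth_nodes[of t] t(3) i(7,8) in auto)
  have w1: "wrap w (- 1) = - 1" by (rule rng_wrap[OF room_rng[OF room, of 0]]) auto
  define s1 where "s1 = s\<lparr>treg := (treg s)(1 := \<tau>), reg := (reg s)(13 := int n)\<rparr>"
  have g1: "good w s1 t" using t(1) by (simp add: good_def tree_at_def s1_def)
  have L1: "wp w Lookup (\<lambda>n' s'. n' \<le> 140 * (1 + depth t) \<and> reg s' 20 = code n a \<and>
    touch stack {15, 16, 17, 18, 19, 20} s1 s') s1"
  proof -
    have "tree_at w s1 t" using g1 by (simp add: good_def)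
    from wp_Lookup[OF this _ rd, of "(int n, \<tau>)"] show ?thesis by (simp add: t(2) en s1_def)
  qed
  have main: "wp w Cancel_edge
    (\<lambda>c s'. \<exists>N'. Inv w n B S' N' s' \<and> step_cost N (card (dom S')) N' (c + p)) s2"
    if g2: "good w s2 t" and r2: "reg s2 0 = int u" "reg s2 1 = int v" "reg s2 10 = int n"
      "reg s2 12 = int (card (dom S))" "treg s2 1 = \<tau>" "treg s2 0 = \<tau>" "treg s2 3 = treg s 3"
      "weights n S (mem s2)" and p: "p \<le> 200 * (1 + depth t)" for s2 p
  proof -
    define s3 where "s3 = s2\<lparr>reg := (reg s2)(13 := int u)\<rparr>"
    have "tree_at w s3 t" using g2 by (simp add: good_def tree_at_def s3_def)
    from wp_Lookup[OF this _ rd, of "(int u, \<tau>)"]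
    have L2: "wp w Lookup (\<lambda>n' s'. n' \<le> 140 * (1 + depth t) \<and> reg s' 20 = ?x \<and>
      touch stack {15, 16, 17, 18, 19, 20} s3 s') s3" using r2 by (simp add: t(2) en s3_def)
    have g3: "good w s3 t" using g2 by (simp add: good_def tree_at_def s3_def)
    show ?thesis unfolding Cancel_edge_def
    proof (rule wp_Seq, rule wp_Asg, simp, simp, simp add: r2, fold s3_def, rule wp_SeqI[OF L2], elim conjE, goal_cases)
      case 4: (1 n4 s4)
      have r4: "reg s4 0 = int u" "reg s4 (Suc 0) = int v" "reg s4 10 = int n" "reg s4 12 = int (card (dom S))"
        "treg s4 0 = \<tau>" "treg s4 3 = treg s 3"
        using 4(3) r2 by (auto simp: touch_def s3_def)
      have W4: "weights n S (mem s4)"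
        by (rule weights_cong[OF r2(8) i(3,4)]) (use touch_stack_neg[OF 4(3)] in \<open>simp add: s3_def\<close>)
      let ?b = "- (int v * int n + int u)"
      have ab: "- ?c < 0" "?b < 0" using uv address_neg[of u v n] address_neg[of v u n] by auto
      have g4: "good w s4 t" by (rule good_touch[OF g3 4(3)]) auto
      define M where "M = (mem s4)(- ?c := - ?x, ?b := - ?x)"
      define s5 where "s5 = s4\<lparr>mem := M, reg := (reg s4)(2 := - ?x, 4 := 0, 5 := 0, 6 := - 1)\<rparr>"
      have "good w (s4\<lparr>mem := M\<rparr>) t"
        using good_neg[OF good_neg[OF g4 ab(1), of "- ?x"] ab(2), of "- ?x"] by (simp add: M_def)
      then have g5: "good w s5 t" by (simp add: good_def tree_at_def s5_def)
      have U: "wp w Update (\<lambda>c s'. \<exists>N'. Inv w n B S' N' s' \<and>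
        step_cost (nodes t) (card (dom S')) N' (600 * (1 + depth t) + c)) s5"
      proof (rule wp_Update_Inv[OF g5 _ room])
        show "nodes t \<le> 6 * B" using t(3) i(7,8) by simp
        have "entry n S' = (entry n S)((int u, \<tau>) := 0, (int v, \<tau>) := 0, (int n, \<tau>) := 0)"
          using entry_cancelled[OF i(3) \<tau> i(4) S'] by (simp add: S'_def uv_def)
        then show "(lookup t)((reg s5 0, treg s5 0) := reg s5 4, (reg s5 1, treg s5 0) := reg s5 4,
          (int n, treg s5 0) := reg s5 5) = entry n S'"
          using t(2) r4 by (simp add: s5_def)
        have "card (dom S) = card (dom S') + 1" using card_created[OF fin', of a] by (simp add: eq)
        then show "reg s5 12 + reg s5 6 = int (card (dom S'))" "card (dom S') \<le> B"
          using r4 i(8) by (simp_all add: s5_def)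
        show "legal_timeline n B S'" "finite (dom S')" "reg s5 10 = int n"
          using S' fin' r4 by (simp_all add: S'_def s5_def)
        show "\<forall>\<sigma> \<in> dom S'. \<sigma> \<le> treg s5 3" using i(5) r4 by (auto simp: S'_def s5_def split: if_splits)
        have "weights n S' M" unfolding M_def by (rule wts[OF W4])
        then show "weights n S' (mem s5)" by (simp add: s5_def)
        show "600 * (1 + depth t) \<le> 1000 * (1 + depth_bound (nodes t + 3))" using dN t(3) by simp
      qed
      note e = eval_Ea[OF room _ _ _ uv(1,2)] eval_Ea[OF room _ _ _ uv(2,1)]
      show ?case
        apply (rule wp_Seq, rule wp_Asg, simp, simp, simp add: 4 xB)
        apply (rule wp_Seq, rule wp_Sto, simp, simp, simp add: e r4)
        apply (rule wp_Seq, rule wp_Sto, simp, simp, simp add: e r4)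
        apply (rule wp_Seq, rule wp_Asg, simp, simp, simp)
        apply (rule wp_Seq, rule wp_Asg, simp, simp, simp)
        apply (rule wp_Seq, rule wp_Asg, simp, simp, simp add: w1)
        apply (rule back_subst[where P = "wp w _ _"])
         apply (rule wp_mono[OF U], elim exE conjE, intro exI conjI, assumption)
         apply (erule step_cost_mono[OF _ t(3)])
        subgoal using 4(1) p by simp
        apply (simp add: s5_def M_def r4)
        done
    qed
  qed
  show ?thesis unfolding Cancel_code_def
  proof (rule wp_Seq, rule wp_TMove, rule wp_Seq, rule wp_Asg, simp, simp, simp add: s i,
      fold s1_def[unfolded One_nat_def], rule wp_SeqI[OF L1], elim conjE, goal_cases)
    case 2: (1 k s2)
    have t2: "touch stack {15, 16, 17, 18, 19, 20} s1 s2" and k: "k \<le> 140 * (1 + depth t)"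
      and r20: "reg s2 20 = code n a" using 2 by auto
    have g2: "good w s2 t" by (rule good_touch[OF g1 t2]) auto
    have r2: "reg s2 3 = 0" "reg s2 10 = int n" "reg s2 12 = int (card (dom S))" "treg s2 1 = \<tau>" "treg s2 0 = \<tau>"
      "treg s2 3 = treg s 3"
      using t2 i s g2 by (auto simp: touch_def s1_def good_def tree_at_def)
    have W2: "weights n S (mem s2)"
      by (rule weights_cong[OF i(6,3,4)]) (use touch_stack_neg[OF t2] in \<open>simp add: s1_def\<close>)
    have "wrap w (- code n a) = - code n a"
      using cabs room_edge[OF room uv(1,2)] by (metis minus_minus)
    then have wc: "wrap w ?c = ?c" "wrap w (- code n a) = - code n a" "wrap w (int u) = int u" "wrap w (int v) = int v"
      using room_edge[OF room uv(1,2)] room_n[OF room uv(1)] room_n[OF room uv(2)] by simp_all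
    have dec: "wp w (Seq (Asg 0 (Bin Div (Var 5) (Var 10))) (Seq (Asg 1 (Bin Mod (Var 5) (Var 10))) Cancel_edge))
      (\<lambda>c s'. \<exists>N'. Inv w n B S' N' s' \<and> step_cost N (card (dom S')) N' (c + p)) (s2\<lparr>reg := (reg s2)(5 := ?c)\<rparr>)"
      if p: "p \<le> 180 * (1 + depth t)" for p
    proof -
      define s3 where "s3 = s2\<lparr>reg := (reg s2)(5 := ?c, 0 := int u, 1 := int v)\<rparr>"
      have "good w s3 t" using g2 by (simp add: good_def tree_at_def s3_def)
      then have m3: "wp w Cancel_edge
        (\<lambda>c s'. \<exists>N'. Inv w n B S' N' s' \<and> step_cost N (card (dom S')) N' (c + (p + 8))) s3"
        by (rule main) (use r2 W2 p in \<open>simp_all add: s3_def\<close>)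
      show ?thesis
        apply (rule wp_Seq, rule wp_Asg, simp, simp, simp add: r2 cdiv wc)
        apply (rule wp_Seq, rule wp_Asg, simp, simp, simp add: r2 cdiv wc uv)
        apply (rule back_subst[where P = "wp w _ _"])
         apply (rule wp_mono[OF m3[unfolded One_nat_def]])
         apply (elim exE conjE, intro exI conjI, assumption)
         apply (erule step_cost_mono, simp, simp)
        apply (simp add: s3_def)
        done
    qed
    note D = dec[unfolded One_nat_def]
    show ?case
    proof (rule wp_Seq, rule wp_Asg, simp, simp, simp add: r20, rule wp_Seq, rule wp_Cond, goal_cases)
      case c: 2
      then have neg: "code n a = - ?c" using cabs cpos r2 by auto
      show ?case
        apply (rule wp_Asg, simp, simp, simp add: wc(2))
        apply (rule back_subst[where P = "wp w _ _"])
         apply (rule wp_mono[OF D[of "k + 10"]])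
        subgoal using k by simp
        subgoal by (elim exE conjE, intro exI conjI, assumption) (erule step_cost_mono, simp_all)
        apply (simp add: neg add.commute)
        done
    next
      case c: 3
      then have pos: "code n a = ?c" using cabs cpos r2 by auto
      show ?case
        apply (rule wp_Skip)
        apply (rule back_subst[where P = "wp w _ _"])
         apply (rule wp_mono[OF D[of "k + 10"]])
        subgoal using k by simp
        subgoal by (elim exE conjE, intro exI conjI, assumption) (erule step_cost_mono, simp_all)
        apply (simp add: pos add.commute)
        done
    qed simp
  qed
qed

section \<open>Queries\<close>

lemma room_pred: "room w n B \<Longrightarrow> v < n \<Longrightarrow> wrap w (int v - 1) = int v - 1 \<and> wrap w (int v + 1) = int v + 1"
proof -
  assume a: "room w n B" "v < n"
  have "(int n + 1)\<^sup>2 = int n * int n + 2 * int n + 1" by (simp add: power2_eq_square algebra_simps)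
  moreover have "0 \<le> int n * int n" "int v < int n" "0 \<le> int v" using a(2) by simp_all
  ultimately have "int v + 1 < 2 ^ (w - 1)" using a(1) unfolding room_def by linarith
  then show ?thesis using \<open>0 \<le> int v\<close> by (intro conjI wrap_id) linarith+
qed

lemma good_same_mem:
  "good w s t \<Longrightarrow> mem s' = mem s \<Longrightarrow> tmem s' = tmem s \<Longrightarrow> reg s' 3 = reg s 3 \<Longrightarrow> reg s' 11 = reg s 11 \<Longrightarrow> good w s' t"
  by (simp add: good_def tree_at_def)

text \<open>Time register 3 bounds all times from above, so that the keys of the vertices below \<open>v\<close> are those
  up to the pair of \<open>v - 1\<close> and this bound.\<close>

definition Vertex_degree :: prog where
  "Vertex_degree = Seq (Asg 13 (Bin Sub (Var 21) (Num 1))) (Seq (Instr (TMove 1 3)) (Seq Prefix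
    (Seq (Asg 23 (Var 20)) (Seq (Asg 13 (Var 21)) (Seq (Instr (TMove 1 0)) (Seq Prefix
    (Asg 23 (Bin Sub (Var 20) (Var 23)))))))))"

definition qsame :: "state \<Rightarrow> state \<Rightarrow> bool" where
  "qsame s s' \<longleftrightarrow> mem s' = mem s \<and> tmem s' = tmem s \<and>
     (\<forall>r. r \<notin> {13, 16, 18, 19, 20, 21, 22, 23} \<longrightarrow> reg s' r = reg s r) \<and>
     (\<forall>r. r \<notin> {1, 2} \<longrightarrow> treg s' r = treg s r)"

lemma qsame_trans: "qsame s s' \<Longrightarrow> qsame s' s'' \<Longrightarrow> qsame s s''"
  by (simp add: qsame_def)

lemma wp_Vertex_degree:
  assumes g: "good w s t" and room: "room w n B" and v: "reg s 21 = int v" "v < n"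
  shows "wp w Vertex_degree (\<lambda>c s'. c \<le> 220 * (1 + depth t) \<and>
    reg s' 23 = wrap w (prefix t (int v, treg s 0) - prefix t (int v - 1, treg s 3)) \<and>
    reg s' 21 = reg s 21 \<and> reg s' 22 = reg s 22 \<and> qsame s s') s"
proof -
  let ?k1 = "(int v - 1, treg s 3)" and ?k2 = "(int v, treg s 0)"
  have w1: "wrap w (int v - 1) = int v - 1" using room_pred[OF room v(2)] by simp
  have r0: "rng w 0" by (rule room_rng[OF room]) auto
  define s1 where "s1 = s\<lparr>reg := (reg s)(13 := int v - 1), treg := (treg s)(1 := treg s 3)\<rparr>"
  have t1: "tree_at w s1 t" using g by (simp add: good_def tree_at_def s1_def)
  have P1: "wp w Prefix (\<lambda>n s'. n \<le> 100 * (1 + depth t) \<and> reg s' 20 = wrap w (prefix t ?k1) \<and>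
    touch {} {16, 18, 19, 20} s1 s') s1"
    by (rule wp_Prefix[OF t1 _ r0]) (simp add: s1_def)
  show ?thesis unfolding Vertex_degree_def
  proof (rule wp_Seq, rule wp_Asg, simp, simp, simp add: v w1, rule wp_Seq, rule wp_TMove, simp,
      fold s1_def[unfolded One_nat_def], rule wp_SeqI[OF P1], elim conjE, goal_cases)
    case 2: (1 k2 s2)
    define s3 where "s3 = s2\<lparr>reg := (reg s2)(23 := wrap w (prefix t ?k1), 13 := int v), treg := (treg s2)(1 := treg s 0)\<rparr>"
    have m2: "mem s2 = mem s" "tmem s2 = tmem s" "reg s2 21 = int v" "reg s2 22 = reg s 22" "treg s2 0 = treg s 0"
      and q2: "qsame s s2"
      using 2(3) v by (auto simp: touch_def s1_def qsame_def)
    have t3: "tree_at w s3 t"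
      using t1 2(3) by (simp add: tree_at_def s3_def touch_def fun_eq_iff) (simp add: fun_eq_iff[symmetric])
    have P2: "wp w Prefix (\<lambda>n s'. n \<le> 100 * (1 + depth t) \<and> reg s' 20 = wrap w (prefix t ?k2) \<and>
      touch {} {16, 18, 19, 20} s3 s') s3"
      by (rule wp_Prefix[OF t3 _ r0]) (simp add: s3_def)
    show ?case
    proof (rule wp_Seq, rule wp_Asg, simp, simp, simp add: 2, rule wp_Seq, rule wp_Asg, simp, simp, simp add: m2,
        rule wp_Seq, rule wp_TMove, simp add: m2, fold s3_def[unfolded One_nat_def], rule wp_SeqI[OF P2], elim conjE, goal_cases)
      case 4: (1 k4 s4)
      have "qsame s2 s4" "reg s4 23 = wrap w (prefix t ?k1)" "reg s4 21 = int v" "reg s4 22 = reg s 22"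
        using 4(3) m2 by (auto simp: touch_def s3_def qsame_def)
      moreover from qsame_trans[OF q2 this(1)] have "qsame s s4" .
      ultimately show ?case
        using 2(1) 4(1,2) v by (intro wp_Asg) (auto simp: qsame_def)
    qed
  qed
qed

text \<open>Weights may be negative, so the maximum starts with the degree of vertex 0 rather than
  with 0.\<close>

definition Query_loop :: prog where
  "Query_loop = While (Less 21 10) (Seq Vertex_degree
    (Seq (Cond (Eq 21 3) (Asg 22 (Var 23)) (Cond (Less 22 23) (Asg 22 (Var 23)) Skip))
      (Asg 21 (Bin Add (Var 21) (Num 1)))))"

definition Query_code :: prog where
  "Query_code = Seq (Asg 21 (Num 0)) (Seq Query_loop (Asg 0 (Var 22)))"

lemma wp_Query_loop:
  fixes deg :: "nat \<Rightarrow> int"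
  assumes "good w s t" "room w n B" "reg s 10 = int n" "reg s 21 = int v" "v + d = n"
    "\<And>u. u < n \<Longrightarrow> wrap w (prefix t (int u, treg s 0) - prefix t (int u - 1, treg s 3)) = deg u"
    "0 < v \<Longrightarrow> reg s 22 = Max (deg ` {..<v})" "0 < n"
  shows "wp w Query_loop (\<lambda>c s'. c \<le> d * (250 * (1 + depth t)) + 1 \<and> reg s' 22 = Max (deg ` {..<n}) \<and> qsame s s') s"
  using assms
proof (induction d arbitrary: v s)
  case 0
  then show ?case unfolding Query_loop_def by (intro wp_While_False) (auto simp: qsame_def)
next
  case (Suc d)
  let ?P = "\<lambda>b c s'. c \<le> b \<and> reg s' 22 = Max (deg ` {..<n}) \<and> qsame s s'"
  let ?K = "250 * (1 + depth t)"
  have v: "v < n" using Suc.prems(5) by simp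
  have wv: "wrap w (int v + 1) = int v + 1" using room_pred[OF Suc.prems(2) v] by simp
  have w1: "wrap w 1 = 1" by (rule rng_wrap[OF room_rng[OF Suc.prems(2), of 0]]) auto
  have Mx: "Max (deg ` {..<Suc v}) = (if v = 0 then deg v else max (deg v) (Max (deg ` {..<v})))"
    by (cases "v = 0") (simp_all add: lessThan_Suc lessThan_empty_iff)
  have step: "wp w Query_loop (?P (d * ?K + 1)) s2"
    if q: "qsame s s2" and r: "reg s2 21 = int v + 1" "reg s2 22 = Max (deg ` {..<Suc v})" for s2
  proof -
    have "good w s2 t" using q by (intro good_same_mem[OF Suc.prems(1)]) (auto simp: qsame_def)
    then have "wp w Query_loop (\<lambda>c s'. c \<le> d * ?K + 1 \<and> reg s' 22 = Max (deg ` {..<n}) \<and> qsame s2 s') s2"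
      by (rule Suc.IH[of s2 "Suc v"]) (use Suc.prems q r in \<open>auto simp: qsame_def\<close>)
    then show ?thesis by (rule wp_mono) (use qsame_trans[OF q] in auto)
  qed
  have "wp w Query_loop (?P (Suc d * ?K + 1)) s" unfolding Query_loop_def
  proof (rule wp_While_True, simp, simp add: Suc.prems v, fold Query_loop_def,
      rule wp_Seq, rule wp_mono[OF wp_Vertex_degree[OF Suc.prems(1,2,4) v]], elim conjE, goal_cases)
    case 1: (1 k1 s1)
    have q1: "qsame s s1" and r1: "reg s1 23 = deg v" "reg s1 21 = int v" "reg s1 22 = reg s 22" "reg s1 3 = 0"
      using 1 Suc.prems(4,6) Suc.prems(1) v by (auto simp: qsame_def good_def tree_at_def)
    let ?X = "Suc d * ?K + 1"
    have kb: "k1 + 20 + (d * ?K + 1) \<le> ?X" using 1(1) by simp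
    have fin: "wp w (Asg 21 (Bin Add (Var 21) (Num 1))) (\<lambda>m. wp w Query_loop (\<lambda>l. ?P ?X (k1 + 10 + m + l)))
      (s1\<lparr>reg := R\<rparr>)"
      if R: "R 21 = int v" "R 22 = Max (deg ` {..<Suc v})" "\<And>r. r \<noteq> 22 \<Longrightarrow> R r = reg s1 r" for R
    proof -
      have "qsame s (s1\<lparr>reg := R(21 := int v + 1)\<rparr>)" using q1 R(3) by (simp add: qsame_def)
      from step[OF this] have st: "wp w Query_loop (?P (d * ?K + 1)) (s1\<lparr>reg := R(21 := int v + 1)\<rparr>)"
        using R(2) by simp
      show ?thesis
        apply (rule wp_Asg, simp, simp, simp add: R(1) wv w1 del: mult_Suc)
        apply (rule wp_mono[OF st])
        using kb by (simp del: mult_Suc)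
    qed
    show ?case
    proof (rule wp_Seq, rule wp_Cond, goal_cases)
      case 2
      then have "v = 0" using r1 by simp
      then have *: "Max (deg ` {..<Suc v}) = deg v" unfolding Mx by simp
      show ?case
        apply (rule wp_Asg, simp, simp, simp add: r1)
        apply (rule wp_mono[OF fin])
        subgoal by (simp add: r1)
        subgoal using * by simp
        subgoal by simp
        apply (erule wp_mono)
        apply simp
        done
    next
      case 3
      then have v0: "v \<noteq> 0" using r1 by simp
      then have *: "Max (deg ` {..<Suc v}) = max (deg v) (reg s1 22)"
        unfolding Mx using Suc.prems(7) r1 by simp
      show ?case
      proof (rule wp_Cond, goal_cases)
        case 2
        then have lt: "Max (deg ` {..<Suc v}) = deg v" using * r1 by simp
        show ?case
          apply (rule wp_Asg, simp, simp, simp add: r1)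
          apply (rule wp_mono[OF fin])
          subgoal by (simp add: r1)
          subgoal using lt by simp
          subgoal by simp
          apply (erule wp_mono)
          apply simp
          done
      next
        case 3
        then have ge: "Max (deg ` {..<Suc v}) = reg s1 22" using * r1 by simp
        show ?case
          apply (rule wp_Skip)
          apply (rule wp_mono[OF fin[of "reg s1", simplified]])
          subgoal by (simp add: r1)
          subgoal using ge by simp
          apply (erule wp_mono)
          apply simp
          done
      qed simp
    qed simp
  qed
  then show ?case .
qed

text \<open>Stored sums may wrap around, but a degree is a sum of at most \<open>B\<close> changes
  of size at most \<open>B\<close>, so its residue is the degree itself.\<close>

lemma room_degree: "room w n B \<Longrightarrow> \<bar>x\<bar> \<le> int (m * B) \<Longrightarrow> m \<le> B \<Longrightarrow> wrap w x = x"
proof -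
  assume a: "room w n B" "\<bar>x\<bar> \<le> int (m * B)" "m \<le> B"
  have "int (m * B) \<le> int (B * B)" using a(3) by (simp only: of_nat_le_iff mult_right_mono)
  also have "\<dots> < 100 * (int B + 2)\<^sup>2"
  proof -
    have "(int B + 2)\<^sup>2 = int B * int B + 4 * int B + 4" by (simp add: power2_eq_square algebra_simps)
    moreover have "0 \<le> int B * int B" "0 \<le> int B" "int (B * B) = int B * int B" by simp_all
    ultimately show ?thesis by linarith
  qed
  also have "\<dots> \<le> 2 ^ (w - 1)" using a(1) by (simp add: room_def)
  finally have "int (m * B) < 2 ^ (w - 1)" .
  with a(2) show ?thesis by (intro wrap_id) linarith+
qed

lemma wp_Query:
  assumes inv: "Inv w n B S N s" and room: "room w n B" and n: "1 \<le> n"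
  shows "wp w Query_code (\<lambda>c s'. c \<le> 300 * n * (1 + depth_bound (N + 3)) \<and>
    reg s' 0 = max_degree n (graph_at S (treg s 0)) \<and> Inv w n B S N s') s"
proof -
  obtain t where t: "good w s t" "lookup t = entry n S" "nodes t = N"
    and i: "reg s 10 = int n" "reg s 12 = int (card (dom S))" "finite (dom S)" "legal_timeline n B S"
      "\<forall>\<tau> \<in> dom S. \<tau> \<le> treg s 3" "weights n S (mem s)" "N \<le> 6 * card (dom S)" "card (dom S) \<le> B"
    using inv unfolding Inv_def by blast
  let ?deg = "weighted_degree (graph_at S (treg s 0))"
  have o: "ordered t" using t(1) by (simp add: good_def)
  have sup: "{k. entry n S k \<noteq> 0} \<subseteq> set (keys t)"
    using lookup_notin[of _ t] unfolding t(2) by blast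
  have deg: "wrap w (prefix t (int v, treg s 0) - prefix t (int v - 1, treg s 3)) = ?deg v" if "v < n" for v
  proof -
    have "prefix t (int v, treg s 0) - prefix t (int v - 1, treg s 3) = ?deg v"
      unfolding prefix_sum[OF o] t(2)
      by (rule degree_from_prefixes[OF i(3,4) _ sup i(5) that]) simp
    then show ?thesis
      using room_degree[OF room weighted_degree_bound[OF i(3,4)] i(8)] by simp
  qed
  have dN: "depth t \<le> depth_bound (N + 3)" by (rule good_depth[OF t(1)]) (simp add: t(3))
  define s1 where "s1 = s\<lparr>reg := (reg s)(21 := 0)\<rparr>"
  have g1: "good w s1 t" by (rule good_same_mem[OF t(1)]) (simp_all add: s1_def)
  have L: "wp w Query_loop (\<lambda>c s'. c \<le> n * (250 * (1 + depth t)) + 1 \<and> reg s' 22 = Max (?deg ` {..<n}) \<and>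
    qsame s1 s') s1"
    by (rule wp_Query_loop[OF g1 room, where v = 0 and d = n and deg = ?deg]) (use deg n i in \<open>simp_all add: s1_def\<close>)
  show ?thesis unfolding Query_code_def
  proof (rule wp_Seq, rule wp_Asg, simp, simp, simp, fold s1_def, rule wp_SeqI[OF L], elim conjE, goal_cases)
    case (1 c s2)
    have g2: "good w (s2\<lparr>reg := (reg s2)(0 := x)\<rparr>) t" for x
      by (rule good_same_mem[OF g1]) (use 1(3) in \<open>auto simp: qsame_def\<close>)
    have Inv2: "Inv w n B S N (s2\<lparr>reg := (reg s2)(0 := x)\<rparr>)" for x
      unfolding Inv_def using g2[of x] t i 1(3) by (auto simp: qsame_def s1_def)
    let ?E = "n * (1 + depth_bound (N + 3))"
    have "n * (250 * (1 + depth t)) \<le> n * (250 * (1 + depth_bound (N + 3)))"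
      using dN by (intro mult_left_mono) auto
    also have "\<dots> = 250 * ?E" by (rule mult.left_commute)
    finally have "c \<le> 250 * ?E + 1" using 1(1) by linarith
    moreover have "?E \<ge> 1" using n by simp
    moreover have "300 * n * (1 + depth_bound (N + 3)) = 300 * ?E" by (rule mult.assoc)
    ultimately have "c + 10 \<le> 300 * n * (1 + depth_bound (N + 3))" by linarith
    with Inv2 1(2) show ?case by (intro wp_Asg) (auto simp: max_degree_def)
  qed
qed

section \<open>Time bounds\<close>

text \<open>Truncated subtraction makes this 0 once \<open>N\<close> is at most
  \<open>3 * T\<close>, as after a rebuild. The constant is \<open>5000 * 9 * 14\<close>, from the
  cost of a rebuild in \<open>amortized_step\<close>; the summand 2 keeps the logarithm at least
  1.\<close>

definition excess_potential :: "nat \<Rightarrow> nat \<Rightarrow> real" where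
  "excess_potential N T = 630000 * real (N - 3 * T) * log 2 (real (N - 3 * T) + 2)"

lemma lg_ge_1: "1 \<le> lg T"
  by (simp add: lg_def le_log_iff)

text \<open>For \<open>T\<close> up to 2 the argument is at most 26, below \<open>2 ^ 5\<close>; for
  larger \<open>T\<close> it is at most \<open>16 * T\<close>.\<close>

lemma log_le_lg: "real x \<le> 6 * real T + 14 \<Longrightarrow> 0 < x \<Longrightarrow> log 2 (real x) \<le> 5 * lg T"
proof (cases "T \<le> 2")
  case True
  assume "real x \<le> 6 * real T + 14" "0 < x"
  with True have "log 2 (real x) \<le> log 2 (2 ^ 5)" by (intro log_mono) auto
  also have "\<dots> = 5" by (subst log_pow_cancel) auto
  finally show ?thesis using True by (simp add: lg_def)
next
  case False
  assume x: "real x \<le> 6 * real T + 14" "0 < x"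
  with False have "log 2 (real x) \<le> log 2 (2 ^ 4 * real T)" by (intro log_mono) auto
  also have "\<dots> = 4 + log 2 (real T)" using False log_pow_cancel[of 2 4] by (subst log_mult) auto
  also have "\<dots> \<le> 5 * lg T" using lg_ge_1[of T] False by (simp add: lg_def)
  finally show ?thesis .
qed

lemma depth_bound_log: "real (depth_bound N) \<le> 2 * log 2 (real N + 1)"
proof -
  have "0 \<le> log 2 (real N + 1)" by simp
  then have "real (nat \<lfloor>log 2 (real N + 1)\<rfloor>) \<le> log 2 (real N + 1)" by linarith
  then show ?thesis by (simp add: depth_bound_def)
qed

text \<open>\<open>N\<close> belongs to the state before an update and \<open>T\<close> to the one
  after it, which a cancellation makes smaller by 1.\<close>

lemma depth_bound_lg:
  assumes "N \<le> 6 * (T + 1)"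
  shows "1 + real (depth_bound (N + 3)) \<le> 11 * lg T"
proof -
  have "log 2 (real (N + 4)) \<le> 5 * lg T" by (rule log_le_lg) (use assms in auto)
  then show ?thesis using depth_bound_log[of "N + 3"] lg_ge_1[of T] by (simp add: add.commute)
qed

text \<open>An update raises the excess by at most 6: up to three new nodes, and three more when
  \<open>T\<close> falls by 1. The logarithm grows by at most \<open>6 / ((e + 2) * ln 2)\<close>,
  which stays bounded even when multiplied by \<open>e\<close>.\<close>

lemma potential_growth:
  fixes e :: nat
  shows "(real e + 6) * log 2 (real e + 8) \<le> real e * log 2 (real e + 2) + 6 * log 2 (real e + 8) + 12"
proof -
  have "log 2 (real e + 8) - log 2 (real e + 2) = log 2 ((real e + 8) / (real e + 2))"
    by (simp add: log_divide)
  also have "(real e + 8) / (real e + 2) = 1 + 6 / (real e + 2)" by (simp add: field_simps)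
  also have "log 2 (1 + 6 / (real e + 2)) \<le> (6 / (real e + 2)) / ln 2"
    unfolding log_def by (intro divide_right_mono ln_add_one_self_le_self) auto
  also have "\<dots> \<le> (6 / (real e + 2)) * 2"
  proof -
    have "1 / 2 \<le> ln (2::real)" by (rule ln_ge_iff[THEN iffD2, OF _ exp_half_le2]) simp
    then have "1 / ln 2 \<le> (2::real)" by (simp add: field_simps)
    then have "(6 / (real e + 2)) * (1 / ln 2) \<le> (6 / (real e + 2)) * 2" by (intro mult_left_mono) auto
    then show ?thesis by simp
  qed
  finally have "real e * (log 2 (real e + 8) - log 2 (real e + 2)) \<le> real e * ((6 / (real e + 2)) * 2)"
    by (intro mult_left_mono) auto
  also have "\<dots> \<le> 12" by (simp add: field_simps)
  finally show ?thesis by (simp add: algebra_simps)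
qed

lemma excess_potential_nonneg: "0 \<le> excess_potential N T"
  by (simp add: excess_potential_def)

lemma excess_potential_mono: "N - 3 * T \<le> e \<Longrightarrow> excess_potential N T \<le> 630000 * (real e * log 2 (real e + 2))"
  unfolding excess_potential_def mult.assoc
  by (intro mult_left_mono mult_mono log_mono) auto

lemma amortized_step:
  assumes c: "step_cost N T' N' c" and N: "N \<le> 6 * T" and T: "T \<le> T' + 1"
  shows "real c + excess_potential N' T' \<le> excess_potential N T + 30000000 * (lg T')\<^sup>2"
proof -
  let ?D = "1 + depth_bound (N + 3)" and ?e = "N - 3 * T"
  have D: "real ?D \<le> 11 * lg T'" using depth_bound_lg[of N T'] N T by simp
  \<comment> \<open>What the potential does not pay is bounded below by a multiple of
    \<open>lg T'\<close>; this relaxes it to the square.\<close>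
  have lg2: "lg T' \<le> (lg T')\<^sup>2" using lg_ge_1[of T'] by (simp add: power2_eq_square)
  from c consider "N' \<le> N + 3" "c \<le> 5000 * ?D"
    | "6 * T' < N + 3" "N' \<le> 3 * T'" "c \<le> 5000 * ?D * (N + 4)"
    unfolding step_cost_def Let_def by blast
  then show ?thesis
  proof cases
    case 1
    have "excess_potential N' T' \<le> 630000 * (real (?e + 6) * log 2 (real (?e + 6) + 2))"
      by (rule excess_potential_mono) (use 1(1) T in linarith)
    also have "\<dots> \<le> 630000 * (real ?e * log 2 (real ?e + 2) + 6 * log 2 (real ?e + 8) + 12)"
      using potential_growth[of ?e] by (simp only: of_nat_add of_nat_numeral add.assoc) simp
    also have "log 2 (real ?e + 8) \<le> 5 * lg T'"
      using log_le_lg[of "?e + 8" T'] N T by simp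
    finally have "excess_potential N' T' \<le> excess_potential N T + 18900000 * lg T' + 7560000"
      by (simp add: excess_potential_def algebra_simps)
    moreover have "real c \<le> 55000 * lg T'"
    proof -
      have "real c \<le> 5000 * real ?D" using 1(2) by (simp only: of_nat_le_iff[symmetric, where 'a = real] of_nat_mult of_nat_numeral)
      also have "\<dots> \<le> 5000 * (11 * lg T')" by (rule mult_left_mono[OF D]) simp
      finally show ?thesis by simp
    qed
    \<comment> \<open>The coefficients \<open>18900000 = 630000 * 6 * 5\<close>,
      \<open>7560000 = 630000 * 12\<close> and 55000 add up to less than 30000000.\<close>
    ultimately show ?thesis using lg_ge_1[of T'] lg2 by linarith
  next
    case 2
    define e where "e = N - 3 * T"
    let ?L = "log 2 (real e + 2)"
    have L: "1 \<le> ?L" by (simp add: le_log_iff)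
    \<comment> \<open>By \<open>6 * T' < N + 3\<close> and \<open>T \<le> T' + 1\<close> the excess
      is nearly half of the tree or more, so it can pay for visiting all nodes.\<close>
    have Ne: "N \<le> 2 * e + 8" using 2(1) T unfolding e_def by linarith
    have "log 2 (real N + 4) \<le> log 2 (2 ^ 3 * (real e + 2))" using Ne by (intro log_mono) auto
    also have "\<dots> = 3 + ?L" using log_pow_cancel[of 2 3] by (subst log_mult) auto
    finally have "log 2 (real N + 4) \<le> 3 + ?L" .
    moreover have "real (depth_bound (N + 3)) \<le> 2 * log 2 (real N + 4)"
      using depth_bound_log[of "N + 3"] by (simp add: add.commute)
    moreover have "real ?D = 1 + real (depth_bound (N + 3))" by simp
    ultimately have "real ?D \<le> 9 * ?L" using L by linarith
    then have "real ?D * real (N + 4) \<le> (9 * ?L) * (2 * real e + 12)"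
      using Ne L by (intro mult_mono) auto
    moreover have "real c \<le> 5000 * (real ?D * real (N + 4))"
      using 2(3) by (simp only: of_nat_le_iff[symmetric, where 'a = real] of_nat_mult of_nat_numeral mult.assoc)
    ultimately have c: "real c \<le> 5000 * ((9 * ?L) * (2 * real e + 12))" by linarith
    have z: "excess_potential N' T' = 0" using 2(2) by (simp add: excess_potential_def)
    show ?thesis
    proof (cases "e = 0")
      \<comment> \<open>Without excess the potential pays nothing, but then the tree has at most 8
        nodes and the rebuild costs a constant.\<close>
      case True
      then have "real c \<le> 540000" using c by simp
      then show ?thesis using z excess_potential_nonneg[of N T] lg_ge_1[of T'] lg2 by linarith
    next
      case False
      then have "2 * real e + 12 \<le> 14 * real e" by simp
      then have "(9 * ?L) * (2 * real e + 12) \<le> (9 * ?L) * (14 * real e)"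
        using L by (intro mult_left_mono) auto
      with c have "real c \<le> 5000 * ((9 * ?L) * (14 * real e))" by linarith
      also have "\<dots> = excess_potential N T" by (simp add: excess_potential_def e_def[symmetric])
      finally have "real c \<le> excess_potential N T" .
      moreover have "0 \<le> 30000000 * (lg T')\<^sup>2" by simp
      ultimately show ?thesis using z by linarith
    qed
  qed
qed

section \<open>Runs of the data structure\<close>

lemma wp_exec:
  assumes "wp w p Q s" "wrapped w s"
  shows "\<exists>k t s'. exec w p s k t \<and> wrapped w t \<and> sim s' t \<and> Q k s'"
proof -
  obtain k t s' where "exec w p s k t" "sim s' t" "Q k s'"
    using assms unfolding wp_def by (meson sim_refl)
  then show ?thesis using exec_wrapped assms(2) by blast
qed

lemma Inv_cong:
  assumes "Inv w n B S N s" "mem s' = mem s" "tmem s' = tmem s" "treg s' 3 = treg s 3"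
    "\<forall>r \<in> {3, 10, 11, 12}. reg s' r = reg s r"
  shows "Inv w n B S N s'"
  using assms(1) good_same_mem[of w s _ s'] assms(2-) unfolding Inv_def by auto

lemma Inv_sim: "Inv w n B S N s \<Longrightarrow> sim s t \<Longrightarrow> Inv w n B S N t"
  by (erule Inv_cong) (auto simp: sim_def)

lemma Inv_pass: "Inv w n B S N s \<Longrightarrow> Inv w n B S N (pass_args w r s)"
  by (erule Inv_cong; cases "(w, r, s)" rule: pass_args.cases) (auto simp: set_reg_def set_treg_def)

lemma wrapped_pass: "wrapped w s \<Longrightarrow> wrapped w (pass_args w r s)"
  by (cases "(w, r, s)" rule: pass_args.cases) (auto simp: set_reg_def set_treg_def wrapped_def)

definition degree_structure :: data_structure where
  "degree_structure = \<lparr>init_code = Asg 10 (Var 0), insert_code = Insert_code, delete_code = Delete_code,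
     cancel_code = Cancel_code, query_code = Query_code\<rparr>"

lemma serve_request:
  assumes inv: "Inv w n B S N s" and wr: "wrapped w s" and room: "room w n B" and n: "1 \<le> n"
    and create: "\<And>a t. r = Create a t \<Longrightarrow> t \<notin> dom S" and cancel: "\<And>t. r = Cancel t \<Longrightarrow> t \<in> dom S"
  defines "S' \<equiv> apply_request r S"
  assumes S': "legal_timeline n B S'" "card (dom S') \<le> B"
  shows "\<exists>k s' N'. exec w (request_code degree_structure r) (pass_args w r s) k s' \<and> wrapped w s' \<and>
    Inv w n B S' N' s' \<and>
    (if is_query r then N' = N \<and> k \<le> 300 * n * (1 + depth_bound (N + 3))
     else step_cost N (card (dom S')) N' k) \<and>
    (\<forall>t. r = Query t \<longrightarrow> reg s' 0 = max_degree n (graph_at S t))"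
proof -
  let ?s = "pass_args w r s"
  have inv': "Inv w n B S N ?s" by (rule Inv_pass[OF inv])
  have fin: "finite (dom S)" using inv by (simp add: Inv_def)
  have fin': "finite (dom S')" using fin unfolding S'_def by (cases r) auto
  have by_wp: ?thesis
    if "wp w (request_code degree_structure r) (\<lambda>k s'. (\<exists>N'. Inv w n B S' N' s' \<and>
      (if is_query r then N' = N \<and> k \<le> 300 * n * (1 + depth_bound (N + 3))
       else step_cost N (card (dom S')) N' k)) \<and>
      (\<forall>t. r = Query t \<longrightarrow> reg s' 0 = max_degree n (graph_at S t))) ?s"
  proof -
    from wp_exec[OF that wrapped_pass[OF wr]] obtain k t s' N' where
      1: "exec w (request_code degree_structure r) ?s k t" "wrapped w t" "sim s' t" "Inv w n B S' N' s'"
      "if is_query r then N' = N \<and> k \<le> 300 * n * (1 + depth_bound (N + 3))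
       else step_cost N (card (dom S')) N' k"
      "\<forall>t. r = Query t \<longrightarrow> reg s' 0 = max_degree n (graph_at S t)" by blast
    have "reg t 0 = reg s' 0" using 1(3) by (simp add: sim_def)
    with 1 Inv_sim[OF 1(4,3)] show ?thesis by metis
  qed
  show ?thesis
  proof (cases "(w, r, s)" rule: pass_args.cases)
    case (1 w' u v x t s0)
    then have r: "r = Create (Insert u v x) t" by simp
    note S'' = S'[unfolded S'_def r apply_request.simps]
    have uv: "u < n" "v < n" "\<bar>x\<bar> \<le> int B"
      using legal_timelineD[OF S''(1), of t "Insert u v x"] by simp_all
    have "wp w Insert_code (\<lambda>c s'. \<exists>N'. Inv w n B (S(t \<mapsto> Insert u v x)) N' s' \<and>
      step_cost N (card (dom (S(t \<mapsto> Insert u v x)))) N' c) ?s"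
      by (rule wp_Insert[OF inv' room _ _ _ _ create[OF r] S''])
        (use r room_n[OF room uv(1)] room_n[OF room uv(2)] room_B[OF room uv(3)] in
          \<open>simp_all add: set_reg_def set_treg_def\<close>)
    then show ?thesis by (intro by_wp) (simp add: r S'_def degree_structure_def)
  next
    case (2 w' u v t s0)
    then have r: "r = Create (Delete u v) t" by simp
    note S'' = S'[unfolded S'_def r apply_request.simps]
    have uv: "u < n" "v < n"
      using legal_ends[OF S''(1), of t "Delete u v"] fin by simp_all
    have "wp w Delete_code (\<lambda>c s'. \<exists>N'. Inv w n B (S(t \<mapsto> Delete u v)) N' s' \<and>
      step_cost N (card (dom (S(t \<mapsto> Delete u v)))) N' c) ?s"
      by (rule wp_Delete[OF inv' room _ _ _ create[OF r] S''])
        (use r room_n[OF room uv(1)] room_n[OF room uv(2)] in \<open>simp_all add: set_reg_def set_treg_def\<close>)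
    then show ?thesis by (intro by_wp) (simp add: r S'_def degree_structure_def)
  next
    case (3 w' t s0)
    then have r: "r = Cancel t" by simp
    note S'' = S'[unfolded S'_def r apply_request.simps]
    obtain a where a: "S t = Some a" using cancel[OF r] by auto
    have "wp w Cancel_code (\<lambda>c s'. \<exists>N'. Inv w n B (S(t := None)) N' s' \<and>
      step_cost N (card (dom (S(t := None)))) N' c) ?s"
      by (rule wp_Cancel[OF inv' room _ a S''(1)]) (use r in \<open>simp add: set_treg_def\<close>)
    then show ?thesis by (intro by_wp) (simp add: r S'_def degree_structure_def)
  next
    case (4 w' t s0)
    then have r: "r = Query t" by simp
    have t: "treg ?s 0 = t" by (simp add: r set_treg_def)
    have "wp w Query_code (\<lambda>c s'. c \<le> 300 * n * (1 + depth_bound (N + 3)) \<and>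
      reg s' 0 = max_degree n (graph_at S t) \<and> Inv w n B S N s') ?s"
      using wp_Query[OF inv' room n] unfolding t .
    then show ?thesis by (intro by_wp) (simp add: r S'_def degree_structure_def conj_ac)
  qed
qed

lemma card_apply_request: "finite (dom S) \<Longrightarrow> card (dom S) \<le> card (dom (apply_request r S)) + 1"
proof (cases r)
  case (Create a t)
  assume "finite (dom S)"
  with Create show ?thesis by (simp add: card_insert_if)
next
  case (Cancel t)
  assume "finite (dom S)"
  with Cancel show ?thesis using card_Suc_Diff1[of "dom S" t] by (cases "t \<in> dom S") simp_all
qed simp

lemma sum_filter_Suc:
  fixes g :: "nat \<Rightarrow> real"
  shows "(\<Sum>i \<in> {i. i < Suc m \<and> Q i}. g i) = (if Q 0 then g 0 else 0) + (\<Sum>i \<in> {i. i < m \<and> Q (Suc i)}. g (Suc i))"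
proof -
  have filter: "(\<Sum>i \<in> {i. i < m \<and> Q i}. g i) = (\<Sum>i<m. if Q i then g i else 0)" for Q g and m :: nat
    using sum.inter_filter[of "{..<m}" g Q] by simp
  show ?thesis unfolding filter by (rule sum.lessThan_Suc_shift)
qed

text \<open>The list is cut so that the induction on \<open>suf\<close> starts from the timeline
  after \<open>pre\<close>, while sizes still refer to the whole list. The potential of the starting
  state is on the right; the final one is dropped, being nonnegative.\<close>

lemma serve_requests:
  assumes room: "room w n B" and n: "1 \<le> n"
    and "legal_requests n B (pre @ suf)" "Inv w n B (timeline_after pre) N s" "wrapped w s"
  defines "f \<equiv> \<lambda>i. size_after (pre @ suf) (length pre + i)"
  shows "\<exists>tr. serve w degree_structure s suf tr \<and>
    (\<forall>i < length suf. \<forall>t. suf ! i = Query t \<longrightarrow>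
       snd (tr ! i) = max_degree n (graph_at (timeline_after (take (length pre + i) (pre @ suf))) t)) \<and>
    (\<forall>i < length suf. is_query (suf ! i) \<longrightarrow> real (fst (tr ! i)) \<le> 30000000 * real n * lg (f i)) \<and>
    (\<Sum>i \<in> {i. i < length suf \<and> \<not> is_query (suf ! i)}. real (fst (tr ! i))) \<le>
      excess_potential N (card (dom (timeline_after pre))) +
      (\<Sum>i \<in> {i. i < length suf \<and> \<not> is_query (suf ! i)}. 30000000 * (lg (f i))\<^sup>2)"
  unfolding f_def using assms(3-5)
proof (induction suf arbitrary: pre s N)
  case Nil
  show ?case by (intro exI[of _ "[]"]) (auto intro: serve_Nil excess_potential_nonneg)
next
  case (Cons r suf)
  let ?S = "timeline_after pre" let ?S' = "timeline_after (pre @ [r])"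
  let ?f = "\<lambda>i. size_after (pre @ r # suf) (length pre + i)"
  have S': "?S' = apply_request r ?S" by (simp add: timeline_after_def)
  have leg: "let S = timeline_after (take (length pre) (pre @ r # suf));
      S' = timeline_after (take (Suc (length pre)) (pre @ r # suf)) in
    (\<forall>u t. (pre @ r # suf) ! length pre = Create u t \<longrightarrow> t \<notin> dom S) \<and>
    (\<forall>t. (pre @ r # suf) ! length pre = Cancel t \<longrightarrow> t \<in> dom S) \<and>
    legal_timeline n B S' \<and> card (dom S') \<le> B"
    by (rule mp[OF spec[OF Cons.prems(1)[unfolded legal_requests_def]]]) simp
  then have leg: "r = Create a t \<Longrightarrow> t \<notin> dom ?S" "r = Cancel t \<Longrightarrow> t \<in> dom ?S"
    "legal_timeline n B (apply_request r ?S)" "card (dom (apply_request r ?S)) \<le> B" for a t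
    unfolding Let_def S'[symmetric] by auto
  obtain k s' N' where 1: "exec w (request_code degree_structure r) (pass_args w r s) k s'" "wrapped w s'"
    "Inv w n B ?S' N' s'"
    "if is_query r then N' = N \<and> k \<le> 300 * n * (1 + depth_bound (N + 3))
     else step_cost N (card (dom ?S')) N' k"
    "\<forall>t. r = Query t \<longrightarrow> reg s' 0 = max_degree n (graph_at ?S t)"
    using serve_request[OF Cons.prems(2,3) room n _ _ leg(3,4)] leg(1,2) unfolding S' by blast
  obtain tr where tr: "serve w degree_structure s' suf tr"
    "\<forall>i < length suf. \<forall>t. suf ! i = Query t \<longrightarrow>
       snd (tr ! i) = max_degree n (graph_at (timeline_after (take (length (pre @ [r]) + i) ((pre @ [r]) @ suf))) t)"
    "\<forall>i < length suf. is_query (suf ! i) \<longrightarrow> real (fst (tr ! i)) \<le> 30000000 * real n *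
       lg (size_after ((pre @ [r]) @ suf) (length (pre @ [r]) + i))"
    "(\<Sum>i \<in> {i. i < length suf \<and> \<not> is_query (suf ! i)}. real (fst (tr ! i))) \<le>
      excess_potential N' (card (dom ?S')) + (\<Sum>i \<in> {i. i < length suf \<and> \<not> is_query (suf ! i)}.
        30000000 * (lg (size_after ((pre @ [r]) @ suf) (length (pre @ [r]) + i)))\<^sup>2)"
    using Cons.IH[of "pre @ [r]" N' s'] Cons.prems(1) 1(2,3) by auto
  have f: "size_after ((pre @ [r]) @ suf) (length (pre @ [r]) + i) = ?f (Suc i)" for i by simp
  have f0: "?f 0 = card (dom ?S')" by (simp add: size_after_def)
  have T: "N \<le> 6 * card (dom ?S)" "finite (dom ?S)" using Cons.prems(2) by (auto simp: Inv_def)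
  let ?tr = "(k, reg s' 0) # tr"
  have q: "real k \<le> 30000000 * real n * lg (?f 0)" if "is_query r"
  proof -
    have "?S' = ?S" using that S' by (cases r) auto
    then have "1 + real (depth_bound (N + 3)) \<le> 11 * lg (?f 0)" using T f0 by (intro depth_bound_lg) auto
    then have "real n * (1 + real (depth_bound (N + 3))) \<le> real n * (11 * lg (?f 0))"
      by (intro mult_left_mono) auto
    also have "\<dots> = 11 * (real n * lg (?f 0))" by (rule mult.left_commute)
    finally have "real n * (1 + real (depth_bound (N + 3))) \<le> 11 * (real n * lg (?f 0))" .
    moreover have "real k \<le> 300 * (real n * (1 + real (depth_bound (N + 3))))"
    proof -
      have "real k \<le> real (300 * n * (1 + depth_bound (N + 3)))"
        using 1(4) that by (simp only: if_True of_nat_le_iff)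
      then show ?thesis by (simp only: of_nat_mult of_nat_add of_nat_numeral of_nat_1 mult.assoc)
    qed
    moreover have "0 \<le> real n * lg (?f 0)" using lg_ge_1[of "?f 0"] by simp
    ultimately have "real k \<le> 30000000 * (real n * lg (?f 0))" by linarith
    then show ?thesis by (simp only: mult.assoc)
  qed
  have u: "real k + excess_potential N' (card (dom ?S')) \<le>
      excess_potential N (card (dom ?S)) + 30000000 * (lg (?f 0))\<^sup>2" if "\<not> is_query r"
    unfolding f0 by (rule amortized_step[OF _ T(1)])
      (use that 1(4) card_apply_request[OF T(2), of r] S' in simp_all)
  have same: "excess_potential N' (card (dom ?S')) = excess_potential N (card (dom ?S))" if "is_query r"
    using that 1(4) S' by (cases r) auto
  show ?case
  proof (intro exI[of _ ?tr] conjI)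
    show "serve w degree_structure s (r # suf) ?tr" using 1(1) tr(1) by (rule serve_Cons)
    show "\<forall>i < length (r # suf). \<forall>t. (r # suf) ! i = Query t \<longrightarrow>
       snd (?tr ! i) = max_degree n (graph_at (timeline_after (take (length pre + i) (pre @ r # suf))) t)"
    proof (intro allI impI)
      fix i t assume "i < length (r # suf)" "(r # suf) ! i = Query t"
      then show "snd (?tr ! i) = max_degree n (graph_at (timeline_after (take (length pre + i) (pre @ r # suf))) t)"
        using 1(5) tr(2) by (cases i) auto
    qed
    show "\<forall>i < length (r # suf). is_query ((r # suf) ! i) \<longrightarrow>
      real (fst (?tr ! i)) \<le> 30000000 * real n * lg (?f i)"
    proof (intro allI impI)
      fix i assume "i < length (r # suf)" "is_query ((r # suf) ! i)"
      then show "real (fst (?tr ! i)) \<le> 30000000 * real n * lg (?f i)"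
        using q tr(3) unfolding f by (cases i) auto
    qed
    show "(\<Sum>i \<in> {i. i < length (r # suf) \<and> \<not> is_query ((r # suf) ! i)}. real (fst (?tr ! i))) \<le>
      excess_potential N (card (dom ?S)) +
      (\<Sum>i \<in> {i. i < length (r # suf) \<and> \<not> is_query ((r # suf) ! i)}. 30000000 * (lg (?f i))\<^sup>2)"
      unfolding list.size(4) One_nat_def add_Suc_right add_0_right sum_filter_Suc
      using tr(4) u same unfolding f by (cases "is_query r") auto
  qed
qed

text \<open>With \<open>l = floorlog 2 n\<close> everything is bounded by powers of
  \<open>2 ^ l\<close>, up to the factor \<open>100 * 9\<close>, which is below
  \<open>2 ^ 10\<close>. As \<open>l\<close> is at least 1 even for \<open>n = 1\<close>, the
  multiple \<open>20 * l\<close> absorbs this factor.\<close>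

lemma room_exists:
  assumes "1 \<le> n"
  shows "room ((2 * c + 20) * floorlog 2 n) n (n ^ c)"
proof -
  let ?l = "floorlog 2 n" let ?w = "(2 * c + 20) * ?l"
  have n: "n < 2 ^ ?l" using floorlog_bounds[of n 2] assms by simp
  then have l: "1 \<le> ?l" using assms by (cases ?l) auto
  have "(2 * c + 20) * ?l = 2 * (c * ?l) + 2 * ?l + 18 * ?l" by (simp add: algebra_simps)
  then have w: "2 * (c * ?l) + 10 \<le> ?w - 1" "2 * ?l \<le> ?w - 1" using l by linarith+
  have B: "int (n ^ c) \<le> 2 ^ (c * ?l)"
  proof -
    have "n ^ c \<le> (2 ^ ?l) ^ c" using n by (intro power_mono) auto
    then have "int (n ^ c) \<le> int ((2 ^ ?l) ^ c)" by (simp only: of_nat_le_iff)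
    then show ?thesis by (simp add: power_mult[symmetric] mult.commute)
  qed
  have "(1 :: int) \<le> 2 ^ (c * ?l)" by simp
  with B have "int (n ^ c) + 2 \<le> 3 * 2 ^ (c * ?l)" by linarith
  then have "(int (n ^ c) + 2)\<^sup>2 \<le> (3 * 2 ^ (c * ?l))\<^sup>2" by (intro power_mono) auto
  moreover have "(3 * 2 ^ (c * ?l) :: int)\<^sup>2 = 9 * 2 ^ (2 * (c * ?l))"
    by (simp add: power_mult_distrib power_mult[symmetric] mult.commute)
  moreover have "(0 :: int) \<le> 2 ^ (2 * (c * ?l))" by simp
  ultimately have "100 * (int (n ^ c) + 2)\<^sup>2 \<le> 1024 * 2 ^ (2 * (c * ?l))" by linarith
  also have "\<dots> = 2 ^ (2 * (c * ?l) + 10)" by (simp add: power_add)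
  also have "\<dots> \<le> 2 ^ (?w - 1)" using w(1) by (intro power_increasing) auto
  finally have 1: "100 * (int (n ^ c) + 2)\<^sup>2 \<le> 2 ^ (?w - 1)" .
  have "int n + 1 \<le> 2 ^ ?l"
  proof -
    have "int (n + 1) \<le> int (2 ^ ?l)" using n by (simp only: of_nat_le_iff)
    then show ?thesis by simp
  qed
  then have "(int n + 1)\<^sup>2 \<le> (2 ^ ?l)\<^sup>2" by (intro power_mono) auto
  also have "\<dots> = 2 ^ (2 * ?l)" by (simp add: power_mult[symmetric] mult.commute)
  also have "\<dots> \<le> 2 ^ (?w - 1)" using w(2) by (intro power_increasing) auto
  finally show ?thesis using 1 by (simp add: room_def)
qed

text \<open>Zeroed memory already represents the empty tree with its sentinel. Only \<open>n\<close>
  has to be saved, so the set-up takes constant time.\<close>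

lemma initialised:
  assumes room: "room w n B"
  shows "\<exists>s. exec w (init_code degree_structure) (start_state w n) 2 s \<and> wrapped w s \<and>
    Inv w n B (timeline_after []) 0 s"
proof -
  let ?s = "start_state w n"
  have n: "int n < 2 ^ (w - 1)"
  proof -
    have "int n < (int n + 1) * 1" by simp
    also have "\<dots> \<le> (int n + 1)\<^sup>2" unfolding power2_eq_square by (intro mult_left_mono) auto
    also have "\<dots> \<le> 2 ^ (w - 1)" using room by (simp add: room_def)
    finally show ?thesis .
  qed
  have wn: "wrap w (int n) = int n" by (rule wrap_id) (use n in \<open>auto intro: order_trans[of _ 0]\<close>)
  have wr: "wrapped w ?s" by (simp add: start_state_def wrapped_def set_reg_def)
  have r0: "rng w 0" by (rule room_rng[OF room]) auto
  have g: "good w (?s\<lparr>reg := (reg ?s)(10 := int n)\<rparr>) Lf"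
    using r0 by (auto simp: good_def tree_at_def start_state_def set_reg_def ordered_def intro: aa_Lf)
  have "Inv w n B Map.empty 0 (?s\<lparr>reg := (reg ?s)(10 := int n)\<rparr>)"
    unfolding Inv_def using g
    by (auto simp: entry_def start_state_def set_reg_def legal_timeline_def weights_def intro!: exI[of _ "Lf"])
  then have "wp w (Asg 10 (Var 0)) (\<lambda>k s'. k = 2 \<and> Inv w n B Map.empty 0 s') ?s"
    by (intro wp_Asg) (simp_all add: start_state_def set_reg_def wn)
  from wp_exec[OF this wr] show ?thesis
    using Inv_sim by (auto simp: degree_structure_def timeline_after_def)
qed

theorem theorem6:
  shows "\<exists>(D :: data_structure) (C :: real). \<forall>c :: nat. \<exists>a :: nat. \<forall>n \<ge> 1.
    let w = a * floorlog 2 n in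
      \<exists>k s. exec w (init_code D) (start_state w n) k s \<and> real k \<le> C * real n \<and>
        (\<forall>rs. legal_requests n (n ^ c) rs \<longrightarrow>
          (\<exists>tr. serve w D s rs tr \<and>
             correct_answers n rs tr \<and>
             amortized_update_time (\<lambda>T. C * (lg T)\<^sup>2) rs tr \<and>
             worst_case_query_time (\<lambda>T. C * real n * lg T) rs tr))"
proof (intro exI[of _ degree_structure] exI[of _ "30000000 :: real"] allI, goal_cases)
  case (1 c)
  show ?case
  proof (intro exI[of _ "2 * c + 20"] allI impI, goal_cases)
    case n: (1 n)
    let ?w = "(2 * c + 20) * floorlog 2 n"
    have room: "room ?w n (n ^ c)" by (rule room_exists[OF n])
    obtain s where s: "exec ?w (init_code degree_structure) (start_state ?w n) 2 s" "wrapped ?w s"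
      "Inv ?w n (n ^ c) (timeline_after []) 0 s" using initialised[OF room] by blast
    \<comment> \<open>The empty structure has potential 0, so the amortized bounds sum up to a bound
      on the total time.\<close>
    have "excess_potential 0 T = 0" for T by (simp add: excess_potential_def)
    with serve_requests[OF room n, of "[]", simplified, OF _ s(3,2)] s(1) n show ?case
      unfolding Let_def correct_answers_def amortized_update_time_def worst_case_query_time_def
      by (intro exI[of _ 2] exI[of _ s]) (auto, blast)
  qed
qed

end
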